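(* Let $n\ge 3$ and let $M$ be an $n$-dimensional $C$-totally real submanifold of a $(2m+1)$-dimensional generalized $(\kappa,\mu)$-contact space form $\tilde M(f_1,\ldots,f_6)$ satisfying $f_3=f_1-1$. Then for each point $p\in M$: (1) For every unit vector $U\in T_pM$, $$\operatorname{Ric}(U)\le\tfrac14n^2\|H\|^2+(n-1)f_1.$$ (2) If $H(p)=0$, then a unit tangent vector $U\in T_pM$ satisfies $\operatorname{Ric}(U)=(n-1)f_1$ if and only if $U$ belongs to the relative null space $\mathcal N_p$. (3) At $p$, $$4S\le\big(n^2\|H\|^2+4(n-1)f_1\big)g$$ as symmetric bilinear forms on $T_pM$, where $S$ is the Ricci tensor of $M$ and $g$ is its Riemannian metric. Equality holds in this inequality at $p$ if and only if either $p$ is a totally geodesic point or $n=2$ and $p$ is a totally umbilical point.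
   Context: An almost contact metric manifold $(\tilde M,\phi,\xi,\eta,\langle,\rangle)$ is a manifold with a $(1,1)$-tensor field $\phi$, a vector field $\xi$, a 1-form $\eta$ and a Riemannian metric $\langle,\rangle$ satisfying $\phi^2=-I+\eta\otimes\xi$, $\eta(\xi)=1$, $\eta\circ\phi=0$, $\phi\xi=0$, $\langle X,Y\rangle=\langle\phi X,\phi Y\rangle+\eta(X)\eta(Y)$, $\langle X,\xi\rangle=\eta(X)$, $\langle X,\phi Y\rangle=-\langle\phi X,Y\rangle$. It is a contact metric manifold if $d\eta(X,Y)=\langle X,\phi Y\rangle$. Put $2h=\mathcal L_\xi\phi$ (Lie derivative). On a contact metric manifold $h$ is symmetric, $h\xi=0$, $h\phi+\phi h=0$, $\operatorname{trace}h=\operatorname{trace}(\phi h)=0$, and $\tilde\nabla_X\xi=-\phi X-\phi hX$ (this fixes the normalization of $d\eta$). A generalized $(\kappa,\mu)$-space form, denoted $\tilde M(f_1,\dots,f_6)$, is an almost contact metric manifold with differentiable functions $f_1,\dots,f_6$ on $\tilde M$ such that its curvature tensor is $\tilde R=\sum_{i=1}^6f_iR_i$, where $R_1(X,Y)Z=\langle Y,Z\rangle X-\langle X,Z\rangle Y$; $R_2(X,Y)Z=\langle X,\phi Z\rangle\phi Y-\langle Y,\phi Z\rangle\phi X+2\langle X,\phi Y\rangle\phi Z$; $R_3(X,Y)Z=\eta(X)\eta(Z)Y-\eta(Y)\eta(Z)X+\langle X,Z\rangle\eta(Y)\xi-\langle Y,Z\rangle\eta(X)\xi$; $R_4(X,Y)Z=\langle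 Y,Z\rangle hX-\langle X,Z\rangle hY+\langle hY,Z\rangle X-\langle hX,Z\rangle Y$; $R_5(X,Y)Z=\langle hY,Z\rangle hX-\langle hX,Z\rangle hY+\langle\phi hX,Z\rangle\phi hY-\langle\phi hY,Z\rangle\phi hX$; $R_6(X,Y)Z=\eta(X)\eta(Z)hY-\eta(Y)\eta(Z)hX+\langle hX,Z\rangle\eta(Y)\xi-\langle hY,Z\rangle\eta(X)\xi$. It is called a generalized $(\kappa,\mu)$-contact space form when the structure is contact metric. Curvature convention: $\tilde R(X,Y,Z,W)=\langle\tilde R(X,Y)Z,W\rangle$, and the sectional curvature of the plane spanned by orthonormal $X,Y$ is $\tilde R(X,Y,Y,X)$ (similarly for $M$). A submanifold $M$ of a contact metric manifold $\tilde M$ is $C$-totally real if $\xi$ is normal to $M$ (every tangent vector lies in the contact distribution $\ker\eta$). $M$ carries the induced metric; $\sigma$ is its second fundamental form and $H=\frac1n\operatorname{trace}(\sigma)$ the mean curvature vector. The Ricci curvature of $M$ at a unit vector $U\in T_pM$ is $\operatorname{Ric}(U)=S(U,U)=\sum_{j=2}^nK(e_1\wedge e_j)$, where $\{e_1=U,e_2,\dots,e_n\}$ is an orthonormal basis of $T_pM$ and $K$ is the sectional curvature of $M$. The relative null space at $p$ is $\mathcal N_p=\{X\in T_pM:\sigma(X,Y)=0\ \forall Y\in T_pM\}$. A point $p$ is totally geodesic if $\sigma=0$ at $p$, and totally umbilical if $\sigma(X,Y)=\langle X,Y\rangle H$ for all $X,Y\in T_pM$. All quantities are evaluated at $p$.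 *)

theory Defs
  imports "HOL-Analysis.Analysis" "HOL-Library.Function_Algebras"
begin

section \<open>Pointwise vector space structure on functions\<close>

instantiation "fun" :: (type, real_vector) real_vector
begin

definition scaleR_fun :: "real \<Rightarrow> ('a \<Rightarrow> 'b) \<Rightarrow> 'a \<Rightarrow> 'b"
  where "scaleR_fun r f = (\<lambda>x. r *\<^sub>R f x)"

instance
  by standard (auto simp: scaleR_fun_def fun_eq_iff algebra_simps)

end


section \<open>Smooth manifolds\<close>

text \<open>Class \<open>C\<^sup>k\<close>, by iterated directional derivatives; meant for open \<open>S\<close>.\<close>

primrec ck_on :: "'e::euclidean_space set \<Rightarrow> ('e \<Rightarrow> 'v::real_normed_vector) \<Rightarrow> nat \<Rightarrow> bool" where
  "ck_on S f 0 \<longleftrightarrow> continuous_on S f"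
| "ck_on S f (Suc k) \<longleftrightarrow>
     (\<forall>x\<in>S. f differentiable (at x)) \<and>
     (\<forall>v. ck_on S (\<lambda>x. frechet_derivative f (at x) v) k)"

definition smooth_on :: "'e::euclidean_space set \<Rightarrow> ('e \<Rightarrow> 'v::real_normed_vector) \<Rightarrow> bool"
  where "smooth_on S f \<longleftrightarrow> (\<forall>k. ck_on S f k)"

text \<open>A chart is a pair of its domain and its coordinate map; the values of the map outside
  the domain are irrelevant. A manifold is a topological space (a type) with a smooth atlas,
  and its dimension is the dimension of the model space \<open>'e\<close>. Atlases need not be maximal.\<close>

type_synonym ('a, 'e) chart = "'a set \<times> ('a \<Rightarrow> 'e)"

abbreviation cdom :: "('a, 'e) chart \<Rightarrow> 'a set" where "cdom \<equiv> fst"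
abbreviation coord :: "('a, 'e) chart \<Rightarrow> 'a \<Rightarrow> 'e" where "coord \<equiv> snd"
abbreviation cimg :: "('a, 'e) chart \<Rightarrow> 'e set" where "cimg C \<equiv> coord C ` cdom C"
abbreviation cinv :: "('a, 'e) chart \<Rightarrow> 'e \<Rightarrow> 'a" where "cinv C \<equiv> inv_into (cdom C) (coord C)"

definition is_chart :: "('a::topological_space, 'e::euclidean_space) chart \<Rightarrow> bool"
  where "is_chart C \<longleftrightarrow> open (cdom C) \<and> open (cimg C) \<and>
    homeomorphism (cdom C) (cimg C) (coord C) (cinv C)"

definition smooth_manifold ::
    "('a::{t2_space,second_countable_topology}, 'e::euclidean_space) chart set \<Rightarrow> bool"
  where "smooth_manifold A \<longleftrightarrow>
    (\<forall>C\<in>A. is_chart C) \<and> (\<Union>C\<in>A. cdom C) = UNIV \<and>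
    (\<forall>C\<in>A. \<forall>D\<in>A. smooth_on (coord C ` (cdom C \<inter> cdom D)) (coord D \<circ> cinv C))"

definition charts_at :: "('a, 'e) chart set \<Rightarrow> 'a \<Rightarrow> ('a, 'e) chart set"
  where "charts_at A p = {C \<in> A. p \<in> cdom C}"

definition chart_at :: "('a, 'e) chart set \<Rightarrow> 'a \<Rightarrow> ('a, 'e) chart"
  where "chart_at A p = (SOME C. C \<in> charts_at A p)"

definition smooth_map ::
    "('b::topological_space, 'f::euclidean_space) chart set \<Rightarrow>
     ('a::topological_space, 'e::euclidean_space) chart set \<Rightarrow> ('b \<Rightarrow> 'a) \<Rightarrow> bool"
  where "smooth_map B A F \<longleftrightarrow> continuous_on UNIV F \<and>
    (\<forall>C\<in>B. \<forall>D\<in>A. smooth_on (coord C ` (cdom C \<inter> F -` cdom D)) (coord D \<circ> F \<circ> cinv C))"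

definition differentiable_fun :: "('a, 'e::euclidean_space) chart set \<Rightarrow> ('a \<Rightarrow> real) \<Rightarrow> bool"
  where "differentiable_fun A f \<longleftrightarrow> (\<forall>C\<in>A. (f \<circ> cinv C) differentiable_on cimg C)"


section \<open>Tangent vectors and vector fields\<close>

text \<open>A tangent vector at \<open>p\<close> is a family \<open>v\<close> of component vectors, \<open>v C\<close> being the
  components with respect to the chart \<open>C\<close> around \<open>p\<close>, which transforms with the derivatives of
  the changes of charts; it is set to \<open>0\<close> at all other arguments.\<close>

type_synonym ('a, 'e) tangent = "('a, 'e) chart \<Rightarrow> 'e"
type_synonym ('a, 'e) vfield = "'a \<Rightarrow> ('a, 'e) tangent"

definition tangent_space ::
    "('a, 'e::euclidean_space) chart set \<Rightarrow> 'a \<Rightarrow> ('a, 'e) tangent set"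
  where "tangent_space A p =
    {v. (\<forall>C. C \<notin> charts_at A p \<longrightarrow> v C = 0) \<and>
        (\<forall>C\<in>charts_at A p. \<forall>D\<in>charts_at A p.
           v D = frechet_derivative (coord D \<circ> cinv C) (at (coord C p)) (v C))}"

text \<open>\<open>coord_field A C a\<close> is the vector field on the domain of the chart \<open>C\<close> whose components
  with respect to \<open>C\<close> are constant, equal to \<open>a\<close>; its value at \<open>p\<close> is the tangent vector at
  \<open>p\<close> with components \<open>a\<close> in \<open>C\<close>.\<close>

definition coord_field ::
    "('a, 'e::euclidean_space) chart set \<Rightarrow> ('a, 'e) chart \<Rightarrow> 'e \<Rightarrow> ('a, 'e) vfield"
  where "coord_field A C a p =
    (\<lambda>D. if C \<in> charts_at A p \<and> D \<in> charts_at A p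
         then frechet_derivative (coord D \<circ> cinv C) (at (coord C p)) a else 0)"

text \<open>The derivative \<open>v f\<close> of a function \<open>f\<close>, defined near \<open>p\<close>, in the direction of
  a tangent vector \<open>v\<close> at \<open>p\<close>. By the chain rule the chart is immaterial.\<close>

definition dir_deriv ::
    "('a, 'e::euclidean_space) chart set \<Rightarrow> 'a \<Rightarrow> ('a, 'e) tangent \<Rightarrow>
     ('a \<Rightarrow> 'v::real_normed_vector) \<Rightarrow> 'v"
  where "dir_deriv A p v f =
    (let C = chart_at A p in frechet_derivative (f \<circ> cinv C) (at (coord C p)) (v C))"

definition pushforward ::
    "('b, 'f::euclidean_space) chart set \<Rightarrow> ('a, 'e::euclidean_space) chart set \<Rightarrow> ('b \<Rightarrow> 'a) \<Rightarrow>
     'b \<Rightarrow> ('b, 'f) tangent \<Rightarrow> ('a, 'e) tangent"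
  where "pushforward B A F p v =
    (\<lambda>D. if D \<in> charts_at A (F p) then dir_deriv B p v (coord D \<circ> F) else 0)"

definition immersion ::
    "('b::topological_space, 'f::euclidean_space) chart set \<Rightarrow>
     ('a::topological_space, 'e::euclidean_space) chart set \<Rightarrow> ('b \<Rightarrow> 'a) \<Rightarrow> bool"
  where "immersion B A F \<longleftrightarrow> smooth_map B A F \<and>
    (\<forall>p. \<forall>v\<in>tangent_space B p. pushforward B A F p v = 0 \<longrightarrow> v = 0)"

text \<open>Lie bracket on the domain of the chart \<open>C\<close>:
  \<open>[X,Y] = \<Sum>\<^sub>i (X(Y\<^sup>i) - Y(X\<^sup>i)) \<partial>\<^sub>i\<close>. The result does not depend on \<open>C\<close>.\<close>

definition lie_bracket ::
    "('a, 'e::euclidean_space) chart set \<Rightarrow> ('a, 'e) chart \<Rightarrow>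
     ('a, 'e) vfield \<Rightarrow> ('a, 'e) vfield \<Rightarrow> ('a, 'e) vfield"
  where "lie_bracket A C X Y p =
    coord_field A C
      (dir_deriv A p (X p) (\<lambda>q. Y q C) - dir_deriv A p (Y p) (\<lambda>q. X q C)) p"


section \<open>Tensor fields\<close>

definition linear_map_on :: "'v::real_vector set \<Rightarrow> ('v \<Rightarrow> 'w::real_vector) \<Rightarrow> bool"
  where "linear_map_on V L \<longleftrightarrow>
    (\<forall>u\<in>V. \<forall>v\<in>V. L (u + v) = L u + L v) \<and> (\<forall>r. \<forall>u\<in>V. L (r *\<^sub>R u) = r *\<^sub>R L u)"

definition smooth_vector_field ::
    "('a, 'e::euclidean_space) chart set \<Rightarrow> ('a, 'e) vfield \<Rightarrow> bool"
  where "smooth_vector_field A X \<longleftrightarrow>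
    (\<forall>p. X p \<in> tangent_space A p) \<and>
    (\<forall>C\<in>A. smooth_on (cimg C) (\<lambda>x. X (cinv C x) C))"

definition smooth_one_form ::
    "('a, 'e::euclidean_space) chart set \<Rightarrow> ('a \<Rightarrow> ('a, 'e) tangent \<Rightarrow> real) \<Rightarrow> bool"
  where "smooth_one_form A \<eta> \<longleftrightarrow>
    (\<forall>p. linear_map_on (tangent_space A p) (\<eta> p)) \<and>
    (\<forall>C\<in>A. \<forall>a. smooth_on (cimg C) (\<lambda>x. \<eta> (cinv C x) (coord_field A C a (cinv C x))))"

definition smooth_endomorphism_field ::
    "('a, 'e::euclidean_space) chart set \<Rightarrow>
     ('a \<Rightarrow> ('a, 'e) tangent \<Rightarrow> ('a, 'e) tangent) \<Rightarrow> bool"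
  where "smooth_endomorphism_field A \<phi> \<longleftrightarrow>
    (\<forall>p. linear_map_on (tangent_space A p) (\<phi> p) \<and>
         \<phi> p ` tangent_space A p \<subseteq> tangent_space A p) \<and>
    (\<forall>C\<in>A. \<forall>a. smooth_on (cimg C) (\<lambda>x. \<phi> (cinv C x) (coord_field A C a (cinv C x)) C))"

type_synonym ('a, 'e) metric_field = "'a \<Rightarrow> ('a, 'e) tangent \<Rightarrow> ('a, 'e) tangent \<Rightarrow> real"

definition riemannian_metric ::
    "('a, 'e::euclidean_space) chart set \<Rightarrow> ('a, 'e) metric_field \<Rightarrow> bool"
  where "riemannian_metric A g \<longleftrightarrow>
    (\<forall>p. \<forall>u\<in>tangent_space A p.
        linear_map_on (tangent_space A p) (g p u) \<and>
        (\<forall>v\<in>tangent_space A p. g p u v = g p v u) \<and>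
        (u \<noteq> 0 \<longrightarrow> g p u u > 0)) \<and>
    (\<forall>C\<in>A. \<forall>a b. smooth_on (cimg C)
        (\<lambda>x. g (cinv C x) (coord_field A C a (cinv C x)) (coord_field A C b (cinv C x))))"

text \<open>Exterior derivative of a 1-form, with the normalization
  \<open>2 d\<eta>(X,Y) = X \<eta>(Y) - Y \<eta>(X) - \<eta>([X,Y])\<close>; this is the one for which a contact metric
  structure satisfies \<open>\<nabla>\<^sub>X \<xi> = - \<phi> X - \<phi> h X\<close>. The tangent vectors \<open>u\<close>, \<open>v\<close> are extended to
  vector fields with constant components in the chart \<open>C\<close>; the result does not depend on \<open>C\<close>.\<close>

definition ext_deriv ::
    "('a, 'e::euclidean_space) chart set \<Rightarrow> ('a, 'e) chart \<Rightarrow>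
     ('a \<Rightarrow> ('a, 'e) tangent \<Rightarrow> real) \<Rightarrow>
     'a \<Rightarrow> ('a, 'e) tangent \<Rightarrow> ('a, 'e) tangent \<Rightarrow> real"
  where "ext_deriv A C \<eta> p u v =
    (let U = coord_field A C (u C); V = coord_field A C (v C) in
      (1/2) * (dir_deriv A p u (\<lambda>q. \<eta> q (V q)) - dir_deriv A p v (\<lambda>q. \<eta> q (U q))
               - \<eta> p (lie_bracket A C U V p)))"


section \<open>Levi-Civita connection and curvature\<close>

text \<open>\<open>christoffel A g C p a b\<close> is the component vector \<open>w\<close> of \<open>\<nabla>\<^sub>X Y\<close> at \<open>p\<close> in the chart \<open>C\<close>,
  where \<open>X\<close>, \<open>Y\<close> have constant components \<open>a\<close>, \<open>b\<close>: that is, \<open>w\<^sup>k = \<Gamma>\<^sup>k\<^sub>i\<^sub>j a\<^sup>i b\<^sup>j\<close>, determined by the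
  Koszul formula for commuting fields.\<close>

definition christoffel ::
    "('a, 'e::euclidean_space) chart set \<Rightarrow> ('a, 'e) metric_field \<Rightarrow> ('a, 'e) chart \<Rightarrow>
     'a \<Rightarrow> 'e \<Rightarrow> 'e \<Rightarrow> 'e"
  where "christoffel A g C p a b =
    (let E = coord_field A C in
     THE w. \<forall>c. 2 * g p (E w p) (E c p) =
        dir_deriv A p (E a p) (\<lambda>q. g q (E b q) (E c q))
      + dir_deriv A p (E b p) (\<lambda>q. g q (E a q) (E c q))
      - dir_deriv A p (E c p) (\<lambda>q. g q (E a q) (E b q)))"

text \<open>Levi-Civita covariant derivative at \<open>p\<close>, in the direction \<open>u\<close> tangent to the source, of
  a vector field \<open>Y\<close> along a map \<open>F\<close>, calculated in the chart \<open>C\<close> of the target around \<open>F p\<close>: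
  \<open>(\<nabla>\<^sub>u Y)\<^sup>k = u(Y\<^sup>k) + \<Gamma>\<^sup>k\<^sub>i\<^sub>j dF(u)\<^sup>i Y\<^sup>j\<close>. The result does not depend on \<open>C\<close>.
  The connection on the manifold itself is the case of the identity map.\<close>

definition cov_deriv_along ::
    "('b, 'f::euclidean_space) chart set \<Rightarrow> ('a, 'e::euclidean_space) chart set \<Rightarrow>
     ('a, 'e) metric_field \<Rightarrow> ('b \<Rightarrow> 'a) \<Rightarrow> ('a, 'e) chart \<Rightarrow>
     'b \<Rightarrow> ('b, 'f) tangent \<Rightarrow> ('b \<Rightarrow> ('a, 'e) tangent) \<Rightarrow> ('a, 'e) tangent"
  where "cov_deriv_along B A g F C p u Y =
    coord_field A C
      (dir_deriv B p u (\<lambda>q. Y q C)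
       + christoffel A g C (F p) (pushforward B A F p u C) (Y p C)) (F p)"

definition nabla ::
    "('a, 'e::euclidean_space) chart set \<Rightarrow> ('a, 'e) metric_field \<Rightarrow> ('a, 'e) chart \<Rightarrow>
     ('a, 'e) vfield \<Rightarrow> ('a, 'e) vfield \<Rightarrow> ('a, 'e) vfield"
  where "nabla A g C X Y p = cov_deriv_along A A g id C p (X p) Y"

text \<open>Tensors at \<open>p\<close> given by differential operators on vector fields are evaluated by extending
  the arguments with constant components in a chart around \<open>p\<close>.\<close>

definition curvature ::
    "('a, 'e::euclidean_space) chart set \<Rightarrow> ('a, 'e) metric_field \<Rightarrow> 'a \<Rightarrow>
     ('a, 'e) tangent \<Rightarrow> ('a, 'e) tangent \<Rightarrow> ('a, 'e) tangent \<Rightarrow> ('a, 'e) tangent"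
  where "curvature A g p u v w =
    (let C = chart_at A p; D = nabla A g C;
         X = coord_field A C (u C); Y = coord_field A C (v C); Z = coord_field A C (w C) in
      D X (D Y Z) p - D Y (D X Z) p - D (lie_bracket A C X Y) Z p)"

text \<open>The sectional curvature of the plane spanned by orthonormal vectors \<open>u\<close>, \<open>v\<close>.\<close>

definition sectional_curvature ::
    "('a, 'e::euclidean_space) chart set \<Rightarrow> ('a, 'e) metric_field \<Rightarrow> 'a \<Rightarrow>
     ('a, 'e) tangent \<Rightarrow> ('a, 'e) tangent \<Rightarrow> real"
  where "sectional_curvature A g p u v = g p (curvature A g p u v v) u"

text \<open>Orthonormal bases are indexed by \<open>1,\<dots>,n\<close>, where \<open>n\<close> is the dimension of the manifold.\<close>

definition orthonormal_basis ::
    "('a, 'e::euclidean_space) chart set \<Rightarrow> ('a, 'e) metric_field \<Rightarrow> 'a \<Rightarrow>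
     (nat \<Rightarrow> ('a, 'e) tangent) \<Rightarrow> bool"
  where "orthonormal_basis A g p e \<longleftrightarrow>
    (\<forall>i\<in>{1..DIM('e)}. \<forall>j\<in>{1..DIM('e)}. g p (e i) (e j) = (if i = j then 1 else 0)) \<and>
    span (e ` {1..DIM('e)}) = tangent_space A p"

definition ricci_curvature ::
    "('a, 'e::euclidean_space) chart set \<Rightarrow> ('a, 'e) metric_field \<Rightarrow> 'a \<Rightarrow>
     ('a, 'e) tangent \<Rightarrow> real"
  where "ricci_curvature A g p u =
    (let e = (SOME e. orthonormal_basis A g p e \<and> e 1 = u) in
      \<Sum>j=2..DIM('e). sectional_curvature A g p (e 1) (e j))"

text \<open>\<open>S(X,Y)\<close> is the trace of \<open>Z \<mapsto> R(Z,X)Y\<close>.\<close>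

definition ricci_tensor ::
    "('a, 'e::euclidean_space) chart set \<Rightarrow> ('a, 'e) metric_field \<Rightarrow> 'a \<Rightarrow>
     ('a, 'e) tangent \<Rightarrow> ('a, 'e) tangent \<Rightarrow> real"
  where "ricci_tensor A g p u v =
    (let e = (SOME e. orthonormal_basis A g p e) in
      \<Sum>j=1..DIM('e). g p (curvature A g p (e j) u v) (e j))"


section \<open>Submanifolds\<close>

text \<open>A submanifold is given by an immersion \<open>F\<close> of a manifold with atlas \<open>B\<close> into one with
  atlas \<open>A\<close>.\<close>

definition induced_metric ::
    "('b, 'f::euclidean_space) chart set \<Rightarrow> ('a, 'e::euclidean_space) chart set \<Rightarrow>
     ('a, 'e) metric_field \<Rightarrow> ('b \<Rightarrow> 'a) \<Rightarrow> ('b, 'f) metric_field"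
  where "induced_metric B A g F p u v =
    g (F p) (pushforward B A F p u) (pushforward B A F p v)"

text \<open>The Gauss formula: \<open>\<sigma>(u,v)\<close> is the difference between the ambient covariant
  derivative of \<open>dF(V)\<close> in the direction \<open>u\<close> and the image of the intrinsic one, where \<open>V\<close>
  extends \<open>v\<close>.\<close>

definition second_fundamental_form ::
    "('b, 'f::euclidean_space) chart set \<Rightarrow> ('a, 'e::euclidean_space) chart set \<Rightarrow>
     ('a, 'e) metric_field \<Rightarrow> ('b \<Rightarrow> 'a) \<Rightarrow> 'b \<Rightarrow>
     ('b, 'f) tangent \<Rightarrow> ('b, 'f) tangent \<Rightarrow> ('a, 'e) tangent"
  where "second_fundamental_form B A g F p u v =
    (let C = chart_at B p; D = chart_at A (F p);
         U = coord_field B C (u C); V = coord_field B C (v C) in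
      cov_deriv_along B A g F D p u (\<lambda>q. pushforward B A F q (V q))
      - pushforward B A F p (nabla B (induced_metric B A g F) C U V p))"

definition mean_curvature ::
    "('b, 'f::euclidean_space) chart set \<Rightarrow> ('a, 'e::euclidean_space) chart set \<Rightarrow>
     ('a, 'e) metric_field \<Rightarrow> ('b \<Rightarrow> 'a) \<Rightarrow> 'b \<Rightarrow> ('a, 'e) tangent"
  where "mean_curvature B A g F p =
    (let e = (SOME e. orthonormal_basis B (induced_metric B A g F) p e) in
      (1 / real DIM('f)) *\<^sub>R (\<Sum>j=1..DIM('f). second_fundamental_form B A g F p (e j) (e j)))"

definition relative_null_space ::
    "('b, 'f::euclidean_space) chart set \<Rightarrow> ('a, 'e::euclidean_space) chart set \<Rightarrow>
     ('a, 'e) metric_field \<Rightarrow> ('b \<Rightarrow> 'a) \<Rightarrow> 'b \<Rightarrow> ('b, 'f) tangent set"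
  where "relative_null_space B A g F p =
    {u \<in> tangent_space B p.
       \<forall>v\<in>tangent_space B p. second_fundamental_form B A g F p u v = 0}"

definition totally_geodesic_point ::
    "('b, 'f::euclidean_space) chart set \<Rightarrow> ('a, 'e::euclidean_space) chart set \<Rightarrow>
     ('a, 'e) metric_field \<Rightarrow> ('b \<Rightarrow> 'a) \<Rightarrow> 'b \<Rightarrow> bool"
  where "totally_geodesic_point B A g F p \<longleftrightarrow>
    (\<forall>u\<in>tangent_space B p. \<forall>v\<in>tangent_space B p. second_fundamental_form B A g F p u v = 0)"

definition totally_umbilical_point ::
    "('b, 'f::euclidean_space) chart set \<Rightarrow> ('a, 'e::euclidean_space) chart set \<Rightarrow>
     ('a, 'e) metric_field \<Rightarrow> ('b \<Rightarrow> 'a) \<Rightarrow> 'b \<Rightarrow> bool"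
  where "totally_umbilical_point B A g F p \<longleftrightarrow>
    (\<forall>u\<in>tangent_space B p. \<forall>v\<in>tangent_space B p.
       second_fundamental_form B A g F p u v =
         induced_metric B A g F p u v *\<^sub>R mean_curvature B A g F p)"


section \<open>Contact metric structures and generalized \<open>(\<kappa>,\<mu>)\<close>-contact space forms\<close>

definition almost_contact_metric_manifold ::
    "('a::{t2_space,second_countable_topology}, 'e::euclidean_space) chart set \<Rightarrow>
     ('a \<Rightarrow> ('a, 'e) tangent \<Rightarrow> ('a, 'e) tangent) \<Rightarrow> ('a, 'e) vfield \<Rightarrow>
     ('a \<Rightarrow> ('a, 'e) tangent \<Rightarrow> real) \<Rightarrow> ('a, 'e) metric_field \<Rightarrow> bool"
  where "almost_contact_metric_manifold A \<phi> \<xi> \<eta> g \<longleftrightarrow>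
    smooth_manifold A \<and> smooth_endomorphism_field A \<phi> \<and> smooth_vector_field A \<xi> \<and>
    smooth_one_form A \<eta> \<and> riemannian_metric A g \<and>
    (\<forall>p. \<eta> p (\<xi> p) = 1 \<and> \<phi> p (\<xi> p) = 0 \<and>
      (\<forall>u\<in>tangent_space A p.
         \<phi> p (\<phi> p u) = - u + \<eta> p u *\<^sub>R \<xi> p \<and> \<eta> p (\<phi> p u) = 0 \<and> g p u (\<xi> p) = \<eta> p u \<and>
         (\<forall>v\<in>tangent_space A p.
            g p u v = g p (\<phi> p u) (\<phi> p v) + \<eta> p u * \<eta> p v \<and>
            g p u (\<phi> p v) = - g p (\<phi> p u) v)))"

definition contact_metric_manifold ::
    "('a::{t2_space,second_countable_topology}, 'e::euclidean_space) chart set \<Rightarrow>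
     ('a \<Rightarrow> ('a, 'e) tangent \<Rightarrow> ('a, 'e) tangent) \<Rightarrow> ('a, 'e) vfield \<Rightarrow>
     ('a \<Rightarrow> ('a, 'e) tangent \<Rightarrow> real) \<Rightarrow> ('a, 'e) metric_field \<Rightarrow> bool"
  where "contact_metric_manifold A \<phi> \<xi> \<eta> g \<longleftrightarrow>
    almost_contact_metric_manifold A \<phi> \<xi> \<eta> g \<and>
    (\<forall>p. \<forall>C\<in>charts_at A p. \<forall>u\<in>tangent_space A p. \<forall>v\<in>tangent_space A p.
       ext_deriv A C \<eta> p u v = g p u (\<phi> p v))"

text \<open>\<open>h = (1/2) \<L>\<^sub>\<xi> \<phi>\<close>, where \<open>(\<L>\<^sub>\<xi> \<phi>) V = [\<xi>, \<phi> V] - \<phi> [\<xi>, V]\<close>.\<close>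

definition h_tensor ::
    "('a, 'e::euclidean_space) chart set \<Rightarrow>
     ('a \<Rightarrow> ('a, 'e) tangent \<Rightarrow> ('a, 'e) tangent) \<Rightarrow> ('a, 'e) vfield \<Rightarrow>
     'a \<Rightarrow> ('a, 'e) tangent \<Rightarrow> ('a, 'e) tangent"
  where "h_tensor A \<phi> \<xi> p v =
    (let C = chart_at A p; V = coord_field A C (v C) in
      (1/2) *\<^sub>R (lie_bracket A C \<xi> (\<lambda>q. \<phi> q (V q)) p - \<phi> p (lie_bracket A C \<xi> V p)))"

text \<open>The model curvature tensors on a single tangent space, for an inner product \<open>G\<close>, linear
  maps \<open>\<phi>\<close>, \<open>h\<close>, a vector \<open>\<xi>\<close> and a linear form \<open>\<eta>\<close>.\<close>

definition R1 :: "('v::real_vector \<Rightarrow> 'v \<Rightarrow> real) \<Rightarrow> 'v \<Rightarrow> 'v \<Rightarrow> 'v \<Rightarrow> 'v"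
  where "R1 G X Y Z = G Y Z *\<^sub>R X - G X Z *\<^sub>R Y"

definition R2 :: "('v::real_vector \<Rightarrow> 'v \<Rightarrow> real) \<Rightarrow> ('v \<Rightarrow> 'v) \<Rightarrow> 'v \<Rightarrow> 'v \<Rightarrow> 'v \<Rightarrow> 'v"
  where "R2 G \<phi> X Y Z =
    G X (\<phi> Z) *\<^sub>R \<phi> Y - G Y (\<phi> Z) *\<^sub>R \<phi> X + (2 * G X (\<phi> Y)) *\<^sub>R \<phi> Z"

definition R3 ::
    "('v::real_vector \<Rightarrow> 'v \<Rightarrow> real) \<Rightarrow> 'v \<Rightarrow> ('v \<Rightarrow> real) \<Rightarrow> 'v \<Rightarrow> 'v \<Rightarrow> 'v \<Rightarrow> 'v"
  where "R3 G \<xi> \<eta> X Y Z =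
    (\<eta> X * \<eta> Z) *\<^sub>R Y - (\<eta> Y * \<eta> Z) *\<^sub>R X + (G X Z * \<eta> Y) *\<^sub>R \<xi> - (G Y Z * \<eta> X) *\<^sub>R \<xi>"

definition R4 :: "('v::real_vector \<Rightarrow> 'v \<Rightarrow> real) \<Rightarrow> ('v \<Rightarrow> 'v) \<Rightarrow> 'v \<Rightarrow> 'v \<Rightarrow> 'v \<Rightarrow> 'v"
  where "R4 G h X Y Z =
    G Y Z *\<^sub>R h X - G X Z *\<^sub>R h Y + G (h Y) Z *\<^sub>R X - G (h X) Z *\<^sub>R Y"

definition R5 ::
    "('v::real_vector \<Rightarrow> 'v \<Rightarrow> real) \<Rightarrow> ('v \<Rightarrow> 'v) \<Rightarrow> ('v \<Rightarrow> 'v) \<Rightarrow> 'v \<Rightarrow> 'v \<Rightarrow> 'v \<Rightarrow> 'v"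
  where "R5 G \<phi> h X Y Z =
    G (h Y) Z *\<^sub>R h X - G (h X) Z *\<^sub>R h Y
    + G (\<phi> (h X)) Z *\<^sub>R \<phi> (h Y) - G (\<phi> (h Y)) Z *\<^sub>R \<phi> (h X)"

definition R6 ::
    "('v::real_vector \<Rightarrow> 'v \<Rightarrow> real) \<Rightarrow> 'v \<Rightarrow> ('v \<Rightarrow> real) \<Rightarrow> ('v \<Rightarrow> 'v) \<Rightarrow> 'v \<Rightarrow> 'v \<Rightarrow> 'v \<Rightarrow> 'v"
  where "R6 G \<xi> \<eta> h X Y Z =
    (\<eta> X * \<eta> Z) *\<^sub>R h Y - (\<eta> Y * \<eta> Z) *\<^sub>R h X
    + (G (h X) Z * \<eta> Y) *\<^sub>R \<xi> - (G (h Y) Z * \<eta> X) *\<^sub>R \<xi>"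

definition generalized_kappa_mu_space_form ::
    "('a::{t2_space,second_countable_topology}, 'e::euclidean_space) chart set \<Rightarrow>
     ('a \<Rightarrow> ('a, 'e) tangent \<Rightarrow> ('a, 'e) tangent) \<Rightarrow> ('a, 'e) vfield \<Rightarrow>
     ('a \<Rightarrow> ('a, 'e) tangent \<Rightarrow> real) \<Rightarrow> ('a, 'e) metric_field \<Rightarrow>
     ('a \<Rightarrow> real) \<Rightarrow> ('a \<Rightarrow> real) \<Rightarrow> ('a \<Rightarrow> real) \<Rightarrow>
     ('a \<Rightarrow> real) \<Rightarrow> ('a \<Rightarrow> real) \<Rightarrow> ('a \<Rightarrow> real) \<Rightarrow> bool"
  where "generalized_kappa_mu_space_form A \<phi> \<xi> \<eta> g f1 f2 f3 f4 f5 f6 \<longleftrightarrow>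
    almost_contact_metric_manifold A \<phi> \<xi> \<eta> g \<and>
    (\<forall>f\<in>{f1, f2, f3, f4, f5, f6}. differentiable_fun A f) \<and>
    (\<forall>p. \<forall>X\<in>tangent_space A p. \<forall>Y\<in>tangent_space A p. \<forall>Z\<in>tangent_space A p.
       (let h = h_tensor A \<phi> \<xi> p in
        curvature A g p X Y Z =
          f1 p *\<^sub>R R1 (g p) X Y Z
        + f2 p *\<^sub>R R2 (g p) (\<phi> p) X Y Z
        + f3 p *\<^sub>R R3 (g p) (\<xi> p) (\<eta> p) X Y Z
        + f4 p *\<^sub>R R4 (g p) h X Y Z
        + f5 p *\<^sub>R R5 (g p) (\<phi> p) h X Y Z
        + f6 p *\<^sub>R R6 (g p) (\<xi> p) (\<eta> p) h X Y Z))"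

definition generalized_kappa_mu_contact_space_form ::
    "('a::{t2_space,second_countable_topology}, 'e::euclidean_space) chart set \<Rightarrow>
     ('a \<Rightarrow> ('a, 'e) tangent \<Rightarrow> ('a, 'e) tangent) \<Rightarrow> ('a, 'e) vfield \<Rightarrow>
     ('a \<Rightarrow> ('a, 'e) tangent \<Rightarrow> real) \<Rightarrow> ('a, 'e) metric_field \<Rightarrow>
     ('a \<Rightarrow> real) \<Rightarrow> ('a \<Rightarrow> real) \<Rightarrow> ('a \<Rightarrow> real) \<Rightarrow>
     ('a \<Rightarrow> real) \<Rightarrow> ('a \<Rightarrow> real) \<Rightarrow> ('a \<Rightarrow> real) \<Rightarrow> bool"
  where "generalized_kappa_mu_contact_space_form A \<phi> \<xi> \<eta> g f1 f2 f3 f4 f5 f6 \<longleftrightarrow>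
    generalized_kappa_mu_space_form A \<phi> \<xi> \<eta> g f1 f2 f3 f4 f5 f6 \<and>
    contact_metric_manifold A \<phi> \<xi> \<eta> g"

definition C_totally_real_submanifold ::
    "('b::{t2_space,second_countable_topology}, 'f::euclidean_space) chart set \<Rightarrow>
     ('a::{t2_space,second_countable_topology}, 'e::euclidean_space) chart set \<Rightarrow>
     ('a, 'e) vfield \<Rightarrow> ('a, 'e) metric_field \<Rightarrow> ('b \<Rightarrow> 'a) \<Rightarrow> bool"
  where "C_totally_real_submanifold B A \<xi> g F \<longleftrightarrow>
    smooth_manifold B \<and> immersion B A F \<and>
    (\<forall>p. \<forall>u\<in>tangent_space B p. g (F p) (\<xi> (F p)) (pushforward B A F p u) = 0)"

end

theory Submission
  imports Defs
begin

text \<open>Write \<open>\<nabla>\<xi> = T = - \<phi> + P\<close> on the ambient contact manifold. The contact condition says that \<open>P\<close>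
  is symmetric, and \<open>d(d\<eta>) = 0\<close> contracted with \<open>\<xi>\<close> gives \<open>\<nabla>\<^sub>\<xi> \<phi> = - (P \<phi> + \<phi> P)\<close>. Since
  \<open>\<nabla>\<^sub>\<xi> (\<phi>\<^sup>2) = 0\<close>, this forces \<open>\<nabla>\<^sub>\<xi> \<phi> = 0\<close>, \<open>P \<phi> = - \<phi> P\<close> and \<open>h = \<phi> P\<close>. The hypothesis
  \<open>f3 = f1 - 1\<close> means \<open>R(X,\<xi>)\<xi> = X - \<eta>(X) \<xi> + \<mu> h X\<close>. Comparing the Riccati equation
  \<open>\<nabla>\<^sub>\<xi> T = - R(\<sqdot>,\<xi>)\<xi> - T\<^sup>2\<close> with its conjugate by \<open>\<phi>\<close> yields \<open>P\<^sup>2 = 0\<close>, so \<open>h = 0\<close>.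

  Hence, \<open>\<phi>\<close> mapping tangent vectors of \<open>M\<close> to normal ones, the ambient curvature restricts to
  \<open>f1 R1\<close> on \<open>M\<close>, and with \<open>a = \<sigma>(U,U)\<close> and an orthonormal basis \<open>e\<close> starting with \<open>U\<close> the Gauss
  equation gives
  \<open>Ric(U) = (n-1) f1 + \<langle>a, n H - a\<rangle> - \<Sum>\<^sub>j\<^sub>\<ge>\<^sub>2 |\<sigma>(U, e\<^sub>j)|\<^sup>2\<close>. Completing the square proves the inequalities.
  Equality for \<open>U\<close> means \<open>2 \<sigma>(U,U) = n H\<close> and \<open>\<sigma>(U, e\<^sub>j) = 0\<close>; equality for all unit \<open>U\<close> sums to
  \<open>2 n H = n\<^sup>2 H\<close>, so that \<open>H = 0\<close> when \<open>n \<ge> 3\<close>.\<close>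

section \<open>Calculus\<close>

text \<open>Tensors at a point are defined by extending vectors with constant components in a chart.
  The analysis therefore lives on open sets of the model space, a metric being a family
  \<open>G y\<close> of bilinear forms, and a last layer carries the results back to the manifolds.
  The 1 in f3 = f1 - 1 is decisive. Were R(X,\<xi>)\<xi> equal to k (X - \<eta>(X) \<xi>) + \<mu> h
  X, the comparison of the Riccati equation with its conjugate would give P(P X) = (1 - k)(X -
  \<eta>(X) \<xi>), so the argument yields P = 0 exactly at k = 1; there the symmetry of P turns P(P
  X) = 0 into P X = 0. The vanishing of h matters because nothing relates h X to the submanifold
  when X is tangent: R4 and R5 would leave terms in the Gauss equation that the asserted bound does
  not contain. The commutation rules between P and \<phi> are proved on a whole chart, since they
  are differentiated once more along \<xi>, whereas the curvature condition is evaluated at a single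
  point.\<close>

abbreviation fd :: "('a::real_normed_vector \<Rightarrow> 'b::real_normed_vector) \<Rightarrow> 'a \<Rightarrow> 'a \<Rightarrow> 'b"
  where "fd f x \<equiv> frechet_derivative f (at x)"

lemma fd_eqI: "(f has_derivative f') (at x) \<Longrightarrow> fd f x = f'"
  using frechet_derivative_at by metis

lemma fd_has_derivative: "f differentiable (at x) \<Longrightarrow> (f has_derivative fd f x) (at x)"
  by (simp add: frechet_derivative_works)

lemma has_derivative_cong_open:
  assumes "open S" "x \<in> S" "\<And>y. y \<in> S \<Longrightarrow> f y = g y"
  shows "(f has_derivative f') (at x) \<longleftrightarrow> (g has_derivative f') (at x)"
  using assms by (metis has_derivative_transform_within_open)

lemma fd_cong_open:
  assumes "open S" "x \<in> S" "\<And>y. y \<in> S \<Longrightarrow> f y = g y"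
  shows "fd f x = fd g x"
  using has_derivative_cong_open[OF assms] by (simp add: frechet_derivative_def)

lemma differentiable_cong_open:
  assumes "open S" "x \<in> S" "\<And>y. y \<in> S \<Longrightarrow> f y = g y"
  shows "f differentiable (at x) \<longleftrightarrow> g differentiable (at x)"
  using has_derivative_cong_open[OF assms] by (simp add: differentiable_def)

lemma fd_add:
  assumes "f differentiable (at x)" "g differentiable (at x)"
  shows "fd (\<lambda>y. f y + g y) x = (\<lambda>v. fd f x v + fd g x v)"
  using assms by (intro fd_eqI has_derivative_add fd_has_derivative)

lemma fd_diff:
  assumes "f differentiable (at x)" "g differentiable (at x)"
  shows "fd (\<lambda>y. f y - g y) x = (\<lambda>v. fd f x v - fd g x v)"
  using assms by (intro fd_eqI has_derivative_diff fd_has_derivative)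

lemma fd_minus:
  assumes "f differentiable (at x)"
  shows "fd (\<lambda>y. - f y) x = (\<lambda>v. - fd f x v)"
  using assms by (intro fd_eqI has_derivative_minus fd_has_derivative)

lemma fd_cmult:
  fixes f :: "'a::real_normed_vector \<Rightarrow> real"
  assumes "f differentiable (at x)"
  shows "fd (\<lambda>y. c * f y) x = (\<lambda>v. c * fd f x v)"
  using assms by (intro fd_eqI has_derivative_mult_right fd_has_derivative)

lemma fd_chain:
  assumes "f differentiable (at x)" "g differentiable (at (f x))"
  shows "fd (\<lambda>y. g (f y)) x v = fd g (f x) (fd f x v)"
  using frechet_derivative_compose[OF assms] by (simp add: o_def fun_eq_iff)

lemma differentiable_compose_at:
  assumes "f differentiable (at x)" "g differentiable (at (f x))"
  shows "(\<lambda>y. g (f y)) differentiable (at x)"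
  using differentiable_chain_at[OF assms] by (simp add: o_def)

text \<open>Expanding the argument in the standard basis reduces this to the product rule for
  finitely many scalar coefficients. Differentiability of each \<open>\<lambda>y. L y v\<close> is
  then enough, and no norm on linear maps enters.\<close>

lemma has_derivative_linear_family:
  fixes L :: "'a::real_normed_vector \<Rightarrow> 'v::euclidean_space \<Rightarrow> 'w::real_normed_vector"
  assumes S: "open S" "x \<in> S" and lin: "\<And>y. y \<in> S \<Longrightarrow> linear (L y)"
    and L: "\<And>v. (\<lambda>y. L y v) differentiable (at x)" and Y: "Y differentiable (at x)"
  shows "((\<lambda>y. L y (Y y)) has_derivative (\<lambda>h. fd (\<lambda>y. L y (Y x)) x h + L x (fd Y x h))) (at x)"
proof -
  have expand: "L y v = (\<Sum>b\<in>Basis. (v \<bullet> b) *\<^sub>R L y b)" if "y \<in> S" for y v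
  proof -
    have "L y v = L y (\<Sum>b\<in>Basis. (v \<bullet> b) *\<^sub>R b)" by (simp add: euclidean_representation)
    also have "\<dots> = (\<Sum>b\<in>Basis. (v \<bullet> b) *\<^sub>R L y b)"
      using lin[OF that] by (simp add: linear_sum linear_cmul)
    finally show ?thesis .
  qed
  note dL = fd_has_derivative[OF L] and dY = fd_has_derivative[OF Y]
  have 1: "fd (\<lambda>y. L y v) x = (\<lambda>h. \<Sum>b\<in>Basis. (v \<bullet> b) *\<^sub>R fd (\<lambda>y. L y b) x h)" for v
    by (rule fd_eqI, subst has_derivative_cong_open[OF S expand], assumption)
      (auto intro!: derivative_eq_intros dL)
  have "((\<lambda>y. L y (Y y)) has_derivative
      (\<lambda>h. \<Sum>b\<in>Basis. (Y x \<bullet> b) *\<^sub>R fd (\<lambda>y. L y b) x h + (fd Y x h \<bullet> b) *\<^sub>R L x b)) (at x)"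
    by (subst has_derivative_cong_open[OF S expand], assumption)
      (auto intro!: derivative_eq_intros dL dY)
  moreover have "fd (\<lambda>y. L y (Y x)) x h + L x (fd Y x h) =
      (\<Sum>b\<in>Basis. (Y x \<bullet> b) *\<^sub>R fd (\<lambda>y. L y b) x h + (fd Y x h \<bullet> b) *\<^sub>R L x b)" for h
    unfolding 1[of "Y x"] expand[OF S(2), of "fd Y x h"] by (simp only: sum.distrib)
  ultimately show ?thesis by simp
qed

lemma linear_family_rule:
  fixes L :: "'a::real_normed_vector \<Rightarrow> 'v::euclidean_space \<Rightarrow> 'w::real_normed_vector"
  assumes "open S" "x \<in> S" "\<And>y. y \<in> S \<Longrightarrow> linear (L y)"
    "\<And>v. (\<lambda>y. L y v) differentiable (at x)" "Y differentiable (at x)"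
  shows differentiable_linear_family: "(\<lambda>y. L y (Y y)) differentiable (at x)"
    and fd_linear_family: "fd (\<lambda>y. L y (Y y)) x h = fd (\<lambda>y. L y (Y x)) x h + L x (fd Y x h)"
  using has_derivative_linear_family[OF assms] by (auto simp: differentiable_def fd_eqI)

text \<open>Two uses of the linear rule. For the first slot the family is
  \<open>\<lambda>y u. L y u (Y y)\<close>, whose differentiability is the linear rule in the second
  slot.\<close>

lemma bilinear_family_rule:
  fixes L :: "'a::real_normed_vector \<Rightarrow> 'v::euclidean_space \<Rightarrow> 'u::euclidean_space \<Rightarrow>
    'w::real_normed_vector"
  assumes S: "open S" "x \<in> S" and bil: "\<And>y. y \<in> S \<Longrightarrow> bilinear (L y)"
    and L: "\<And>u v. (\<lambda>y. L y u v) differentiable (at x)"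
    and X: "X differentiable (at x)" and Y: "Y differentiable (at x)"
  shows differentiable_bilinear_family: "(\<lambda>y. L y (X y) (Y y)) differentiable (at x)"
    and fd_bilinear_family: "fd (\<lambda>y. L y (X y) (Y y)) x h =
      fd (\<lambda>y. L y (X x) (Y x)) x h + L x (fd X x h) (Y x) + L x (X x) (fd Y x h)"
proof -
  have l1: "linear (\<lambda>u. L y u v)" and l2: "linear (L y u)" if "y \<in> S" for y u v
    using bil[OF that] by (auto simp: bilinear_def)
  have 1: "(\<lambda>y. L y u (Y y)) differentiable (at x)" for u
    by (rule differentiable_linear_family[OF S _ _ Y]) (auto intro: l2 L)
  show "(\<lambda>y. L y (X y) (Y y)) differentiable (at x)"
    by (rule differentiable_linear_family[OF S _ _ X, of "\<lambda>y u. L y u (Y y)"]) (auto intro: l1 1)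
  have "fd (\<lambda>y. L y (X y) (Y y)) x h = fd (\<lambda>y. L y (X x) (Y y)) x h + L x (fd X x h) (Y x)"
    by (rule fd_linear_family[OF S _ _ X, of "\<lambda>y u. L y u (Y y)"]) (auto intro: l1 1)
  also have "fd (\<lambda>y. L y (X x) (Y y)) x h
      = fd (\<lambda>y. L y (X x) (Y x)) x h + L x (X x) (fd Y x h)"
    by (rule fd_linear_family[OF S _ _ Y]) (auto intro: l2 L)
  finally show "fd (\<lambda>y. L y (X y) (Y y)) x h =
      fd (\<lambda>y. L y (X x) (Y x)) x h + L x (fd X x h) (Y x) + L x (X x) (fd Y x h)" by simp
qed

section \<open>Smooth maps and the symmetry of second derivatives\<close>

lemma smooth_on_differentiable: "smooth_on S f \<Longrightarrow> x \<in> S \<Longrightarrow> f differentiable (at x)"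
  unfolding smooth_on_def using ck_on.simps(2) by blast

lemma smooth_on_fd: "smooth_on S f \<Longrightarrow> smooth_on S (\<lambda>x. fd f x v)"
  unfolding smooth_on_def using ck_on.simps(2) by blast

lemma smooth_on_continuous: "smooth_on S f \<Longrightarrow> continuous_on S f"
  unfolding smooth_on_def using ck_on.simps(1) by blast

text \<open>The mean value theorem is used twice: along \<open>a\<close> for the difference of
  \<open>f\<close> at two points displaced by \<open>h\<close> along \<open>b\<close>, then along
  \<open>b\<close> for the derivative so obtained.\<close>

lemma second_difference_mvt:
  fixes f :: "'e::euclidean_space \<Rightarrow> real"
  assumes S: "smooth_on S f" and h: "h > 0"
    and sub: "\<And>s t. 0 \<le> s \<Longrightarrow> s \<le> h \<Longrightarrow> 0 \<le> t \<Longrightarrow> t \<le> h \<Longrightarrow> x + s *\<^sub>R a + t *\<^sub>R b \<in> S"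
  shows "\<exists>s t. 0 < s \<and> s < h \<and> 0 < t \<and> t < h \<and>
    f (x + h *\<^sub>R a + h *\<^sub>R b) - f (x + h *\<^sub>R a) - f (x + h *\<^sub>R b) + f x
      = h * h * fd (\<lambda>y. fd f y a) (x + s *\<^sub>R a + t *\<^sub>R b) b"
proof -
  have der: "((\<lambda>r. k (y + r *\<^sub>R c)) has_real_derivative fd k (y + r *\<^sub>R c) c) (at r)"
    if "smooth_on S k" "y + r *\<^sub>R c \<in> S" for k :: "'e \<Rightarrow> real" and y c r
  proof -
    have d: "k differentiable (at (y + r *\<^sub>R c))" using smooth_on_differentiable that by blast
    have "((\<lambda>r. k (y + r *\<^sub>R c)) has_derivative (\<lambda>q. fd k (y + r *\<^sub>R c) (q *\<^sub>R c))) (at r)"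
      by (rule has_derivative_compose[where f = "\<lambda>r. y + r *\<^sub>R c" and g = k])
        (auto intro!: derivative_eq_intros fd_has_derivative d)
    then show ?thesis
      using linear_frechet_derivative[OF d]
      by (simp add: has_field_derivative_def linear_cmul mult_commute_abs)
  qed
  define \<phi> where "\<phi> = (\<lambda>s. f (x + h *\<^sub>R b + s *\<^sub>R a) - f (x + s *\<^sub>R a))"
  have "\<exists>s. 0 < s \<and> s < h \<and> \<phi> h - \<phi> 0 = (h - 0) * (fd f (x + h *\<^sub>R b + s *\<^sub>R a) a - fd f (x + s *\<^sub>R a) a)"
  proof (rule MVT2[OF h])
    fix s assume s: "0 \<le> s" "s \<le> h"
    have "x + h *\<^sub>R b + s *\<^sub>R a \<in> S" "x + s *\<^sub>R a \<in> S"
      using sub[of s h] sub[of s 0] s h by (auto simp: add_ac)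
    then show "(\<phi> has_real_derivative fd f (x + h *\<^sub>R b + s *\<^sub>R a) a - fd f (x + s *\<^sub>R a) a) (at s)"
      unfolding \<phi>_def by (intro DERIV_diff der S) auto
  qed
  then obtain s where s: "0 < s" "s < h"
    and 1: "\<phi> h - \<phi> 0 = h * (fd f (x + h *\<^sub>R b + s *\<^sub>R a) a - fd f (x + s *\<^sub>R a) a)" by auto
  have "\<exists>t. 0 < t \<and> t < h \<and> fd f (x + s *\<^sub>R a + h *\<^sub>R b) a - fd f (x + s *\<^sub>R a + 0 *\<^sub>R b) a
      = (h - 0) * fd (\<lambda>y. fd f y a) (x + s *\<^sub>R a + t *\<^sub>R b) b"
    by (rule MVT2[OF h]) (use sub s in \<open>auto intro!: der smooth_on_fd S\<close>)
  then obtain t where t: "0 < t" "t < h"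
    and 2: "fd f (x + s *\<^sub>R a + h *\<^sub>R b) a - fd f (x + s *\<^sub>R a) a
      = h * fd (\<lambda>y. fd f y a) (x + s *\<^sub>R a + t *\<^sub>R b) b" by auto
  have "f (x + h *\<^sub>R a + h *\<^sub>R b) - f (x + h *\<^sub>R a) - f (x + h *\<^sub>R b) + f x = \<phi> h - \<phi> 0"
    by (simp add: \<phi>_def add_ac)
  also have "\<dots> = h * h * fd (\<lambda>y. fd f y a) (x + s *\<^sub>R a + t *\<^sub>R b) b"
    using 1 2 by (simp add: add_ac)
  finally show ?thesis using s t by blast
qed

text \<open>The second difference does not change when \<open>a\<close> and \<open>b\<close> are
  exchanged, so both mixed derivatives are its limit. Continuity of the mixed derivative absorbs the
  unknown intermediate point.\<close>

lemma second_difference_tendsto: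
  fixes f :: "'e::euclidean_space \<Rightarrow> real"
  assumes S: "smooth_on S f" "open S" "x \<in> S"
  shows "((\<lambda>h. (f (x + h *\<^sub>R a + h *\<^sub>R b) - f (x + h *\<^sub>R a) - f (x + h *\<^sub>R b) + f x) / (h * h))
    \<longlongrightarrow> fd (\<lambda>y. fd f y a) x b) (at_right 0)"
proof (rule tendstoI)
  fix e :: real assume e: "e > 0"
  let ?D = "\<lambda>y. fd (\<lambda>y. fd f y a) y b"
  have "continuous_on S ?D"
    by (intro smooth_on_continuous smooth_on_fd S)
  then have "filterlim ?D (nhds (?D x)) (nhds x)"
    using S continuous_on_eq_continuous_at isCont_def tendsto_at_iff_tendsto_nhds by metis
  then have "eventually (\<lambda>y. dist (?D y) (?D x) < e) (nhds x)"
    using e by (rule tendstoD)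
  then have "eventually (\<lambda>y. dist (?D y) (?D x) < e \<and> y \<in> S) (nhds x)"
    using S eventually_nhds_in_open eventually_conj by blast
  then obtain d where d: "d > 0" "\<And>y. dist y x < d \<Longrightarrow> dist (?D y) (?D x) < e \<and> y \<in> S"
    by (auto simp: eventually_nhds_metric)
  \<comment> \<open>Parameters below \<open>k\<close> keep all four corners and the intermediate
    point within distance \<open>d\<close>; the summand 1 keeps the denominator positive when
    \<open>a\<close> and \<open>b\<close> are both 0.\<close>
  define k where "k = d / (norm a + norm b + 1)"
  have k: "k > 0" using d by (simp add: k_def add_nonneg_pos)
  have near: "dist (x + s *\<^sub>R a + t *\<^sub>R b) x < d" if "0 \<le> s" "s < k" "0 \<le> t" "t < k" for s t
  proof -
    have "dist (x + s *\<^sub>R a + t *\<^sub>R b) x \<le> s * norm a + t * norm b"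
      using norm_triangle_ineq[of "s *\<^sub>R a" "t *\<^sub>R b"] that by (simp add: dist_norm add.assoc)
    also have "\<dots> \<le> k * norm a + k * norm b"
      using that by (intro add_mono mult_right_mono) auto
    also have "\<dots> < k * (norm a + norm b + 1)" using k by (simp add: algebra_simps)
    also have "\<dots> = d" 
      using add_nonneg_pos[of "norm a + norm b" 1] by (simp add: k_def)
    finally show ?thesis .
  qed
  have "eventually (\<lambda>h. 0 < h \<and> h < k) (at_right (0::real))"
    using k by (auto simp: eventually_at_right_field)
  then show "\<forall>\<^sub>F h in at_right 0.
      dist ((f (x + h *\<^sub>R a + h *\<^sub>R b) - f (x + h *\<^sub>R a) - f (x + h *\<^sub>R b) + f x) / (h * h)) (?D x) < e"
  proof eventually_elim
    case (elim h)
    have "x + s *\<^sub>R a + t *\<^sub>R b \<in> S" if "0 \<le> s" "s \<le> h" "0 \<le> t" "t \<le> h" for s t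
      using near[of s t] d(2) that elim by auto
    then obtain s t where st: "0 < s" "s < h" "0 < t" "t < h" and
      eq: "f (x + h *\<^sub>R a + h *\<^sub>R b) - f (x + h *\<^sub>R a) - f (x + h *\<^sub>R b) + f x
        = h * h * ?D (x + s *\<^sub>R a + t *\<^sub>R b)"
      using second_difference_mvt[OF S(1), of h x a b] elim by blast
    then show ?case using near[of s t] d(2) elim by (simp add: eq)
  qed
qed

lemma ck_on_cong:
  assumes "open S" "\<And>y. y \<in> S \<Longrightarrow> f y = g y"
  shows "ck_on S f k \<longleftrightarrow> ck_on S g k"
  using assms(2)
proof (induction k arbitrary: f g)
  case 0
  then show ?case by (simp cong: continuous_on_cong)
next
  case (Suc k)
  have "f differentiable (at x) \<longleftrightarrow> g differentiable (at x)" if "x \<in> S" for x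
    using differentiable_cong_open[OF assms(1) that] Suc.prems by blast
  moreover have "ck_on S (\<lambda>x. fd f x v) k \<longleftrightarrow> ck_on S (\<lambda>x. fd g x v) k" for v
    by (intro Suc.IH fun_cong[OF fd_cong_open[OF assms(1)]] Suc.prems)
  ultimately show ?case by auto
qed

lemma fd_inner_left:
  "f differentiable (at x) \<Longrightarrow> fd (\<lambda>y. f y \<bullet> c) x v = fd f x v \<bullet> c"
  by (rule fd_eqI[THEN fun_cong], rule has_derivative_inner_left, rule fd_has_derivative)

text \<open>The mean value theorem needs real values, so vector-valued maps are handled one
  component at a time.\<close>

lemma smooth_on_inner:
  assumes "smooth_on S f" "open S"
  shows "smooth_on S (\<lambda>x. f x \<bullet> c)"
proof -
  have "ck_on S f k \<Longrightarrow> ck_on S (\<lambda>x. f x \<bullet> c) k" for k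
  proof (induction k arbitrary: f)
    case 0
    then show ?case by (auto intro: continuous_intros)
  next
    case (Suc k)
    have "fd (\<lambda>y. f y \<bullet> c) x v = fd f x v \<bullet> c" if "x \<in> S" for x v
      using Suc.prems that by (simp add: fd_inner_left)
    then have "ck_on S (\<lambda>x. fd (\<lambda>y. f y \<bullet> c) x v) k" for v
      by (subst ck_on_cong[OF assms(2), where g = "\<lambda>x. fd f x v \<bullet> c"])
        (use Suc in auto)
    then show ?case using Suc.prems
      by (auto simp: differentiable_def) (metis has_derivative_inner_left)
  qed
  then show ?thesis using assms by (simp add: smooth_on_def)
qed

lemma second_derivative_symmetric:
  fixes f :: "'e::euclidean_space \<Rightarrow> 'v::euclidean_space"
  assumes f: "smooth_on S f" and S: "open S" "x \<in> S"
  shows "fd (\<lambda>y. fd f y a) x b = fd (\<lambda>y. fd f y b) x a"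
proof (rule euclidean_eqI)
  fix c :: 'v
  let ?f = "\<lambda>y. f y \<bullet> c"
  have sm: "smooth_on S ?f" using f S by (rule_tac smooth_on_inner)
  have "((\<lambda>h. (?f (x + h *\<^sub>R a + h *\<^sub>R b) - ?f (x + h *\<^sub>R a) - ?f (x + h *\<^sub>R b) + ?f x) / (h * h))
    \<longlongrightarrow> fd (\<lambda>y. fd ?f y b) x a) (at_right 0)"
    using second_difference_tendsto[OF sm S, of b a] by (simp add: algebra_simps)
  with second_difference_tendsto[OF sm S, of a b]
  have eq: "fd (\<lambda>y. fd ?f y a) x b = fd (\<lambda>y. fd ?f y b) x a"
    by (intro tendsto_unique[OF trivial_limit_at_right_real])
  have "fd (\<lambda>y. fd ?f y u) x v = fd (\<lambda>y. fd f y u) x v \<bullet> c" for u v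
  proof -
    have "fd (\<lambda>y. fd ?f y u) x = fd (\<lambda>y. fd f y u \<bullet> c) x"
      using smooth_on_differentiable[OF f] by (intro fd_cong_open[OF S]) (simp add: fd_inner_left)
    then show ?thesis
      using smooth_on_differentiable[OF smooth_on_fd[OF f] S(2)] by (simp add: fd_inner_left)
  qed
  with eq show "fd (\<lambda>y. fd f y a) x b \<bullet> c = fd (\<lambda>y. fd f y b) x a \<bullet> c" by simp
qed


text \<open>The solution is a component of the inverse of \<open>(y, v) \<mapsto> (y, M y v)\<close>, so the inverse
  function theorem avoids differentiating \<open>(M y)\<^sup>-\<^sup>1\<close> directly.\<close>

lemma differentiable_linear_system:
  fixes M :: "'a::euclidean_space \<Rightarrow> 'v::euclidean_space \<Rightarrow> 'v"
  assumes U: "open U" "x \<in> U"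
    and lin: "\<And>y. y \<in> U \<Longrightarrow> linear (M y)" and inj: "\<And>y. y \<in> U \<Longrightarrow> inj (M y)"
    and M: "\<And>y v. y \<in> U \<Longrightarrow> (\<lambda>z. M z v) differentiable (at y)"
    and r: "r differentiable (at x)" and w: "\<And>y. y \<in> U \<Longrightarrow> M y (w y) = r y"
  shows "w differentiable (at x)"
proof -
  define S where "S = U \<times> (UNIV :: 'v set)"
  define f where "f = (\<lambda>p. (fst p, M (fst p) (snd p)))"
  define g where "g = (\<lambda>p. (fst p, inv (M (fst p)) (snd p)))"
  have S: "open S" using U by (simp add: S_def open_Times)
  have fst_der: "fst differentiable (at p)" and snd_der: "snd differentiable (at p)" for p :: "'a \<times> 'v"
    by (auto intro!: bounded_linear_imp_differentiable bounded_linear_fst bounded_linear_snd)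
  have fd_fst: "fd fst p = fst" and fd_snd: "fd snd p = snd" for p :: "'a \<times> 'v"
    by (auto intro!: fd_eqI bounded_linear_imp_has_derivative bounded_linear_fst bounded_linear_snd)
  have M': "(\<lambda>p. M (fst p) v) differentiable (at p)" if "p \<in> S" for p :: "'a \<times> 'v" and v
    using that by (intro differentiable_compose_at[OF fst_der, of "\<lambda>z. M z v"] M) (auto simp: S_def)
  have fd_M: "fd (\<lambda>p. M (fst p) v) p hk = fd (\<lambda>z. M z v) (fst p) (fst hk)" if "p \<in> S"
    for p hk :: "'a \<times> 'v" and v
    using that fd_chain[OF fst_der, of "\<lambda>z. M z v" p hk] M[of "fst p" v]
    by (auto simp: S_def fd_fst)
  have f_der: "(f has_derivative (\<lambda>h. (fst h, fd (\<lambda>z. M z (snd p)) (fst p) (fst h) + M (fst p) (snd h)))) (at p)"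
    if p: "p \<in> S" for p
  proof -
    have "((\<lambda>q. M (fst q) (snd q)) has_derivative
      (\<lambda>h. fd (\<lambda>q. M (fst q) (snd p)) p h + M (fst p) (fd snd p h))) (at p)"
      by (rule has_derivative_linear_family[OF S p])
        (use p in \<open>auto simp: S_def snd_der intro: lin M'\<close>)
    then show ?thesis unfolding f_def
      by (intro has_derivative_Pair) (auto simp: fd_M[OF p] fd_snd intro!: derivative_eq_intros)
  qed
  define p where "p = (x, w x)"
  have p: "p \<in> S" using U by (simp add: p_def S_def)
  have bij: "inv (M y) (M y v) = v" "M y (inv (M y) v) = v" if "y \<in> U" for y v
    using inj[OF that] linear_inj_imp_surj[OF lin[OF that] inj[OF that]]
    by (auto simp: inv_f_f surj_f_inv_f)
  let ?N = "fd (\<lambda>z. M z (w x)) x"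
  \<comment> \<open>The derivative of \<open>f\<close> at \<open>p\<close> is block triangular and
    the candidate is its right inverse. Since \<open>g\<close> inverts \<open>f\<close> on
    \<open>S\<close> by construction, only continuity of \<open>f\<close> is left to supply.\<close>
  have "(g has_derivative (\<lambda>h. (fst h, inv (M x) (snd h - ?N (fst h))))) (at (f p))"
  proof (rule has_derivative_inverse_strong[OF S p _ _ f_der[OF p]])
    show "continuous_on S f"
      using f_der S by (meson continuous_on_eq_continuous_at has_derivative_continuous)
    show "g (f q) = q" if "q \<in> S" for q
      using that bij by (auto simp: g_def f_def S_def)
    show "(\<lambda>h. (fst h, fd (\<lambda>z. M z (snd p)) (fst p) (fst h) + M (fst p) (snd h))) \<circ>
        (\<lambda>h. (fst h, inv (M x) (snd h - ?N (fst h)))) = id"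
      using bij U by (auto simp: p_def fun_eq_iff)
  qed
  then have "g differentiable (at (x, r x))"
    using w U by (auto simp: differentiable_def f_def p_def)
  moreover have "(\<lambda>y. (y, r y)) differentiable (at x)"
    using fd_has_derivative[OF r] by (auto simp: differentiable_def intro!: has_derivative_Pair has_derivative_ident)
  ultimately have "(\<lambda>y. g (y, r y)) differentiable (at x)"
    using differentiable_compose_at[of "\<lambda>y. (y, r y)" x g] by simp
  then have "(\<lambda>y. snd (g (y, r y))) differentiable (at x)"
    using differentiable_compose_at snd_der by blast
  then show ?thesis
    using differentiable_cong_open[OF U, of w "\<lambda>y. snd (g (y, r y))"] bij w
    by (metis g_def fst_conv snd_conv)
qed


section \<open>Riemannian metrics in a chart\<close>

text \<open>Two derivatives of \<open>G\<close> are what curvature uses, as it differentiates the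
  Christoffel symbols once. Stopping there lets the induced metric qualify without a proof that it
  is smooth.\<close>

locale metric_chart =
  fixes U :: "'e::euclidean_space set" and G :: "'e \<Rightarrow> 'e \<Rightarrow> 'e \<Rightarrow> real"
  assumes open_U: "open U"
    and bilinear_G: "y \<in> U \<Longrightarrow> bilinear (G y)"
    and G_sym: "y \<in> U \<Longrightarrow> G y a b = G y b a"
    and G_pos: "y \<in> U \<Longrightarrow> a \<noteq> 0 \<Longrightarrow> G y a a > 0"
    and G_diff: "y \<in> U \<Longrightarrow> (\<lambda>z. G z a b) differentiable (at y)"
    and G_diff2: "y \<in> U \<Longrightarrow> (\<lambda>z. fd (\<lambda>w. G w a b) z c) differentiable (at y)"
begin

lemmas G_simps = bilinear_ladd[OF bilinear_G] bilinear_radd[OF bilinear_G]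
  bilinear_lsub[OF bilinear_G] bilinear_rsub[OF bilinear_G]
  bilinear_lmul[OF bilinear_G] bilinear_rmul[OF bilinear_G]
  bilinear_lneg[OF bilinear_G] bilinear_rneg[OF bilinear_G]
  bilinear_lzero[OF bilinear_G] bilinear_rzero[OF bilinear_G]

lemma G_linear: "y \<in> U \<Longrightarrow> linear (G y a)" "y \<in> U \<Longrightarrow> linear (\<lambda>a. G y a b)"
  using bilinear_G by (auto simp: bilinear_def)

lemma G_eqI:
  assumes "y \<in> U" "\<And>c. G y u c = G y v c"
  shows "u = v"
proof (rule ccontr)
  assume "u \<noteq> v"
  then have "G y (u - v) (u - v) > 0" using G_pos assms by simp
  then show False using assms by (simp add: G_simps)
qed

lemma G_eq_0: "y \<in> U \<Longrightarrow> G y v v = 0 \<longleftrightarrow> v = 0"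
  using G_pos[of y v] by (cases "v = 0") (auto simp: G_simps)

text \<open>The Gram map: it expresses \<open>G y\<close> through the standard inner product. Its
  invertibility gives the representation of linear forms, and it is the matrix of the linear system
  solved by the Christoffel symbols.\<close>

definition G_map :: "'e \<Rightarrow> 'e \<Rightarrow> 'e"
  where "G_map y v = (\<Sum>b\<in>Basis. G y v b *\<^sub>R b)"

lemma G_map_inner: "y \<in> U \<Longrightarrow> G_map y v \<bullet> c = G y v c"
proof -
  assume y: "y \<in> U"
  have "G y v c = G y v (\<Sum>b\<in>Basis. (c \<bullet> b) *\<^sub>R b)" by (simp add: euclidean_representation)
  also have "\<dots> = (\<Sum>b\<in>Basis. (c \<bullet> b) * G y v b)"
    using G_linear(1)[OF y] by (simp add: linear_sum linear_cmul)
  finally show ?thesis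
    by (simp add: G_map_def inner_sum_left inner_commute[of c] mult.commute)
qed

lemma linear_G_map: "y \<in> U \<Longrightarrow> linear (G_map y)"
  by (rule linearI) (auto simp: G_map_def G_simps scaleR_add_left sum.distrib scaleR_sum_right)

lemma inj_G_map: "y \<in> U \<Longrightarrow> inj (G_map y)"
  by (rule injI) (metis G_eqI G_map_inner)

lemma G_represent:
  assumes "y \<in> U" "linear \<beta>"
  shows "\<exists>!w. \<forall>c. G y w c = \<beta> c"
proof -
  have "surj (G_map y)" using assms linear_G_map inj_G_map linear_inj_imp_surj by blast
  then obtain w where "G_map y w = (\<Sum>b\<in>Basis. \<beta> b *\<^sub>R b)" by (metis surjD)
  then have "G y w c = (\<Sum>b\<in>Basis. (c \<bullet> b) * \<beta> b)" for c
    using G_map_inner[OF assms(1), of w c]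
    by (simp add: inner_sum_left inner_commute[of c] mult.commute)
  also have "(\<Sum>b\<in>Basis. (c \<bullet> b) * \<beta> b) = \<beta> c" for c
    using linear_sum[OF assms(2), of "\<lambda>b. (c \<bullet> b) *\<^sub>R b" Basis]
    by (simp add: linear_cmul[OF assms(2)] euclidean_representation)
  finally show ?thesis using G_eqI[OF assms(1)] by metis
qed

section \<open>Christoffel symbols from the Koszul formula for constant fields\<close>

definition koszul :: "'e \<Rightarrow> 'e \<Rightarrow> 'e \<Rightarrow> 'e \<Rightarrow> real"
  where "koszul y a b c =
    fd (\<lambda>z. G z b c) y a + fd (\<lambda>z. G z a c) y b - fd (\<lambda>z. G z a b) y c"

text \<open>Given by a definite description so that it agrees literally with
  \<open>christoffel\<close> once the metric is written in a chart.\<close>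

definition \<Gamma> :: "'e \<Rightarrow> 'e \<Rightarrow> 'e \<Rightarrow> 'e"
  where "\<Gamma> y a b = (THE w. \<forall>c. 2 * G y w c = koszul y a b c)"

lemma fd_G_bilinear:
  assumes y: "y \<in> U"
  shows "fd (\<lambda>z. G z (a + a') b) y c = fd (\<lambda>z. G z a b) y c + fd (\<lambda>z. G z a' b) y c"
    and "fd (\<lambda>z. G z (r *\<^sub>R a) b) y c = r * fd (\<lambda>z. G z a b) y c"
    and "fd (\<lambda>z. G z a b) y c = fd (\<lambda>z. G z b a) y c"
    and "fd (\<lambda>z. G z a b) y (c + c') = fd (\<lambda>z. G z a b) y c + fd (\<lambda>z. G z a b) y c'"
    and "fd (\<lambda>z. G z a b) y (r *\<^sub>R c) = r * fd (\<lambda>z. G z a b) y c"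
proof -
  have "fd (\<lambda>z. G z (a + a') b) y = fd (\<lambda>z. G z a b + G z a' b) y"
    by (rule fd_cong_open[OF open_U y]) (simp add: G_simps)
  then show "fd (\<lambda>z. G z (a + a') b) y c = fd (\<lambda>z. G z a b) y c + fd (\<lambda>z. G z a' b) y c"
    by (simp add: fd_add G_diff y)
  have "fd (\<lambda>z. G z (r *\<^sub>R a) b) y = fd (\<lambda>z. r * G z a b) y"
    by (rule fd_cong_open[OF open_U y]) (simp add: G_simps)
  then show "fd (\<lambda>z. G z (r *\<^sub>R a) b) y c = r * fd (\<lambda>z. G z a b) y c"
    by (simp add: fd_cmult G_diff y)
  have "fd (\<lambda>z. G z a b) y = fd (\<lambda>z. G z b a) y"
    by (rule fd_cong_open[OF open_U y]) (simp add: G_sym)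
  then show "fd (\<lambda>z. G z a b) y c = fd (\<lambda>z. G z b a) y c" by simp
  have "linear (fd (\<lambda>z. G z a b) y)" by (simp add: linear_frechet_derivative G_diff y)
  then show "fd (\<lambda>z. G z a b) y (c + c') = fd (\<lambda>z. G z a b) y c + fd (\<lambda>z. G z a b) y c'"
    "fd (\<lambda>z. G z a b) y (r *\<^sub>R c) = r * fd (\<lambda>z. G z a b) y c"
    by (simp_all add: linear_add linear_cmul)
qed

lemma linear_koszul: "y \<in> U \<Longrightarrow> linear (koszul y a b)"
  using fd_G_bilinear by (intro linearI) (auto simp: koszul_def algebra_simps)

lemma \<Gamma>_works: 
  assumes "y \<in> U"
  shows "2 * G y (\<Gamma> y a b) c = koszul y a b c"
proof -
  have "linear (\<lambda>c. koszul y a b c / 2)"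
    using linear_koszul[OF assms, of a b] by (simp add: linear_iff add_divide_distrib)
  from G_represent[OF assms this] have "\<exists>!w. \<forall>c. 2 * G y w c = koszul y a b c"
    by (simp add: field_simps)
  from theI'[OF this] show ?thesis unfolding \<Gamma>_def by blast
qed

lemma \<Gamma>_sym: "y \<in> U \<Longrightarrow> \<Gamma> y a b = \<Gamma> y b a"
  using fd_G_bilinear(3)[of y a b] by (simp add: \<Gamma>_def koszul_def add_ac)

lemma bilinear_\<Gamma>: 
  assumes y: "y \<in> U"
  shows "bilinear (\<Gamma> y)"
proof -
  have k: "koszul y (a + a') b c = koszul y a b c + koszul y a' b c"
     "koszul y (r *\<^sub>R a) b c = r * koszul y a b c" for a a' b c r
    using fd_G_bilinear[OF y] by (simp_all add: koszul_def algebra_simps)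
  have "\<Gamma> y (a + a') b = \<Gamma> y a b + \<Gamma> y a' b" for a a' b
    by (rule G_eqI[OF y]) (use \<Gamma>_works[OF y] k(1)[of a a' b] in \<open>simp add: G_simps y; smt (verit)\<close>)
  moreover have "\<Gamma> y (r *\<^sub>R a) b = r *\<^sub>R \<Gamma> y a b" for r a b
  proof (rule G_eqI[OF y])
    show "G y (\<Gamma> y (r *\<^sub>R a) b) c = G y (r *\<^sub>R \<Gamma> y a b) c" for c
      using \<Gamma>_works[OF y, of "r *\<^sub>R a" b c] \<Gamma>_works[OF y, of a b c, symmetric] k(2)[of r a b c]
      by (simp add: G_simps y)
  qed
  ultimately have "linear (\<lambda>a. \<Gamma> y a b)" for b by (auto intro: linearI)
  then show ?thesis using \<Gamma>_sym[OF y] by (simp add: bilinear_def)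
qed

lemmas \<Gamma>_simps = bilinear_ladd[OF bilinear_\<Gamma>] bilinear_radd[OF bilinear_\<Gamma>]
  bilinear_lsub[OF bilinear_\<Gamma>] bilinear_rsub[OF bilinear_\<Gamma>]
  bilinear_lmul[OF bilinear_\<Gamma>] bilinear_rmul[OF bilinear_\<Gamma>]
  bilinear_lneg[OF bilinear_\<Gamma>] bilinear_rneg[OF bilinear_\<Gamma>]
  bilinear_lzero[OF bilinear_\<Gamma>] bilinear_rzero[OF bilinear_\<Gamma>]

lemma \<Gamma>_metric:
  assumes y: "y \<in> U"
  shows "fd (\<lambda>z. G z b c) y a = G y (\<Gamma> y a b) c + G y b (\<Gamma> y a c)"
  using \<Gamma>_works[OF y, of a b c] \<Gamma>_works[OF y, of a c b] G_sym[OF y, of b "\<Gamma> y a c"]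
    fd_G_bilinear(3)[OF y, of b c] 
  by (simp add: koszul_def)

text \<open>The Koszul formula, tested on basis vectors, is a linear system for
  \<open>\<Gamma> z a b\<close> with the differentiable invertible matrix
  \<open>G_map z\<close>.\<close>

lemma \<Gamma>_diff:
  assumes y: "y \<in> U"
  shows "(\<lambda>z. \<Gamma> z a b) differentiable (at y)"
proof (rule differentiable_linear_system[OF open_U y])
  show "linear (G_map z)" "inj (G_map z)" if "z \<in> U" for z
    using that linear_G_map inj_G_map by auto
  show "(\<lambda>z. G_map z v) differentiable (at x)" if "x \<in> U" for x v
    unfolding G_map_def using that
    by (auto intro!: differentiable_sum differentiable_scaleR G_diff)
  show "(\<lambda>z. \<Sum>c\<in>Basis. (koszul z a b c / 2) *\<^sub>R c) differentiable (at y)"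
    unfolding koszul_def using y
    by (auto intro!: differentiable_sum differentiable_scaleR differentiable_divide
        differentiable_add differentiable_diff G_diff2)
  show "G_map z (\<Gamma> z a b) = (\<Sum>c\<in>Basis. (koszul z a b c / 2) *\<^sub>R c)" if "z \<in> U" for z
    unfolding G_map_def using \<Gamma>_works[OF that, of a b]
    by (intro sum.cong) (auto simp: field_simps)
qed

section \<open>Curvature and covariant derivatives along a map\<close>

definition curv :: "'e \<Rightarrow> 'e \<Rightarrow> 'e \<Rightarrow> 'e \<Rightarrow> 'e"
  where "curv y a b c = fd (\<lambda>z. \<Gamma> z b c) y a + \<Gamma> y a (\<Gamma> y b c)
    - (fd (\<lambda>z. \<Gamma> z a c) y b + \<Gamma> y b (\<Gamma> y a c))"

text \<open>The map \<open>F\<close> is kept general so that one formula serves twice: the identity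
  gives the connection itself, an immersion gives the ambient derivative of fields along the
  submanifold.\<close>

definition cov :: "('f::euclidean_space \<Rightarrow> 'e) \<Rightarrow> ('f \<Rightarrow> 'e) \<Rightarrow> 'f \<Rightarrow> 'f \<Rightarrow> 'e"
  where "cov F Y x a = fd Y x a + \<Gamma> (F x) (fd F x a) (Y x)"

lemma along:
  fixes F :: "'f::euclidean_space \<Rightarrow> 'e"
  assumes V: "open V" "x \<in> V" and F: "\<And>z. z \<in> V \<Longrightarrow> F z \<in> U" "F differentiable (at x)"
    and Y: "Y differentiable (at x)" and Z: "Z differentiable (at x)"
  shows differentiable_G_along: "(\<lambda>z. G (F z) (Y z) (Z z)) differentiable (at x)"
    and fd_G_along: "fd (\<lambda>z. G (F z) (Y z) (Z z)) x a
      = G (F x) (cov F Y x a) (Z x) + G (F x) (Y x) (cov F Z x a)"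
    and differentiable_\<Gamma>_along: "(\<lambda>z. \<Gamma> (F z) (Y z) (Z z)) differentiable (at x)"
    and fd_\<Gamma>_along: "fd (\<lambda>z. \<Gamma> (F z) (Y z) (Z z)) x a
      = fd (\<lambda>y. \<Gamma> y (Y x) (Z x)) (F x) (fd F x a)
        + \<Gamma> (F x) (fd Y x a) (Z x) + \<Gamma> (F x) (Y x) (fd Z x a)"
proof -
  have Fx: "F x \<in> U" using F V by simp
  have dG: "(\<lambda>z. G (F z) u v) differentiable (at x)"
    "fd (\<lambda>z. G (F z) u v) x a = fd (\<lambda>y. G y u v) (F x) (fd F x a)" for u v a
    using differentiable_compose_at[OF F(2) G_diff[OF Fx]] fd_chain[OF F(2) G_diff[OF Fx]] by auto
  have dL: "(\<lambda>z. \<Gamma> (F z) u v) differentiable (at x)"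
    "fd (\<lambda>z. \<Gamma> (F z) u v) x a = fd (\<lambda>y. \<Gamma> y u v) (F x) (fd F x a)" for u v a
    using differentiable_compose_at[OF F(2) \<Gamma>_diff[OF Fx]] fd_chain[OF F(2) \<Gamma>_diff[OF Fx]] by auto
  note rG = bilinear_family_rule[OF V bilinear_G[OF F(1)] dG(1) Y Z]
  note rL = bilinear_family_rule[OF V bilinear_\<Gamma>[OF F(1)] dL(1) Y Z]
  show "(\<lambda>z. G (F z) (Y z) (Z z)) differentiable (at x)" using rG by blast
  show "(\<lambda>z. \<Gamma> (F z) (Y z) (Z z)) differentiable (at x)" using rL by blast
  show "fd (\<lambda>z. \<Gamma> (F z) (Y z) (Z z)) x a
      = fd (\<lambda>y. \<Gamma> y (Y x) (Z x)) (F x) (fd F x a)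
        + \<Gamma> (F x) (fd Y x a) (Z x) + \<Gamma> (F x) (Y x) (fd Z x a)"
    using rL(2) dL(2) by simp
  show "fd (\<lambda>z. G (F z) (Y z) (Z z)) x a
      = G (F x) (cov F Y x a) (Z x) + G (F x) (Y x) (cov F Z x a)"
    using rG(2)[of a] dG(2) by (simp add: \<Gamma>_metric[OF Fx] cov_def G_simps Fx)
qed

text \<open>Second derivatives of \<open>F\<close> and \<open>Y\<close> cancel by symmetry, and so
  do the terms with one derivative of \<open>Y\<close>. What survives is the derivative of
  \<open>\<Gamma>\<close> and its quadratic part, which is \<open>curv\<close>.\<close>

lemma ricci_identity:
  fixes F :: "'f::euclidean_space \<Rightarrow> 'e"
  assumes V: "open V" "x \<in> V" and F: "\<And>z. z \<in> V \<Longrightarrow> F z \<in> U" "smooth_on V F" and Y: "smooth_on V Y"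
  shows "cov F (\<lambda>z. cov F Y z b) x a - cov F (\<lambda>z. cov F Y z a) x b
    = curv (F x) (fd F x a) (fd F x b) (Y x)"
proof -
  note d = smooth_on_differentiable[OF _ V(2)]
  have dF: "F differentiable (at x)" and dY: "Y differentiable (at x)" using d F Y by auto
  have dF2: "(\<lambda>z. fd F z b) differentiable (at x)" for b using d F smooth_on_fd by blast
  have dY2: "(\<lambda>z. fd Y z b) differentiable (at x)" for b using d Y smooth_on_fd by blast
  have Fx: "F x \<in> U" using F V by simp
  have "fd (\<lambda>z. cov F Y z b) x a = fd (\<lambda>z. fd Y z b) x a
      + (fd (\<lambda>y. \<Gamma> y (fd F x b) (Y x)) (F x) (fd F x a)
        + \<Gamma> (F x) (fd (\<lambda>z. fd F z b) x a) (Y x) + \<Gamma> (F x) (fd F x b) (fd Y x a))" for a b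
    unfolding cov_def
    by (simp add: fd_add[OF dY2 differentiable_\<Gamma>_along[OF V F(1) dF dF2 dY]]
        fd_\<Gamma>_along[OF V F(1) dF dF2 dY])
  moreover have "fd (\<lambda>z. fd Y z b) x a = fd (\<lambda>z. fd Y z a) x b"
    "fd (\<lambda>z. fd F z b) x a = fd (\<lambda>z. fd F z a) x b"
    by (intro second_derivative_symmetric[OF _ V] F Y)+
  ultimately show ?thesis
    unfolding cov_def[of F "\<lambda>z. cov F Y z _"] by (simp add: cov_def curv_def \<Gamma>_simps Fx)
qed

end


section \<open>The Gauss equation in charts\<close>

locale immersed_chart = metric_chart U G
  for U :: "'e::euclidean_space set" and G :: "'e \<Rightarrow> 'e \<Rightarrow> 'e \<Rightarrow> real" +
  fixes V :: "'f::euclidean_space set" and F :: "'f \<Rightarrow> 'e"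
  assumes open_V: "open V"
    and F_in: "x \<in> V \<Longrightarrow> F x \<in> U"
    and F_smooth: "smooth_on V F"
    and F_immersion: "x \<in> V \<Longrightarrow> fd F x a = 0 \<Longrightarrow> a = 0"
begin

lemma F_diff: "x \<in> V \<Longrightarrow> F differentiable (at x)"
  using F_smooth smooth_on_differentiable by blast

lemma F_diff2: "x \<in> V \<Longrightarrow> (\<lambda>z. fd F z a) differentiable (at x)"
  using F_smooth smooth_on_differentiable smooth_on_fd by blast

lemma F_diff3: "x \<in> V \<Longrightarrow> (\<lambda>z. fd (\<lambda>z. fd F z a) z b) differentiable (at x)"
  using F_smooth smooth_on_differentiable smooth_on_fd by blast

lemma F_linear: "x \<in> V \<Longrightarrow> linear (fd F x)"
  using F_diff linear_frechet_derivative by blast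

lemma fd_F_fd_F_sym: "x \<in> V \<Longrightarrow> fd (\<lambda>z. fd F z a) x b = fd (\<lambda>z. fd F z b) x a"
  using second_derivative_symmetric F_smooth open_V by blast

lemmas F_simps = linear_add[OF F_linear] linear_diff[OF F_linear] linear_cmul[OF F_linear]
  linear_0[OF F_linear] linear_neg[OF F_linear]

definition gM :: "'f \<Rightarrow> 'f \<Rightarrow> 'f \<Rightarrow> real"
  where "gM x a b = G (F x) (fd F x a) (fd F x b)"

text \<open>The Hessian of the immersion: its tangential part is the intrinsic connection and its
  normal part the second fundamental form.\<close>

definition hess :: "'f \<Rightarrow> 'f \<Rightarrow> 'f \<Rightarrow> 'e"
  where "hess x a b = cov F (\<lambda>z. fd F z b) x a"

lemma hess_eq: "hess x a b = fd (\<lambda>z. fd F z b) x a + \<Gamma> (F x) (fd F x a) (fd F x b)"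
  by (simp add: hess_def cov_def)

lemma hess_sym: "x \<in> V \<Longrightarrow> hess x a b = hess x b a"
  using fd_F_fd_F_sym \<Gamma>_sym F_in by (simp add: hess_eq)

lemma hess_linear: 
  assumes x: "x \<in> V"
  shows "linear (\<lambda>a. hess x a b)"
proof (rule linearI)
  note l = linear_frechet_derivative[OF F_diff2[OF x]]
  show "hess x (a + a') b = hess x a b + hess x a' b" for a a'
    by (simp add: hess_eq F_simps x F_in \<Gamma>_simps linear_add[OF l])
  show "hess x (r *\<^sub>R a) b = r *\<^sub>R hess x a b" for a r
    by (simp add: hess_eq F_simps x F_in \<Gamma>_simps linear_cmul[OF l] scaleR_add_right)
qed

lemma bilinear_hess: 
  assumes x: "x \<in> V"
  shows "bilinear (hess x)"
proof -
  have "linear (hess x a)" for a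
  proof -
    have "hess x a = (\<lambda>b. hess x b a)" using hess_sym[OF x] by blast
    then show ?thesis using hess_linear[OF x, of a] by simp
  qed
  then show ?thesis using hess_linear[OF x] by (simp add: bilinear_def)
qed

lemma hess_diff: "x \<in> V \<Longrightarrow> (\<lambda>z. hess z a b) differentiable (at x)"
  unfolding hess_eq
  by (intro differentiable_add F_diff3 differentiable_\<Gamma>_along[OF open_V _ F_in F_diff F_diff2 F_diff2])

lemma gM_diff: "x \<in> V \<Longrightarrow> (\<lambda>z. gM z a b) differentiable (at x)"
  unfolding gM_def by (intro differentiable_G_along[OF open_V _ F_in F_diff F_diff2 F_diff2])

lemma fd_gM:
  "x \<in> V \<Longrightarrow> fd (\<lambda>z. gM z a b) x c
    = G (F x) (hess x c a) (fd F x b) + G (F x) (fd F x a) (hess x c b)"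
  unfolding gM_def hess_def by (intro fd_G_along[OF open_V _ F_in F_diff F_diff2 F_diff2])

sublocale M: metric_chart V gM
proof
  show "open V" by (rule open_V)
  fix x a b assume x: "x \<in> V"
  show "bilinear (gM x)"
    by (auto simp: bilinear_def gM_def F_simps G_simps x F_in intro!: linearI)
  show "gM x a b = gM x b a" by (simp add: gM_def G_sym F_in x)
  show "a \<noteq> 0 \<Longrightarrow> gM x a a > 0"
    using F_immersion[OF x] G_pos[OF F_in[OF x]] by (auto simp: gM_def)
  show "(\<lambda>z. gM z a b) differentiable (at x)" by (rule gM_diff[OF x])
  fix c
  \<comment> \<open>This is the first derivative of the induced metric in the form of
    \<open>fd_gM\<close>, so a second derivative of \<open>gM\<close> needs only one derivative of
    \<open>hess\<close>.\<close>
  have "(\<lambda>z. G (F z) (hess z c a) (fd F z b) + G (F z) (fd F z a) (hess z c b)) differentiable (at x)"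
    by (intro differentiable_add differentiable_G_along[OF open_V x F_in F_diff[OF x]]
      F_diff2[OF x] hess_diff[OF x])
  then show "(\<lambda>z. fd (\<lambda>w. gM w a b) z c) differentiable (at x)"
    by (subst differentiable_cong_open[OF open_V x fd_gM])
qed

text \<open>With \<open>fd_gM\<close> and the symmetry of \<open>hess\<close>, four of the six terms
  in the Koszul sum of \<open>gM\<close> cancel; the other two give twice the left-hand
  side.\<close>

lemma G_hess_tangent:
  assumes x: "x \<in> V"
  shows "G (F x) (hess x a b) (fd F x c) = gM x (M.\<Gamma> x a b) c"
  using M.\<Gamma>_works[OF x, of a b c] hess_sym[OF x] G_sym[OF F_in[OF x]]
  by (simp add: M.koszul_def fd_gM x)

section \<open>The second fundamental form and the Gauss equation\<close>

definition sff :: "'f \<Rightarrow> 'f \<Rightarrow> 'f \<Rightarrow> 'e"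
  where "sff x a b = hess x a b - fd F x (M.\<Gamma> x a b)"

lemma sff_normal: "x \<in> V \<Longrightarrow> G (F x) (sff x a b) (fd F x c) = 0"
  by (simp add: sff_def G_simps F_in G_hess_tangent gM_def)

lemma sff_sym: "x \<in> V \<Longrightarrow> sff x a b = sff x b a"
  by (simp add: sff_def hess_sym[of x a] M.\<Gamma>_sym[of x a])

lemma bilinear_sff: "x \<in> V \<Longrightarrow> bilinear (sff x)"
  using bilinear_hess[of x] M.bilinear_\<Gamma>[of x] F_linear[of x]
  unfolding bilinear_def sff_def
  by (auto intro!: linear_compose_sub linear_compose[unfolded o_def, of _ "fd F x"])

text \<open>Orthogonality of the normal and tangential parts. The tangential product is the one that
  cancels in the Gauss equation.\<close>

lemma G_hess_hess:
  assumes x: "x \<in> V"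
  shows "G (F x) (hess x a b) (hess x c d)
    = G (F x) (sff x a b) (sff x c d) + gM x (M.\<Gamma> x a b) (M.\<Gamma> x c d)"
proof -
  have "hess x a b = sff x a b + fd F x (M.\<Gamma> x a b)" for a b by (simp add: sff_def)
  moreover have "G (F x) (fd F x c) (sff x a b) = 0" for a b c
    using sff_normal[OF x] G_sym[OF F_in[OF x]] by simp
  ultimately show ?thesis by (simp add: G_simps F_in x sff_normal gM_def)
qed

text \<open>Taking the inner product with a tangent vector before differentiating the second
  fundamental form makes the normal connection unnecessary.\<close>

lemma gauss_equation:
  assumes x: "x \<in> V"
  shows "gM x (M.curv x a b c) d = G (F x) (curv (F x) (fd F x a) (fd F x b) (fd F x c)) (fd F x d)
    + G (F x) (sff x b c) (sff x a d) - G (F x) (sff x a c) (sff x b d)"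
proof -
  \<comment> \<open>The identity \<open>G_hess_tangent\<close> is differentiated along
    \<open>a\<close> in two ways, by the ambient product rule and by that of the induced metric. In
    the term with two Hessians the product of Christoffel symbols cancels, leaving the product of
    second fundamental forms.\<close>
  have key: "G (F x) (cov F (\<lambda>z. hess z b c) x a) (fd F x d)
    = gM x (fd (\<lambda>z. M.\<Gamma> z b c) x a + M.\<Gamma> x a (M.\<Gamma> x b c)) d - G (F x) (sff x b c) (sff x a d)" for a b
  proof -
    have "G (F x) (cov F (\<lambda>z. hess z b c) x a) (fd F x d) + G (F x) (hess x b c) (hess x a d)
        = fd (\<lambda>z. G (F z) (hess z b c) (fd F z d)) x a"
      unfolding hess_def[of x a d]
      by (intro fd_G_along[OF open_V x F_in F_diff[OF x], symmetric] hess_diff[OF x] F_diff2[OF x])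
    also have "\<dots> = fd (\<lambda>z. gM z (M.\<Gamma> z b c) d) x a"
      by (intro fun_cong[OF fd_cong_open[OF open_V x]] G_hess_tangent)
    also have "\<dots> = gM x (M.cov (\<lambda>z. z) (\<lambda>z. M.\<Gamma> z b c) x a) d
        + gM x (M.\<Gamma> x b c) (M.cov (\<lambda>z. z) (\<lambda>z. d) x a)"
      by (intro M.fd_G_along[OF open_V x] M.\<Gamma>_diff[OF x]) auto
    finally show ?thesis by (simp add: M.cov_def G_hess_hess[OF x])
  qed
  have "cov F (\<lambda>z. hess z b c) x a - cov F (\<lambda>z. hess z a c) x b
    = curv (F x) (fd F x a) (fd F x b) (fd F x c)"
    unfolding hess_def using ricci_identity[OF open_V x F_in F_smooth smooth_on_fd[OF F_smooth]] .
  then have "G (F x) (curv (F x) (fd F x a) (fd F x b) (fd F x c)) (fd F x d)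
    = G (F x) (cov F (\<lambda>z. hess z b c) x a) (fd F x d) - G (F x) (cov F (\<lambda>z. hess z a c) x b) (fd F x d)"
    by (simp add: G_simps F_in x flip: \<open>_ = curv _ _ _ _\<close>)
  then show ?thesis
    by (simp add: key M.curv_def M.G_simps x)
qed

end


section \<open>Contact metric structures in charts\<close>

text \<open>The form \<eta> is not a separate datum but \<open>G y a (\<xi> y)\<close>. The
  assumption \<open>contact\<close> is the coordinate form of the condition on d\<eta>: constant
  fields commute, so no bracket term appears.\<close>

locale contact_chart = metric_chart U G
  for U :: "'e::euclidean_space set" and G :: "'e \<Rightarrow> 'e \<Rightarrow> 'e \<Rightarrow> real" +
  fixes \<xi> :: "'e \<Rightarrow> 'e" and \<phi> :: "'e \<Rightarrow> 'e \<Rightarrow> 'e"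
  assumes \<xi>_smooth: "smooth_on U \<xi>"
    and \<eta>_smooth: "smooth_on U (\<lambda>z. G z a (\<xi> z))"
    and \<phi>_linear: "y \<in> U \<Longrightarrow> linear (\<phi> y)"
    and \<phi>_diff: "y \<in> U \<Longrightarrow> (\<lambda>z. \<phi> z a) differentiable (at y)"
    and \<xi>_unit: "y \<in> U \<Longrightarrow> G y (\<xi> y) (\<xi> y) = 1"
    and \<phi>_\<xi>: "y \<in> U \<Longrightarrow> \<phi> y (\<xi> y) = 0"
    and \<phi>_\<phi>: "y \<in> U \<Longrightarrow> \<phi> y (\<phi> y a) = - a + G y a (\<xi> y) *\<^sub>R \<xi> y"
    and \<phi>_skew: "y \<in> U \<Longrightarrow> G y a (\<phi> y b) = - G y (\<phi> y a) b"
    and contact: "y \<in> U \<Longrightarrow>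
      (fd (\<lambda>z. G z b (\<xi> z)) y a - fd (\<lambda>z. G z a (\<xi> z)) y b) / 2 = G y a (\<phi> y b)"
begin

abbreviation covd :: "('e \<Rightarrow> 'e) \<Rightarrow> 'e \<Rightarrow> 'e \<Rightarrow> 'e"
  where "covd \<equiv> cov (\<lambda>z. z)"

lemma covd_eq: "covd Y y a = fd Y y a + \<Gamma> y a (Y y)"
  by (simp add: cov_def)

definition T :: "'e \<Rightarrow> 'e \<Rightarrow> 'e"
  where "T y a = covd \<xi> y a"

text \<open>By \<open>T_skew_part\<close> the skew part of \<open>T\<close> is - \<phi>, so
  \<open>P\<close> is its symmetric part; in the classical formula for the derivative of \<xi> it is
  - \<phi> h.\<close>

definition P :: "'e \<Rightarrow> 'e \<Rightarrow> 'e"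
  where "P y a = T y a + \<phi> y a"

text \<open>\<open>N\<close> and \<open>K\<close> are the covariant derivatives of \<open>\<phi>\<close> and \<open>T\<close> in the direction \<open>\<xi>\<close>.\<close>

definition N :: "'e \<Rightarrow> 'e \<Rightarrow> 'e"
  where "N y a = covd (\<lambda>z. \<phi> z a) y (\<xi> y) - \<phi> y (\<Gamma> y (\<xi> y) a)"

definition K :: "'e \<Rightarrow> 'e \<Rightarrow> 'e"
  where "K y a = covd (\<lambda>z. T z a) y (\<xi> y) - T y (\<Gamma> y (\<xi> y) a)"

text \<open>Half the Lie derivative of \<phi> along \<xi>, evaluated on the constant field
  \<open>a\<close>, whose bracket [\<xi>, a] is minus the derivative of \<xi> along
  \<open>a\<close>.\<close>

definition h :: "'e \<Rightarrow> 'e \<Rightarrow> 'e"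
  where "h y a = (1/2) *\<^sub>R (fd (\<lambda>z. \<phi> z a) y (\<xi> y) - fd \<xi> y (\<phi> y a) + \<phi> y (fd \<xi> y a))"

lemma \<xi>_diff: "y \<in> U \<Longrightarrow> \<xi> differentiable (at y)"
  using \<xi>_smooth smooth_on_differentiable by blast

lemma \<xi>_diff2: "y \<in> U \<Longrightarrow> (\<lambda>z. fd \<xi> z a) differentiable (at y)"
  using \<xi>_smooth smooth_on_differentiable smooth_on_fd by blast

lemmas \<phi>_simps = linear_add[OF \<phi>_linear] linear_diff[OF \<phi>_linear] linear_cmul[OF \<phi>_linear]
  linear_0[OF \<phi>_linear] linear_neg[OF \<phi>_linear]

lemma T_linear: 
  assumes y: "y \<in> U"
  shows "linear (T y)"
  using linear_frechet_derivative[OF \<xi>_diff[OF y]]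
  by (intro linearI) (auto simp: T_def covd_eq linear_add linear_cmul \<Gamma>_simps y scaleR_add_right)

lemmas T_simps = linear_add[OF T_linear] linear_diff[OF T_linear] linear_cmul[OF T_linear]
  linear_0[OF T_linear] linear_neg[OF T_linear]

lemma T_diff: "y \<in> U \<Longrightarrow> (\<lambda>z. T z a) differentiable (at y)"
  unfolding T_def covd_eq
  by (intro differentiable_add \<xi>_diff2 \<xi>_diff differentiable_const
    differentiable_\<Gamma>_along[OF open_U, where F = "\<lambda>z. z"]) auto

lemma fd_G:
  assumes "y \<in> U" "Y differentiable (at y)" "Z differentiable (at y)"
  shows "fd (\<lambda>z. G z (Y z) (Z z)) y a = G y (covd Y y a) (Z y) + G y (Y y) (covd Z y a)"
  by (intro fd_G_along[OF open_U assms(1)] assms) auto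

section \<open>The covariant derivative of the Reeb field\<close>

lemma fd_\<eta>:
  assumes y: "y \<in> U"
  shows "fd (\<lambda>z. G z b (\<xi> z)) y a = G y (\<Gamma> y a b) (\<xi> y) + G y b (T y a)"
  using fd_G[OF y _ \<xi>_diff[OF y], of "\<lambda>z. b"] by (simp add: covd_eq T_def)

text \<open>The Christoffel symbols are symmetric, so they drop out of the antisymmetrized
  derivative of \<eta> and only \<open>T\<close> remains.\<close>

lemma T_skew_part: 
  assumes y: "y \<in> U"
  shows "G y b (T y a) - G y a (T y b) = 2 * G y a (\<phi> y b)"
  using contact[OF y, of b a] \<Gamma>_sym[OF y, of a b] by (simp add: fd_\<eta> y)

lemma G_T_\<xi>: 
  assumes y: "y \<in> U"
  shows "G y (T y a) (\<xi> y) = 0"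
proof -
  have "fd (\<lambda>z. G z (\<xi> z) (\<xi> z)) y = fd (\<lambda>z. 1) y"
    by (rule fd_cong_open[OF open_U y]) (rule \<xi>_unit)
  with fd_G[OF y \<xi>_diff[OF y] \<xi>_diff[OF y], of a] show ?thesis
    using G_sym[OF y, of "\<xi> y" "T y a"] by (simp add: T_def)
qed

text \<open>Integral curves of \<xi> are geodesics: paired with \<xi>, the skew part of
  \<open>T\<close> vanishes since \<phi> \<xi> = 0, and the unit length of \<xi> removes the
  transposed term.\<close>

lemma T_\<xi>: 
  assumes y: "y \<in> U"
  shows "T y (\<xi> y) = 0"
proof (rule G_eqI[OF y])
  fix c
  show "G y (T y (\<xi> y)) c = G y 0 c"
    using T_skew_part[OF y, of c "\<xi> y"] G_T_\<xi>[OF y, of c] \<phi>_skew[OF y, of "\<xi> y" c] \<phi>_\<xi>[OF y]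
      G_sym[OF y, of c "T y (\<xi> y)"] G_sym[OF y, of "\<xi> y" "T y c"]
    by (simp add: G_simps y)
qed

lemma covd_\<phi>:
  assumes y: "y \<in> U" and X: "X differentiable (at y)"
  shows "covd (\<lambda>z. \<phi> z (X z)) y (\<xi> y) = N y (X y) + \<phi> y (covd X y (\<xi> y))"
  using fd_linear_family[OF open_U y \<phi>_linear \<phi>_diff[OF y] X, of "\<xi> y"]
  by (simp add: N_def covd_eq \<phi>_simps y)

lemma covd_T:
  assumes y: "y \<in> U" and X: "X differentiable (at y)"
  shows "covd (\<lambda>z. T z (X z)) y (\<xi> y) = K y (X y) + T y (covd X y (\<xi> y))"
  using fd_linear_family[OF open_U y T_linear T_diff[OF y] X, of "\<xi> y"]
  by (simp add: K_def covd_eq T_simps y)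

text \<open>The identity \<open>d (d \<eta>) = 0\<close>, contracted with \<open>\<xi>\<close>.\<close>

lemma closed_\<Phi>:
  assumes y: "y \<in> U"
  shows "G y (T y a) (\<phi> y b) + G y a (N y b) + G y a (\<phi> y (T y b)) = 0"
proof -
  define \<eta> where "\<eta> = (\<lambda>a z. G z a (\<xi> z))"
  have \<eta>_sm: "smooth_on U (\<eta> a)" for a by (simp add: \<eta>_def \<eta>_smooth)
  have \<eta>_diff: "(\<lambda>z. fd (\<eta> a) z b) differentiable (at y)" for a b
    using \<eta>_sm smooth_on_fd smooth_on_differentiable y by blast
  have half: "fd (\<lambda>z. G z a (\<phi> z b)) y c = (fd (\<lambda>z. fd (\<eta> b) z a) y c - fd (\<lambda>z. fd (\<eta> a) z b) y c) / 2"
    for a b c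
  proof -
    have "fd (\<lambda>z. G z a (\<phi> z b)) y = fd (\<lambda>z. (1/2) * (fd (\<eta> b) z a - fd (\<eta> a) z b)) y"
      by (rule fd_cong_open[OF open_U y]) (simp add: \<eta>_def flip: contact)
    then show ?thesis
      using fd_cmult[OF differentiable_diff[OF \<eta>_diff \<eta>_diff], of "1/2" b a a b]
        fd_diff[OF \<eta>_diff \<eta>_diff, of b a a b] by simp
  qed
  define c where "c = \<xi> y"
  \<comment> \<open>This cyclic sum is d(d\<eta>): its six second derivatives cancel in
    pairs.\<close>
  have cyc: "fd (\<lambda>z. G z a (\<phi> z b)) y c + fd (\<lambda>z. G z b (\<phi> z c)) y a + fd (\<lambda>z. G z c (\<phi> z a)) y b = 0"
    unfolding half using second_derivative_symmetric[OF \<eta>_sm open_U y]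
    by (simp add: field_simps)
  have \<Phi>_diff: "(\<lambda>z. G z b (\<phi> z v)) differentiable (at y)" for b v
    by (intro differentiable_G_along[OF open_U y, where F = "\<lambda>z. z"] \<phi>_diff y) auto
  \<comment> \<open>Since \<phi> \<xi> = 0 on all of \<open>U\<close>, a derivative falling on
    \<phi> is traded for one falling on \<xi>.\<close>
  have c: "fd (\<lambda>z. G z b (\<phi> z c)) y a = - G y b (\<phi> y (fd \<xi> y a))" for a b
  proof -
    have lin: "linear (\<lambda>v. G z b (\<phi> z v))" if "z \<in> U" for z
      using linear_compose[OF \<phi>_linear[OF that] G_linear(1)[OF that, of b]] by (simp add: o_def)
    have "fd (\<lambda>z. G z b (\<phi> z (\<xi> z))) y = fd (\<lambda>z. 0) y"
      by (rule fd_cong_open[OF open_U y]) (simp add: \<phi>_\<xi> G_simps)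
    moreover have "fd (\<lambda>z. G z b (\<phi> z (\<xi> z))) y a
        = fd (\<lambda>z. G z b (\<phi> z (\<xi> y))) y a + G y b (\<phi> y (fd \<xi> y a))"
      by (intro fd_linear_family[OF open_U y, where L = "\<lambda>z v. G z b (\<phi> z v)"] \<xi>_diff \<Phi>_diff y
        lin)
    ultimately show ?thesis by (simp add: c_def)
  qed
  have "fd (\<lambda>z. G z c (\<phi> z a)) y = fd (\<lambda>z. - G z a (\<phi> z c)) y"
    by (rule fd_cong_open[OF open_U y]) (metis \<phi>_skew G_sym)
  then have c': "fd (\<lambda>z. G z c (\<phi> z a)) y b = G y a (\<phi> y (fd \<xi> y b))"
    by (simp add: fd_minus \<Phi>_diff c)
  have "fd (\<lambda>z. G z a (\<phi> z b)) y c = G y (\<Gamma> y c a) (\<phi> y b) + G y a (N y b + \<phi> y (\<Gamma> y c b))"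
    using fd_G[OF y _ \<phi>_diff[OF y], of "\<lambda>z. a" b c] by (simp add: N_def covd_eq c_def)
  moreover have "G y b (\<phi> y (fd \<xi> y a)) = - G y (fd \<xi> y a) (\<phi> y b)"
    using \<phi>_skew[OF y, of "fd \<xi> y a" b] G_sym[OF y] by simp
  ultimately show ?thesis
    using cyc by (simp add: c c' T_def covd_eq \<Gamma>_sym[OF y, of _ c] c_def[symmetric] G_simps \<phi>_simps y)
qed

section \<open>The symmetric part of the derivative of \<xi> and its commutation with \<phi>\<close>

lemma P_sym: "y \<in> U \<Longrightarrow> G y (P y a) b = G y a (P y b)"
  using T_skew_part[of y b a] \<phi>_skew[of y a b] G_sym[of y b "T y a"]
  by (simp add: P_def G_simps)

lemma P_linear: "y \<in> U \<Longrightarrow> linear (P y)"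
  unfolding P_def by (intro linear_compose_add T_linear \<phi>_linear)

lemmas P_simps = linear_add[OF P_linear] linear_diff[OF P_linear] linear_cmul[OF P_linear]
  linear_0[OF P_linear] linear_neg[OF P_linear]

lemma P_\<xi>: "y \<in> U \<Longrightarrow> P y (\<xi> y) = 0"
  by (simp add: P_def T_\<xi> \<phi>_\<xi>)

lemma G_P_\<xi>: "y \<in> U \<Longrightarrow> G y (P y a) (\<xi> y) = 0"
  by (simp add: P_sym P_\<xi> G_simps)

lemma P_\<phi>_\<phi>: "y \<in> U \<Longrightarrow> P y (\<phi> y (\<phi> y a)) = - P y a"
  by (simp add: \<phi>_\<phi> P_simps P_\<xi>)

lemma \<phi>_\<phi>_P: "y \<in> U \<Longrightarrow> \<phi> y (\<phi> y (P y a)) = - P y a"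
  by (simp add: \<phi>_\<phi> G_P_\<xi>)

text \<open>In \<open>closed_\<Phi>\<close> put T = P - \<phi>. The two contributions of \<phi>
  alone cancel by skew symmetry, and the rest is read off against an arbitrary
  \<open>a\<close>.\<close>

lemma N_eq: 
  assumes y: "y \<in> U"
  shows "N y b = - P y (\<phi> y b) - \<phi> y (P y b)"
proof (rule G_eqI[OF y])
  fix a
  have "G y a (N y b) = - G y (P y a) (\<phi> y b) - G y a (\<phi> y (P y b))"
    using closed_\<Phi>[OF y, of a b] \<phi>_skew[OF y, of a "\<phi> y b"]
    by (simp add: P_def G_simps \<phi>_simps y)
  then show "G y (N y b) a = G y (- P y (\<phi> y b) - \<phi> y (P y b)) a"
    using P_sym[OF y, of a "\<phi> y b"] G_sym[OF y, of _ a] by (simp add: G_simps y)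
qed

text \<open>The identity \<open>\<phi>_\<phi>\<close> is differentiated along \<xi>. Its right-hand
  side is parallel in that direction because T \<xi> = 0.\<close>

lemma N_\<phi>: 
  assumes y: "y \<in> U"
  shows "N y (\<phi> y b) + \<phi> y (N y b) = 0"
proof -
  let ?b = "\<Gamma> y (\<xi> y) b"
  have \<eta>_diff: "(\<lambda>z. G z b (\<xi> z)) differentiable (at y)"
    using \<eta>_smooth smooth_on_differentiable y by blast
  have "covd (\<lambda>z. \<phi> z (\<phi> z b)) y (\<xi> y) = N y (\<phi> y b) + \<phi> y (N y b + \<phi> y ?b)"
    by (simp add: covd_\<phi>[OF y \<phi>_diff[OF y]] covd_\<phi>[OF y differentiable_const])
      (simp add: covd_eq)
  moreover have "fd (\<lambda>z. \<phi> z (\<phi> z b)) y (\<xi> y) = fd (\<lambda>z. - b + G z b (\<xi> z) *\<^sub>R \<xi> z) y (\<xi> y)"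
    by (rule fun_cong[OF fd_cong_open[OF open_U y]]) (rule \<phi>_\<phi>)
  moreover have "fd (\<lambda>z. - b + G z b (\<xi> z) *\<^sub>R \<xi> z) y v
      = G y b (\<xi> y) *\<^sub>R fd \<xi> y v + fd (\<lambda>z. G z b (\<xi> z)) y v *\<^sub>R \<xi> y" for v
    by (rule fun_cong[OF fd_eqI])
      (auto intro!: derivative_eq_intros fd_has_derivative \<eta>_diff \<xi>_diff y)
  ultimately have "N y (\<phi> y b) + \<phi> y (N y b + \<phi> y ?b)
      = G y b (\<xi> y) *\<^sub>R T y (\<xi> y) + (G y ?b (\<xi> y) + G y b (T y (\<xi> y))) *\<^sub>R \<xi> y - ?b"
    by (simp add: covd_eq fd_\<eta>[OF y] \<phi>_\<phi>[OF y, of b] \<Gamma>_simps y T_def scaleR_add_right algebra_simps)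
  then show ?thesis
    by (simp add: T_\<xi> y G_simps \<phi>_simps \<phi>_\<phi>[OF y, of ?b])
qed

text \<open>Inserting \<open>N_eq\<close> into \<open>N_\<phi>\<close> leaves 2 P - 2 \<phi> P
  \<phi> = 0, as P \<phi> \<phi> and \<phi> \<phi> P are both - P.\<close>

lemma \<phi>_P_\<phi>: 
  assumes y: "y \<in> U"
  shows "\<phi> y (P y (\<phi> y b)) = P y b"
proof -
  have "2 *\<^sub>R (\<phi> y (P y (\<phi> y b))) = 2 *\<^sub>R P y b"
    using N_\<phi>[OF y, of b] 
    by (simp add: N_eq y \<phi>_simps P_\<phi>_\<phi> \<phi>_\<phi>_P scaleR_2 algebra_simps)
  then show ?thesis by simp
qed

lemma P_\<phi>: 
  assumes y: "y \<in> U"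
  shows "P y (\<phi> y b) = - \<phi> y (P y b)"
  using \<phi>_\<phi>_P[OF y, of "\<phi> y b"] \<phi>_P_\<phi>[OF y, of b] by simp

lemma N_0: "y \<in> U \<Longrightarrow> N y b = 0"
  by (simp add: N_eq P_\<phi>)

text \<open>Torsion-freeness rewrites the Lie derivative covariantly as N - T \<phi> + \<phi> T.
  Here N = 0, and with T = P - \<phi> the two copies of \<phi> \<phi> cancel.\<close>

lemma h_eq: 
  assumes y: "y \<in> U"
  shows "h y b = \<phi> y (P y b)"
proof -
  have "2 *\<^sub>R h y b = N y b - T y (\<phi> y b) + \<phi> y (T y b)"
    by (simp add: h_def N_def T_def covd_eq \<phi>_simps y \<Gamma>_sym[OF y, of _ "\<xi> y"])
  moreover have "T y b = P y b - \<phi> y b" for b by (simp add: P_def)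
  ultimately have "2 *\<^sub>R h y b = 2 *\<^sub>R \<phi> y (P y b)"
    by (simp add: N_0 P_\<phi> y \<phi>_simps scaleR_2)
  then show ?thesis by simp
qed

lemma h_\<xi>: "y \<in> U \<Longrightarrow> h y (\<xi> y) = 0"
  by (simp add: h_eq P_\<xi> \<phi>_simps)

text \<open>The Ricci identity for \<xi> exchanges the directions \<open>a\<close> and \<xi> in the
  derivative of \<open>T\<close> at the cost of curvature. As T \<xi> = 0 on \<open>U\<close>, the
  derivative of \<open>T\<close> along \<open>a\<close>, applied to \<xi>, is - T (T a).\<close>

lemma riccati: 
  assumes y: "y \<in> U"
  shows "K y a = - curv y a (\<xi> y) (\<xi> y) - T y (T y a)"
proof -
  define c where "c = \<xi> y"
  have "fd (\<lambda>z. T z (\<xi> z)) y = fd (\<lambda>z. 0) y"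
    by (rule fd_cong_open[OF open_U y]) (rule T_\<xi>)
  then have "fd (\<lambda>z. T z c) y a + T y (fd \<xi> y a) = 0"
    using fd_linear_family[OF open_U y T_linear T_diff[OF y] \<xi>_diff[OF y], of a] by (simp add: c_def)
  then have "covd (\<lambda>z. T z c) y a = - T y (fd \<xi> y a)"
    by (simp add: covd_eq c_def T_\<xi> \<Gamma>_simps y eq_neg_iff_add_eq_0)
  moreover have "smooth_on U (\<lambda>z::'e. z)" 
  proof -
    have "ck_on U (\<lambda>z::'e. z) k" for k
    proof (cases k)
      case (Suc j)
      have "ck_on U (\<lambda>z::'e. v::'e) i" for v i
        by (induction i arbitrary: v) auto
      then show ?thesis by (simp add: Suc)
    qed auto
    then show ?thesis by (simp add: smooth_on_def)
  qed
  then have "covd (\<lambda>z. T z c) y a - covd (\<lambda>z. T z a) y c = curv y a c (\<xi> y)"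
    using ricci_identity[OF open_U y _ _ \<xi>_smooth, of "\<lambda>z. z" c a] by (simp add: T_def)
  ultimately have "covd (\<lambda>z. T z a) y c = - T y (fd \<xi> y a) - curv y a c (\<xi> y)"
    by (metis diff_eq_eq eq_diff_eq add.commute minus_diff_commute)
  moreover have "T y (T y a) = T y (fd \<xi> y a) + T y (\<Gamma> y (\<xi> y) a)"
    by (subst (2) T_def) (simp add: covd_eq T_simps y \<Gamma>_sym[OF y, of a])
  ultimately show ?thesis
    by (simp add: K_def c_def)
qed

text \<open>The relation \<phi> T \<phi> = T + 2 \<phi> holds throughout \<open>U\<close>, and
  \<phi> is parallel along \<xi>. Differentiating along \<xi> therefore replaces \<open>T\<close> by
  \<open>K\<close> and kills the last term.\<close>

lemma \<phi>_K_\<phi>: 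
  assumes y: "y \<in> U"
  shows "\<phi> y (K y (\<phi> y a)) = K y a"
proof -
  have T\<phi>: "\<phi> z (T z (\<phi> z b)) = T z b + 2 *\<^sub>R \<phi> z b" if "z \<in> U" for z b
  proof -
    have "\<phi> z (\<phi> z (\<phi> z b)) = - \<phi> z b"
      using that \<phi>_\<phi>[OF that, of b] by (simp add: \<phi>_simps \<phi>_\<xi>)
    then show ?thesis
      using \<phi>_P_\<phi>[OF that, of b] by (simp add: P_def \<phi>_simps that scaleR_2 algebra_simps)
  qed
  let ?g = "\<Gamma> y (\<xi> y) a"
  have d: "(\<lambda>z. T z (\<phi> z a)) differentiable (at y)"
    using differentiable_linear_family[OF open_U y T_linear T_diff[OF y] \<phi>_diff[OF y]] .
  have const: "covd (\<lambda>z. a) y (\<xi> y) = ?g" by (simp add: covd_eq)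
  have "covd (\<lambda>z. \<phi> z (T z (\<phi> z a))) y (\<xi> y) = \<phi> y (K y (\<phi> y a) + T y (\<phi> y ?g))"
    by (simp add: covd_\<phi>[OF y d] covd_T[OF y \<phi>_diff[OF y]] covd_\<phi>[OF y differentiable_const] N_0 y const)
  moreover have "covd (\<lambda>z. \<phi> z (T z (\<phi> z a))) y (\<xi> y) = covd (\<lambda>z. T z a + 2 *\<^sub>R \<phi> z a) y (\<xi> y)"
    using fun_cong[OF fd_cong_open[OF open_U y, of "\<lambda>z. \<phi> z (T z (\<phi> z a))" "\<lambda>z. T z a + 2 *\<^sub>R \<phi> z a"]]
    by (simp add: covd_eq T\<phi> y)
  moreover have "fd (\<lambda>z. T z a + 2 *\<^sub>R \<phi> z a) y v = fd (\<lambda>z. T z a) y v + 2 *\<^sub>R fd (\<lambda>z. \<phi> z a) y v" for v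
    by (rule fun_cong[OF fd_eqI])
      (auto intro!: derivative_eq_intros fd_has_derivative T_diff \<phi>_diff y)
  then have "covd (\<lambda>z. T z a + 2 *\<^sub>R \<phi> z a) y (\<xi> y)
      = covd (\<lambda>z. T z a) y (\<xi> y) + 2 *\<^sub>R covd (\<lambda>z. \<phi> z a) y (\<xi> y)"
    by (simp add: covd_eq \<Gamma>_simps y scaleR_add_right)
  then have "covd (\<lambda>z. T z a + 2 *\<^sub>R \<phi> z a) y (\<xi> y) = K y a + T y ?g + 2 *\<^sub>R \<phi> y ?g"
    using covd_T[OF y differentiable_const, of a] covd_\<phi>[OF y differentiable_const, of a]
    by (simp add: N_0 y const)
  ultimately show ?thesis
    using T\<phi>[OF y, of ?g] by (simp add: \<phi>_simps y)
qed

text \<open>The part of the curvature without \<mu> cancels \<phi> \<phi> in T T, so K = - \<mu>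
  \<phi> P - P P. Enclosing an operator between two copies of \<phi> fixes K and \<phi> P but
  reverses the sign of P P. Hence P P = 0, and G (P a) (P a) = G a (P (P a)) = 0.\<close>

lemma h_eq_0:
  assumes y: "y \<in> U"
    and R: "\<And>a. curv y a (\<xi> y) (\<xi> y)
      = a - G y a (\<xi> y) *\<^sub>R \<xi> y + \<mu> *\<^sub>R (h y a - G y (h y a) (\<xi> y) *\<^sub>R \<xi> y)"
  shows "h y a = 0"
proof -
  have T: "T y a = P y a - \<phi> y a" for a by (simp add: P_def)
  have "G y (h y a) (\<xi> y) = 0" for a
    using \<phi>_skew[OF y, of "P y a" "\<xi> y"] by (simp add: h_eq y \<phi>_\<xi> G_simps)
  moreover have "T y (T y a) = P y (P y a) + \<phi> y (\<phi> y a)" for a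
    by (simp add: T P_simps \<phi>_simps y P_\<phi>)
  ultimately have K: "K y a = - \<mu> *\<^sub>R \<phi> y (P y a) - P y (P y a)" for a
    by (simp add: riccati y R h_eq \<phi>_\<phi>)
  have "\<phi> y (K y (\<phi> y a)) = - \<mu> *\<^sub>R \<phi> y (P y a) + P y (P y a)"
    by (simp add: K y P_\<phi> \<phi>_simps P_simps \<phi>_\<phi>_P)
  then have "- \<mu> *\<^sub>R \<phi> y (P y a) + P y (P y a) = - \<mu> *\<^sub>R \<phi> y (P y a) - P y (P y a)"
    using \<phi>_K_\<phi>[OF y, of a] K[of a] by simp
  then have "2 *\<^sub>R P y (P y a) = 0" 
    by (simp add: scaleR_2 eq_neg_iff_add_eq_0)
  then have "P y a = 0"
    using P_sym[OF y, of a "P y a"] G_eq_0[OF y] by (simp add: G_simps y)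
  then show ?thesis by (simp add: h_eq \<phi>_simps y)
qed

end


locale C_totally_real_chart = contact_chart U G \<xi> \<phi> + immersed_chart U G V F
  for U :: "'e::euclidean_space set" and G \<xi> \<phi> and V :: "'f::euclidean_space set" and F +
  assumes \<xi>_normal: "x \<in> V \<Longrightarrow> G (F x) (fd F x a) (\<xi> (F x)) = 0"
begin

text \<open>The pullback of \<open>\<eta>\<close> to the submanifold is \<open>0\<close>, hence so is that of \<open>d\<eta>\<close>.\<close>

lemma \<phi>_tangent_normal:
  assumes x: "x \<in> V"
  shows "G (F x) (fd F x a) (\<phi> (F x) (fd F x b)) = 0"
proof -
  note Fx = F_in[OF x]
  have d: "(\<lambda>z. \<xi> (F z)) differentiable (at x)"
    by (rule differentiable_compose_at[OF F_diff[OF x] \<xi>_diff[OF Fx]])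
  have cov: "cov F (\<lambda>z. \<xi> (F z)) x a = T (F x) (fd F x a)" for a
    by (simp add: cov_def T_def fd_chain[OF F_diff[OF x] \<xi>_diff[OF Fx]])
  have "G (F x) (fd F x b) (T (F x) (fd F x a)) = - G (F x) (hess x a b) (\<xi> (F x))" for a b
  proof -
    have "fd (\<lambda>z. G (F z) (fd F z b) (\<xi> (F z))) x = fd (\<lambda>z. 0) x"
      by (rule fd_cong_open[OF open_V x]) (rule \<xi>_normal)
    then show ?thesis
      using fd_G_along[OF open_V x F_in F_diff[OF x] F_diff2[OF x] d, of b a]
      by (simp add: cov hess_def)
  qed
  then show ?thesis
    using T_skew_part[OF Fx, of "fd F x b" "fd F x a"] hess_sym[OF x, of a b] by simp
qed

end


section \<open>Ricci curvature from the Gauss equation\<close>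

locale inner_form =
  fixes g :: "'f::euclidean_space \<Rightarrow> 'f \<Rightarrow> real"
  assumes bilinear_g: "bilinear g" and g_sym: "g a b = g b a" and g_pos: "a \<noteq> 0 \<Longrightarrow> g a a > 0"
begin

lemma g_linear: "linear (g a)" "linear (\<lambda>a. g a b)"
  using bilinear_g by (auto simp: bilinear_def)

lemmas g_simps = bilinear_ladd[OF bilinear_g] bilinear_radd[OF bilinear_g]
  bilinear_lsub[OF bilinear_g] bilinear_rsub[OF bilinear_g]
  bilinear_lmul[OF bilinear_g] bilinear_rmul[OF bilinear_g]
  bilinear_lneg[OF bilinear_g] bilinear_rneg[OF bilinear_g]
  bilinear_lzero[OF bilinear_g] bilinear_rzero[OF bilinear_g]

lemma g_eq_0: "g v v = 0 \<longleftrightarrow> v = 0"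
  using g_pos[of v] by (cases "v = 0") (auto simp: g_simps)

lemma g_nonneg: "g v v \<ge> 0"
  using g_pos[of v] by (cases "v = 0") (auto simp: g_simps)

section \<open>Orthonormal frames and traces at one point\<close>

definition orthonormal :: "nat \<Rightarrow> (nat \<Rightarrow> 'f) \<Rightarrow> bool"
  where "orthonormal k e \<longleftrightarrow> (\<forall>i\<in>{1..k}. \<forall>j\<in>{1..k}. g (e i) (e j) = (if i = j then 1 else 0))"

abbreviation "frame \<equiv> orthonormal DIM('f)"

lemma orthonormalD:
  "orthonormal k e \<Longrightarrow> i \<in> {1..k} \<Longrightarrow> j \<in> {1..k} \<Longrightarrow> g (e i) (e j) = (if i = j then 1 else 0)"
  by (simp add: orthonormal_def)

lemma orthonormal_coeff:
  assumes "orthonormal k e" "i \<in> {1..k}"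
  shows "g (\<Sum>j=1..k. c j *\<^sub>R e j) (e i) = c i"
proof -
  have "g (\<Sum>j=1..k. c j *\<^sub>R e j) (e i) = (\<Sum>j=1..k. c j * g (e j) (e i))"
    using linear_sum[OF g_linear(2), of "\<lambda>j. c j *\<^sub>R e j" "{1..k}" "e i"] by (simp add: g_simps)
  also have "\<dots> = (\<Sum>j=1..k. if j = i then c j else 0)"
    using assms by (intro sum.cong) (auto simp: orthonormalD)
  also have "\<dots> = c i" using assms by simp
  finally show ?thesis .
qed

lemma span_frame:
  assumes e: "frame e"
  shows "span (e ` {1..DIM('f)}) = UNIV"
proof -
  let ?I = "{1..DIM('f)}"
  have inj: "inj_on e ?I"
    by (rule inj_onI) (metis e orthonormalD zero_neq_one)
  have "independent (e ` ?I)"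
  proof
    assume "dependent (e ` ?I)"
    then obtain u i where i: "i \<in> ?I" "u (e i) \<noteq> 0" and 0: "(\<Sum>v\<in>e ` ?I. u v *\<^sub>R v) = 0"
      by (auto simp: real_vector.dependent_finite)
    have "(\<Sum>v\<in>e ` ?I. u v *\<^sub>R v) = (\<Sum>j\<in>?I. u (e j) *\<^sub>R e j)"
      using inj by (simp add: sum.reindex)
    then show False
      using orthonormal_coeff[OF e i(1), of "\<lambda>j. u (e j)"] i(2) 0 by (simp add: g_simps)
  qed
  then show ?thesis
    using card_ge_dim_independent[of "e ` ?I" UNIV] card_image[OF inj] by auto
qed

lemma frame_expansion:
  assumes e: "frame e"
  shows "(\<Sum>j=1..DIM('f). g v (e j) *\<^sub>R e j) = v"
proof -
  define w where "w = v - (\<Sum>j=1..DIM('f). g v (e j) *\<^sub>R e j)"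
  have "g w (e i) = 0" if "i \<in> {1..DIM('f)}" for i
    using orthonormal_coeff[OF e that] by (simp add: w_def g_simps)
  then have "g w z = 0" if "z \<in> e ` {1..DIM('f)}" for z
    using that by blast
  then have "g w u = 0" if "u \<in> span (e ` {1..DIM('f)})" for u
    using linear_eq_0_on_span[OF g_linear(1) _ that] by blast
  then have "g w w = 0" using span_frame[OF e] by auto
  then show ?thesis using g_eq_0 by (simp add: w_def)
qed

lemma unit_scale:
  assumes "u \<noteq> 0"
  obtains v where "g v v = 1" "v = (1 / sqrt (g u u)) *\<^sub>R u" "u = sqrt (g u u) *\<^sub>R v"
proof
  have pos: "g u u > 0" using assms g_pos by simp
  let ?v = "(1 / sqrt (g u u)) *\<^sub>R u"
  have "g ?v ?v = g u u / (sqrt (g u u) * sqrt (g u u))" by (simp add: g_simps)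
  also have "\<dots> = 1" using pos by (simp add: real_sqrt_mult_self)
  finally show "g ?v ?v = 1" .
  show "?v = ?v" "u = sqrt (g u u) *\<^sub>R ?v" using pos by auto
qed

text \<open>Gram-Schmidt by induction on the length, started at 1 so that \<open>U\<close> stays the
  first vector; a dimension count supplies a vector outside the span of the first
  \<open>k\<close>.\<close>

lemma extend_to_frame:
  assumes U: "g U U = 1"
  obtains e where "frame e" "e 1 = U"
proof -
  have "\<exists>e. orthonormal k e \<and> e 1 = U" if "1 \<le> k" "k \<le> DIM('f)" for k
    using that
  proof (induction k rule: nat_induct_at_least)
    case base
    \<comment> \<open>Only index 1 is constrained here, so the constant family will do.\<close>
    show ?case by (intro exI[of _ "\<lambda>_. U"]) (simp add: orthonormal_def U)
  next
    case (Suc k)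
    then obtain e where e: "orthonormal k e" "e 1 = U" by auto
    have "dim (span (e ` {1..k})) \<le> k"
      using dim_le_card'[of "e ` {1..k}"] card_image_le[of "{1..k}" e] by simp
    then have "span (e ` {1..k}) \<noteq> UNIV" using Suc.prems by (metis dim_UNIV not_less_eq_eq)
    then obtain v where v: "v \<notin> span (e ` {1..k})" by auto
    define w where "w = v - (\<Sum>j=1..k. g v (e j) *\<^sub>R e j)"
    have "(\<Sum>j=1..k. g v (e j) *\<^sub>R e j) \<in> span (e ` {1..k})"
      by (intro span_sum span_scale span_base) auto
    then have w: "w \<noteq> 0" using v by (auto simp: w_def)
    have we: "g w (e i) = 0" "g (e i) w = 0" if "i \<in> {1..k}" for i
      using orthonormal_coeff[OF e(1) that] g_sym[of "e i" w] by (simp_all add: w_def g_simps)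
    obtain z where z: "g z z = 1" "z = (1 / sqrt (g w w)) *\<^sub>R w" using unit_scale[OF w] .
    define e' where "e' = e(Suc k := z)"
    have "g (e' (Suc k)) (e' (Suc k)) = 1"
      using z(1) by (simp add: e'_def)
    moreover have "g (e' i) (e' (Suc k)) = 0" "g (e' (Suc k)) (e' i) = 0" if "i \<in> {1..k}" for i
      using that we[OF that] by (auto simp: e'_def z(2) g_simps)
    moreover have "g (e' i) (e' j) = (if i = j then 1 else 0)" if "i \<in> {1..k}" "j \<in> {1..k}" for i j
      using that e(1) by (auto simp: e'_def orthonormalD)
    ultimately have "orthonormal (Suc k) e'"
      unfolding orthonormal_def by (auto simp: atLeastAtMostSuc_conv)
    moreover have "e' 1 = U" using e Suc.hyps by (simp add: e'_def)
    ultimately show ?case by blast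
  qed
  then show ?thesis using that DIM_positive[where 'a='f] by (metis Suc_leI One_nat_def order_refl)
qed

lemma frame_exists: obtains e where "frame e"
proof -
  obtain v :: 'f where v: "v \<noteq> 0" using nonzero_Basis SOME_Basis by blast
  then obtain u where "g u u = 1" using unit_scale by blast
  from extend_to_frame[OF this] that show ?thesis by blast
qed

text \<open>The definitions pick their bases by \<open>SOME\<close>, separately for each notion;
  this makes the resulting traces comparable. Each frame is expanded in the other and the double sum
  is swapped.\<close>

lemma trace_frame_independent:
  fixes \<beta> :: "'f \<Rightarrow> 'f \<Rightarrow> 'w::real_vector"
  assumes \<beta>: "bilinear \<beta>" and e: "frame e" and e': "frame e'"
  shows "(\<Sum>j=1..DIM('f). \<beta> (e j) (e j)) = (\<Sum>j=1..DIM('f). \<beta> (e' j) (e' j))"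
proof -
  have l: "linear (\<beta> a)" "linear (\<lambda>a. \<beta> a b)" for a b using \<beta> by (auto simp: bilinear_def)
  have "(\<Sum>j=1..DIM('f). \<beta> (e j) (e j))
      = (\<Sum>j=1..DIM('f). \<beta> (\<Sum>i=1..DIM('f). g (e j) (e' i) *\<^sub>R e' i) (e j))"
    by (simp only: frame_expansion[OF e'])
  also have "\<dots> = (\<Sum>j=1..DIM('f). \<Sum>i=1..DIM('f). g (e j) (e' i) *\<^sub>R \<beta> (e' i) (e j))"
    by (simp add: linear_sum[OF l(2)] linear_cmul[OF l(2)])
  also have "\<dots> = (\<Sum>i=1..DIM('f). \<Sum>j=1..DIM('f). g (e' i) (e j) *\<^sub>R \<beta> (e' i) (e j))"
    by (subst sum.swap) (simp add: g_sym)
  also have "\<dots> = (\<Sum>i=1..DIM('f). \<beta> (e' i) (\<Sum>j=1..DIM('f). g (e' i) (e j) *\<^sub>R e j))"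
    by (simp add: linear_sum[OF l(1)] linear_cmul[OF l(1)])
  also have "\<dots> = (\<Sum>i=1..DIM('f). \<beta> (e' i) (e' i))"
    by (simp only: frame_expansion[OF e])
  finally show ?thesis .
qed

end


text \<open>What remains after differentiation is linear algebra in one tangent space;
  \<open>c\<close> stands for the value of f1 at the point.\<close>

locale gauss_data = inner_form g + N: inner_form G
  for g :: "'f::euclidean_space \<Rightarrow> 'f \<Rightarrow> real" and G :: "'e::euclidean_space \<Rightarrow> 'e \<Rightarrow> real" +
  fixes \<sigma> :: "'f \<Rightarrow> 'f \<Rightarrow> 'e" and c :: real
  assumes bilinear_\<sigma>: "bilinear \<sigma>" and \<sigma>_sym: "\<sigma> a b = \<sigma> b a"
begin

lemma \<sigma>_linear: "linear (\<sigma> a)"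
  using bilinear_\<sigma> by (auto simp: bilinear_def)

lemmas \<sigma>_simps = bilinear_ladd[OF bilinear_\<sigma>] bilinear_radd[OF bilinear_\<sigma>]
  bilinear_lmul[OF bilinear_\<sigma>] bilinear_rmul[OF bilinear_\<sigma>]

text \<open>The right-hand side of the Gauss equation when the ambient curvature restricts to
  \<open>c\<close> times R1, with \<open>z\<close> as the vector paired against.\<close>

definition Rm :: "'f \<Rightarrow> 'f \<Rightarrow> 'f \<Rightarrow> 'f \<Rightarrow> real"
  where "Rm u v w z = c * (g v w * g u z - g u w * g v z) + G (\<sigma> v w) (\<sigma> u z) - G (\<sigma> u w) (\<sigma> v z)"

definition S :: "(nat \<Rightarrow> 'f) \<Rightarrow> 'f \<Rightarrow> 'f \<Rightarrow> real"
  where "S e u v = (\<Sum>j=1..DIM('f). Rm (e j) u v (e j))"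

definition ric :: "(nat \<Rightarrow> 'f) \<Rightarrow> real"
  where "ric e = (\<Sum>j=2..DIM('f). Rm (e 1) (e j) (e j) (e 1))"

definition tr :: "(nat \<Rightarrow> 'f) \<Rightarrow> 'e"
  where "tr e = (\<Sum>j=1..DIM('f). \<sigma> (e j) (e j))"

lemma tr_independent: "frame e \<Longrightarrow> frame e' \<Longrightarrow> tr e = tr e'"
  unfolding tr_def by (rule trace_frame_independent[OF bilinear_\<sigma>])

lemma bilinear_Rm: "bilinear (\<lambda>a b. Rm a u v b)"
proof -
  have "linear (\<lambda>b. Rm a u v b)" "linear (\<lambda>a. Rm a u v b)" for a b
    unfolding Rm_def
    by (auto intro!: linearI simp: g_simps N.g_simps \<sigma>_simps algebra_simps)
  then show ?thesis by (simp add: bilinear_def)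
qed

lemma S_independent: "frame e \<Longrightarrow> frame e' \<Longrightarrow> S e u v = S e' u v"
  unfolding S_def by (rule trace_frame_independent[OF bilinear_Rm])

lemma sum_from_1: "(\<Sum>j=1..DIM('f). k j) = k 1 + (\<Sum>j=2..DIM('f). k j)" 
  for k :: "nat \<Rightarrow> 'w::comm_monoid_add"
  using DIM_positive[where 'a='f] sum.atLeast_Suc_atMost[of 1 "DIM('f)" k]
  by (simp add: numeral_2_eq_2 Suc_le_eq)

section \<open>Ricci curvature of a unit vector\<close>

lemma ric_eq:
  assumes e: "frame e"
  shows "ric e = (real DIM('f) - 1) * c + G (\<sigma> (e 1) (e 1)) (tr e - \<sigma> (e 1) (e 1))
    - (\<Sum>j=2..DIM('f). G (\<sigma> (e 1) (e j)) (\<sigma> (e 1) (e j)))"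
proof -
  have "Rm (e 1) (e j) (e j) (e 1)
    = c + G (\<sigma> (e 1) (e 1)) (\<sigma> (e j) (e j)) - G (\<sigma> (e 1) (e j)) (\<sigma> (e 1) (e j))"
    if "j \<in> {2..DIM('f)}" for j
    using that orthonormalD[OF e, of 1 1] orthonormalD[OF e, of j j] orthonormalD[OF e, of 1 j]
      \<sigma>_sym[of "e j" "e 1"] N.g_sym[of "\<sigma> (e j) (e j)" "\<sigma> (e 1) (e 1)"] by (simp add: Rm_def)
  then have "ric e = (\<Sum>j=2..DIM('f). c + G (\<sigma> (e 1) (e 1)) (\<sigma> (e j) (e j))
      - G (\<sigma> (e 1) (e j)) (\<sigma> (e 1) (e j)))"
    by (simp add: ric_def)
  also have "\<dots> = (real DIM('f) - 1) * c + G (\<sigma> (e 1) (e 1)) (\<Sum>j=2..DIM('f). \<sigma> (e j) (e j))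
    - (\<Sum>j=2..DIM('f). G (\<sigma> (e 1) (e j)) (\<sigma> (e 1) (e j)))"
    using DIM_positive[where 'a='f]
    by (simp add: sum.distrib sum_subtractf linear_sum[OF N.g_linear(1)] of_nat_diff)
  finally show ?thesis unfolding tr_def sum_from_1 by simp
qed

lemma S_eq_ric:
  assumes e: "frame e"
  shows "S e (e 1) (e 1) = ric e"
proof -
  have "Rm (e 1) (e 1) (e 1) (e 1) = 0" by (simp add: Rm_def)
  moreover have "(\<Sum>j=2..DIM('f). Rm (e j) (e 1) (e 1) (e j)) = ric e"
    unfolding ric_def
  proof (rule sum.cong[OF refl])
    fix j
    show "Rm (e j) (e 1) (e 1) (e j) = Rm (e 1) (e j) (e j) (e 1)"
      using \<sigma>_sym[of "e j" "e 1"] N.g_sym[of "\<sigma> (e j) (e j)" "\<sigma> (e 1) (e 1)"]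
      by (simp add: Rm_def mult.commute)
  qed
  ultimately show ?thesis unfolding S_def sum_from_1 by simp
qed

text \<open>Source of the constant 1/4: for \<open>t\<close> the trace of \<sigma>, the left side is
  largest at a = t/2.\<close>

lemma completed_square:
  "G a (t - a) = G t t / 4 - G (a - (1/2) *\<^sub>R t) (a - (1/2) *\<^sub>R t)"
  by (simp add: N.g_simps N.g_sym[of t a] field_simps)

lemma ric_square:
  assumes e: "frame e"
  shows "ric e = G (tr e) (tr e) / 4 + (real DIM('f) - 1) * c
    - G (\<sigma> (e 1) (e 1) - (1/2) *\<^sub>R tr e) (\<sigma> (e 1) (e 1) - (1/2) *\<^sub>R tr e)
    - (\<Sum>j=2..DIM('f). G (\<sigma> (e 1) (e j)) (\<sigma> (e 1) (e j)))"
  unfolding ric_eq[OF e] completed_square by simp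

lemma ric_le: "frame e \<Longrightarrow> ric e \<le> G (tr e) (tr e) / 4 + (real DIM('f) - 1) * c"
  using N.g_nonneg[of "\<sigma> (e 1) (e 1) - (1/2) *\<^sub>R tr e"]
    sum_nonneg[of "{2..DIM('f)}" "\<lambda>j. G (\<sigma> (e 1) (e j)) (\<sigma> (e 1) (e j))", OF N.g_nonneg]
  by (simp only: ric_square)

lemma ric_eq_iff:
  assumes e: "frame e"
  shows "ric e = G (tr e) (tr e) / 4 + (real DIM('f) - 1) * c \<longleftrightarrow>
    2 *\<^sub>R \<sigma> (e 1) (e 1) = tr e \<and> (\<forall>j\<in>{2..DIM('f)}. \<sigma> (e 1) (e j) = 0)"
proof -
  let ?a = "\<sigma> (e 1) (e 1) - (1/2) *\<^sub>R tr e" and ?s = "\<Sum>j=2..DIM('f). G (\<sigma> (e 1) (e j)) (\<sigma> (e 1) (e j))"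
  have "ric e = G (tr e) (tr e) / 4 + (real DIM('f) - 1) * c \<longleftrightarrow> G ?a ?a + ?s = 0"
    by (auto simp: ric_square[OF e])
  also have "\<dots> \<longleftrightarrow> G ?a ?a = 0 \<and> ?s = 0"
    using N.g_nonneg by (intro add_nonneg_eq_0_iff sum_nonneg) auto
  also have "?s = 0 \<longleftrightarrow> (\<forall>j\<in>{2..DIM('f)}. \<sigma> (e 1) (e j) = 0)"
    using N.g_nonneg by (subst sum_nonneg_eq_0_iff) (auto simp: N.g_eq_0)
  also have "G ?a ?a = 0 \<longleftrightarrow> 2 *\<^sub>R \<sigma> (e 1) (e 1) = tr e"
  proof -
    have "2 *\<^sub>R ?a = 2 *\<^sub>R \<sigma> (e 1) (e 1) - tr e" by (simp add: scaleR_right_diff_distrib)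
    then show ?thesis
      unfolding N.g_eq_0 by (metis right_minus_eq scaleR_eq_0_iff zero_neq_numeral)
  qed
  finally show ?thesis .
qed

text \<open>With zero trace, the condition on \<sigma>(e 1, e 1) supplies the index 1 absent from
  the other equations, so \<sigma>(e 1, -) vanishes on the whole frame.\<close>

lemma ric_eq_iff_relative_null:
  assumes e: "frame e" and tr: "tr e = 0"
  shows "ric e = (real DIM('f) - 1) * c \<longleftrightarrow> (\<forall>v. \<sigma> (e 1) v = 0)"
proof -
  have "\<sigma> (e 1) v = 0" if "\<sigma> (e 1) (e 1) = 0" "\<forall>j\<in>{2..DIM('f)}. \<sigma> (e 1) (e j) = 0" for v
  proof -
    have "\<sigma> (e 1) (e j) = 0" if "j \<in> {1..DIM('f)}" for j
      using that \<open>\<sigma> (e 1) (e 1) = 0\<close> \<open>\<forall>j\<in>_. _\<close> by (cases "j = 1") auto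
    then have "\<sigma> (e 1) (\<Sum>j=1..DIM('f). g v (e j) *\<^sub>R e j) = 0"
      by (simp add: linear_sum[OF \<sigma>_linear] \<sigma>_simps)
    then show ?thesis by (simp only: frame_expansion[OF e])
  qed
  with ric_eq_iff[OF e] tr show ?thesis by (auto simp: N.g_simps)
qed

section \<open>The Ricci tensor as a quadratic form, and the case of equality\<close>

lemma S_scale: "S e (r *\<^sub>R u) (r *\<^sub>R u) = r\<^sup>2 * S e u u"
  by (simp add: S_def Rm_def g_simps N.g_simps \<sigma>_simps sum_distrib_left power2_eq_square algebra_simps)

text \<open>Both sides are homogeneous of degree 2, so a nonzero vector may be normalized.
  Completing it to a frame turns the Ricci tensor into \<open>ric\<close>, the traces being
  independent of the frame.\<close>

lemma S_le:
  assumes e: "frame e"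
  shows "4 * S e u u \<le> (G (tr e) (tr e) + 4 * (real DIM('f) - 1) * c) * g u u"
proof (cases "u = 0")
  case True
  then show ?thesis using S_scale[of e 0 u] by (simp add: g_simps)
next
  case False
  then obtain v where v: "g v v = 1" "u = sqrt (g u u) *\<^sub>R v" using unit_scale by blast
  obtain e' where e': "frame e'" "e' 1 = v" using extend_to_frame[OF v(1)] .
  have "S e v v = ric e'" using S_eq_ric[OF e'(1)] S_independent[OF e e'(1)] e'(2) by simp
  also have "\<dots> \<le> G (tr e) (tr e) / 4 + (real DIM('f) - 1) * c"
    using ric_le[OF e'(1)] tr_independent[OF e e'(1)] by simp
  finally have "4 * S e v v \<le> G (tr e) (tr e) + 4 * (real DIM('f) - 1) * c"
    by (simp add: field_simps)
  then have "g u u * (4 * S e v v) \<le> g u u * (G (tr e) (tr e) + 4 * (real DIM('f) - 1) * c)"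
    by (rule mult_left_mono) (rule g_nonneg)
  moreover have "S e u u = g u u * S e v v"
    by (subst (1 2) v(2)) (simp add: S_scale g_nonneg)
  ultimately show ?thesis by (simp add: mult_ac)
qed

text \<open>Every unit vector starts a frame, so \<open>ric_eq_iff\<close> applies to all of them.
  Once the trace vanishes, scaling gives \<sigma>(w, w) = 0 for all \<open>w\<close>, and
  polarization recovers \<sigma>.\<close>

lemma S_equality_imp_geodesic:
  assumes e: "frame e" and dim: "DIM('f) \<ge> 3"
    and eq: "\<And>u. 4 * S e u u = (G (tr e) (tr e) + 4 * (real DIM('f) - 1) * c) * g u u"
  shows "\<sigma> u v = 0"
proof -
  have unit: "2 *\<^sub>R \<sigma> w w = tr e" if w: "g w w = 1" for w
  proof -
    obtain e' where e': "frame e'" "e' 1 = w" using extend_to_frame[OF w] .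
    have "ric e' = S e w w" using S_eq_ric[OF e'(1)] S_independent[OF e e'(1)] e'(2) by simp
    also have "\<dots> = G (tr e) (tr e) / 4 + (real DIM('f) - 1) * c"
      using eq[of w] w by (simp add: field_simps)
    finally show ?thesis
      using ric_eq_iff[OF e'(1)] tr_independent[OF e e'(1)] e'(2) by simp
  qed
  have "2 *\<^sub>R tr e = (\<Sum>j=1..DIM('f). 2 *\<^sub>R \<sigma> (e j) (e j))"
    by (simp add: tr_def scaleR_sum_right)
  also have "\<dots> = real DIM('f) *\<^sub>R tr e"
    using unit orthonormalD[OF e] by (simp add: sum_constant_scaleR)
  finally have "(real DIM('f) - 2) *\<^sub>R tr e = 0" by (simp add: scaleR_left_diff_distrib)
  then have "tr e = 0" using dim by simp
  have diag: "\<sigma> w w = 0" for w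
  proof (cases "w = 0")
    case False
    then obtain z where z: "g z z = 1" "w = sqrt (g w w) *\<^sub>R z" using unit_scale by blast
    have "\<sigma> z z = 0" using unit[OF z(1)] \<open>tr e = 0\<close> by simp
    then show ?thesis by (subst (1 2) z(2)) (simp add: \<sigma>_simps)
  qed (simp add: bilinear_lzero[OF bilinear_\<sigma>])
  have "2 *\<^sub>R \<sigma> u v = 0"
    using diag[of "u + v"] diag[of u] diag[of v] \<sigma>_sym[of u v] by (simp add: \<sigma>_simps scaleR_2)
  then show ?thesis by simp
qed

lemma S_geodesic:
  assumes e: "frame e" and \<sigma>: "\<And>u v. \<sigma> u v = 0"
  shows "4 * S e u v = (G (tr e) (tr e) + 4 * (real DIM('f) - 1) * c) * g u v"
proof -
  \<comment> \<open>The second term is written with a summand of the frame expansion of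
    \<open>v\<close>, so that the sum collapses to \<open>g v u\<close>; this accounts for the -1 in
    n - 1.\<close>
  have "S e u v = (\<Sum>j=1..DIM('f). c * (g u v - g (g v (e j) *\<^sub>R e j) u))"
    unfolding S_def
  proof (intro sum.cong refl)
    fix j assume "j \<in> {1..DIM('f)}"
    then show "Rm (e j) u v (e j) = c * (g u v - g (g v (e j) *\<^sub>R e j) u)"
      using orthonormalD[OF e, of j j] g_sym[of "e j" u] g_sym[of "e j" v] by (simp add: Rm_def \<sigma> N.g_simps g_simps)
  qed
  also have "\<dots> = c * (real DIM('f) * g u v - g v u)"
    using linear_sum[OF g_linear(2), of "\<lambda>j. g v (e j) *\<^sub>R e j" "{1..DIM('f)}" u]
    unfolding frame_expansion[OF e] by (simp add: sum_subtractf flip: sum_distrib_left)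
  finally show ?thesis using g_sym[of v u] by (simp add: tr_def \<sigma> N.g_simps algebra_simps)
qed

end


section \<open>From manifolds to charts\<close>

lemma smooth_on_cong:
  assumes "open S" "\<And>y. y \<in> S \<Longrightarrow> f y = g y" "smooth_on S f"
  shows "smooth_on S g"
  using assms ck_on_cong[OF assms(1,2)] by (simp add: smooth_on_def)

lemma linear_map_on_0: "linear_map_on V L \<Longrightarrow> u \<in> V \<Longrightarrow> L 0 = 0"
  unfolding linear_map_on_def by (metis scaleR_zero_left)

locale manifold =
  fixes A :: "('a::{t2_space,second_countable_topology}, 'e::euclidean_space) chart set"
  assumes smooth_manifold: "smooth_manifold A"
begin

abbreviation CF :: "('a, 'e) chart \<Rightarrow> 'e \<Rightarrow> 'a \<Rightarrow> ('a, 'e) tangent"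
  where "CF \<equiv> coord_field A"

lemma is_chart: "C \<in> A \<Longrightarrow> is_chart C"
  using smooth_manifold by (simp add: smooth_manifold_def)

lemma open_cdom: "C \<in> A \<Longrightarrow> open (cdom C)"
  using is_chart by (simp add: is_chart_def)

lemma open_cimg: "C \<in> A \<Longrightarrow> open (cimg C)"
  using is_chart by (simp add: is_chart_def)

lemma homeo: "C \<in> A \<Longrightarrow> homeomorphism (cdom C) (cimg C) (coord C) (cinv C)"
  using is_chart by (simp add: is_chart_def)

lemma cinv_coord [simp]: "C \<in> A \<Longrightarrow> p \<in> cdom C \<Longrightarrow> cinv C (coord C p) = p"
  using homeo by (auto simp: homeomorphism_def)

lemma coord_cinv [simp]: "C \<in> A \<Longrightarrow> x \<in> cimg C \<Longrightarrow> coord C (cinv C x) = x"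
  using homeo by (auto simp: homeomorphism_def)

lemma cinv_in: "C \<in> A \<Longrightarrow> x \<in> cimg C \<Longrightarrow> cinv C x \<in> cdom C"
  using homeo by (auto simp: homeomorphism_def)

lemma coord_in: "p \<in> cdom C \<Longrightarrow> coord C p \<in> cimg C"
  by auto

lemma image_eq_preimage:
  "C \<in> A \<Longrightarrow> coord C ` (cdom C \<inter> W) = cimg C \<inter> cinv C -` W"
  using cinv_in coord_cinv by (fastforce simp: image_iff)

lemma open_image_coord:
  assumes "C \<in> A" "open W"
  shows "open (coord C ` (cdom C \<inter> W))"
  using homeo[OF assms(1)] assms open_cimg[OF assms(1)] unfolding image_eq_preimage[OF assms(1)]
  by (intro continuous_open_preimage) (auto simp: homeomorphism_def)

lemma charts_at_iff: "C \<in> charts_at A p \<longleftrightarrow> C \<in> A \<and> p \<in> cdom C"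
  by (simp add: charts_at_def)

lemma chart_at: "chart_at A p \<in> A" "p \<in> cdom (chart_at A p)"
proof -
  have "p \<in> (\<Union>C\<in>A. cdom C)" using smooth_manifold by (simp add: smooth_manifold_def)
  then have "\<exists>C. C \<in> charts_at A p" by (auto simp: charts_at_def)
  then have "chart_at A p \<in> charts_at A p" unfolding chart_at_def by (rule someI_ex)
  then show "chart_at A p \<in> A" "p \<in> cdom (chart_at A p)" by (auto simp: charts_at_def)
qed

lemma transition_diff:
  assumes "C \<in> A" "D \<in> A" "p \<in> cdom C" "p \<in> cdom D"
  shows "(coord D \<circ> cinv C) differentiable (at (coord C p))"
  using assms smooth_manifold smooth_on_differentiable
  unfolding smooth_manifold_def by blast

lemma fd_transition_self:
  assumes "C \<in> A" "p \<in> cdom C"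
  shows "fd (coord C \<circ> cinv C) (coord C p) = (\<lambda>a. a)"
proof -
  have "fd (coord C \<circ> cinv C) (coord C p) = fd (\<lambda>x. x) (coord C p)"
    by (rule fd_cong_open[OF open_cimg[OF assms(1)]]) (use assms in auto)
  then show ?thesis by simp
qed

text \<open>Chain rule on the overlap of the two charts. It frees the later computations from the
  chart that \<open>chart_at\<close> happens to select.\<close>

lemma change_chart:
  assumes C: "C \<in> A" "p \<in> cdom C" and D: "D \<in> A" "p \<in> cdom D"
    and f: "(f \<circ> cinv C) differentiable (at (coord C p))"
  shows "fd (f \<circ> cinv D) (coord D p) a
    = fd (f \<circ> cinv C) (coord C p) (fd (coord C \<circ> cinv D) (coord D p) a)"
proof -
  let ?W = "coord D ` (cdom D \<inter> cdom C)"
  have "fd (f \<circ> cinv D) (coord D p) = fd (\<lambda>x. (f \<circ> cinv C) ((coord C \<circ> cinv D) x)) (coord D p)"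
  proof (rule fd_cong_open[of ?W])
    show "open ?W" using open_image_coord[OF D(1) open_cdom[OF C(1)]] .
    show "coord D p \<in> ?W" using C D by auto
    show "(f \<circ> cinv D) y = (f \<circ> cinv C) ((coord C \<circ> cinv D) y)" if "y \<in> ?W" for y
      using that C D by auto
  qed
  then show ?thesis
    using fd_chain[OF transition_diff[OF D(1) C(1) D(2) C(2)], of "f \<circ> cinv C" a] f C D by simp
qed

section \<open>Tangent vectors through their components\<close>

lemma tangent_eq_0: "v \<in> tangent_space A p \<Longrightarrow> D \<notin> charts_at A p \<Longrightarrow> v D = 0"
  unfolding tangent_space_def by blast

lemma tangent_transform:
  "v \<in> tangent_space A p \<Longrightarrow> C \<in> A \<Longrightarrow> p \<in> cdom C \<Longrightarrow> D \<in> A \<Longrightarrow> p \<in> cdom D \<Longrightarrow>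
    v D = fd (coord D \<circ> cinv C) (coord C p) (v C)"
  using charts_at_iff unfolding tangent_space_def by blast

text \<open>The transformation rule demanded of a tangent vector is \<open>change_chart\<close>
  applied to a coordinate map.\<close>

lemma CF_tangent:
  assumes C: "C \<in> A" "p \<in> cdom C"
  shows "CF C a p \<in> tangent_space A p"
proof -
  have trans: "fd (coord E \<circ> cinv C) (coord C p) a
      = fd (coord E \<circ> cinv D) (coord D p) (fd (coord D \<circ> cinv C) (coord C p) a)"
    if "D \<in> A" "p \<in> cdom D" "E \<in> A" "p \<in> cdom E" for D E
    using that C by (intro change_chart transition_diff)
  have "CF C a p D = 0" if "D \<notin> charts_at A p" for D
    using that by (simp add: coord_field_def)
  moreover have "CF C a p E = fd (coord E \<circ> cinv D) (coord D p) (CF C a p D)"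
    if "D \<in> charts_at A p" "E \<in> charts_at A p" for D E
    using that C trans[of D E] by (simp add: coord_field_def charts_at_iff)
  ultimately show ?thesis unfolding tangent_space_def by blast
qed

lemma CF_self [simp]: "C \<in> A \<Longrightarrow> p \<in> cdom C \<Longrightarrow> CF C a p C = a"
  by (simp add: coord_field_def charts_at_iff fd_transition_self)

lemma CF_eta:
  assumes v: "v \<in> tangent_space A p" and C: "C \<in> A" "p \<in> cdom C"
  shows "CF C (v C) p = v"
proof
  fix D
  show "CF C (v C) p D = v D"
  proof (cases "D \<in> charts_at A p")
    case True
    then show ?thesis
      using tangent_transform[OF v C, of D] C by (simp add: coord_field_def charts_at_iff)
  next
    case False
    then show ?thesis using tangent_eq_0[OF v, of D] by (simp add: coord_field_def)
  qed
qed

lemma CF_add: 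
  assumes C: "C \<in> A" "p \<in> cdom C"
  shows "CF C (a + b) p = CF C a p + CF C b p"
  using transition_diff[OF C(1) _ C(2)]
  by (auto simp: coord_field_def fun_eq_iff charts_at_iff C linear_add linear_frechet_derivative)

lemma CF_scale: 
  assumes C: "C \<in> A" "p \<in> cdom C"
  shows "CF C (r *\<^sub>R a) p = r *\<^sub>R CF C a p"
  using transition_diff[OF C(1) _ C(2)]
  by (auto simp: coord_field_def fun_eq_iff charts_at_iff C linear_cmul linear_frechet_derivative
      scaleR_fun_def)

lemma CF_linear: "C \<in> A \<Longrightarrow> p \<in> cdom C \<Longrightarrow> linear (\<lambda>a. CF C a p)"
  by (intro linearI CF_add CF_scale)

lemmas CF_simps = CF_add CF_scale linear_diff[OF CF_linear] linear_0[OF CF_linear] linear_neg[OF CF_linear]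

lemma tangent_CF_image: 
  assumes "C \<in> A" "p \<in> cdom C"
  shows "tangent_space A p = range (\<lambda>a. CF C a p)"
  using CF_tangent[OF assms] CF_eta[OF _ assms] by (auto simp: image_iff) metis

lemma dir_deriv_chart:
  assumes C: "C \<in> A" "p \<in> cdom C" and v: "v \<in> tangent_space A p"
    and f: "(f \<circ> cinv C) differentiable (at (coord C p))"
  shows "dir_deriv A p v f = fd (f \<circ> cinv C) (coord C p) (v C)"
  unfolding dir_deriv_def Let_def
  by (subst change_chart[OF C chart_at f])
    (simp add: tangent_transform[OF v chart_at C, symmetric])

lemma comp_CF:
  assumes C: "C \<in> A" "x \<in> cimg C"
  shows "((\<lambda>q. CF C b q C) \<circ> cinv C) differentiable (at x)" 
    and "fd ((\<lambda>q. CF C b q C) \<circ> cinv C) x a = 0"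
proof -
  have eq: "((\<lambda>q. CF C b q C) \<circ> cinv C) y = b" if "y \<in> cimg C" for y
    using that C cinv_in[OF C(1) that] by simp
  show "((\<lambda>q. CF C b q C) \<circ> cinv C) differentiable (at x)"
    by (subst differentiable_cong_open[OF open_cimg[OF C(1)] C(2) eq]) auto
  show "fd ((\<lambda>q. CF C b q C) \<circ> cinv C) x a = 0"
    by (subst fd_cong_open[OF open_cimg[OF C(1)] C(2) eq]) auto
qed

lemma lie_bracket_chart:
  assumes C: "C \<in> A" "p \<in> cdom C" and "X p \<in> tangent_space A p" "Y p \<in> tangent_space A p"
    and "((\<lambda>q. X q C) \<circ> cinv C) differentiable (at (coord C p))"
    and "((\<lambda>q. Y q C) \<circ> cinv C) differentiable (at (coord C p))"
  shows "lie_bracket A C X Y p = CF C (fd ((\<lambda>q. Y q C) \<circ> cinv C) (coord C p) (X p C)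
    - fd ((\<lambda>q. X q C) \<circ> cinv C) (coord C p) (Y p C)) p"
  using assms by (simp add: lie_bracket_def dir_deriv_chart)

lemma lie_bracket_CF: 
  assumes C: "C \<in> A" "p \<in> cdom C"
  shows "lie_bracket A C (CF C a) (CF C b) p = 0"
  using C comp_CF[OF C(1) coord_in[OF C(2)]] CF_tangent[OF C]
  by (subst lie_bracket_chart) (auto simp: CF_simps)

lemma pushforward_id:
  assumes v: "v \<in> tangent_space A p"
  shows "pushforward A A id p v = v"
proof
  fix D
  show "pushforward A A id p v D = v D"
  proof (cases "D \<in> charts_at A p")
    case True
    then have D: "D \<in> A" "p \<in> cdom D" by (auto simp: charts_at_iff)
    have "dir_deriv A p v (coord D) = v D"
      using dir_deriv_chart[OF D v transition_diff[OF D(1,1) D(2,2)]] fd_transition_self[OF D] by simp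
    then show ?thesis using True by (simp add: pushforward_def)
  next
    case False
    then show ?thesis using tangent_eq_0[OF v] by (simp add: pushforward_def)
  qed
qed

end


text \<open>The domain \<open>W\<close> may be smaller than the chart image: for an immersed
  manifold, coordinates are usable only where the immersion lands in the chosen ambient
  chart.\<close>

locale metric_rep = manifold A + metric_chart W Gm
  for A :: "('a::{t2_space,second_countable_topology}, 'e::euclidean_space) chart set"
    and W :: "'e set" and Gm +
  fixes g :: "('a, 'e) metric_field" and C :: "('a, 'e) chart"
  assumes C: "C \<in> A" and W: "W \<subseteq> cimg C"
    and rep: "x \<in> W \<Longrightarrow> g (cinv C x) (coord_field A C a (cinv C x)) (coord_field A C b (cinv C x)) = Gm x a b"
begin

lemma rep_at: "p \<in> cdom C \<Longrightarrow> coord C p \<in> W \<Longrightarrow> g p (CF C a p) (CF C b p) = Gm (coord C p) a b"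
  using rep[of "coord C p" a b] C by simp

lemma christoffel_chart:
  assumes p: "p \<in> cdom C" "coord C p \<in> W"
  shows "christoffel A g C p a b = \<Gamma> (coord C p) a b"
proof -
  have cong: "((\<lambda>q. g q (CF C b q) (CF C c q)) \<circ> cinv C) differentiable (at (coord C p)) \<and>
     fd ((\<lambda>q. g q (CF C b q) (CF C c q)) \<circ> cinv C) (coord C p) = fd (\<lambda>x. Gm x b c) (coord C p)" for b c
    using differentiable_cong_open[OF open_U p(2), of "(\<lambda>q. g q (CF C b q) (CF C c q)) \<circ> cinv C" "\<lambda>x. Gm x b c"]
      fd_cong_open[OF open_U p(2), of "(\<lambda>q. g q (CF C b q) (CF C c q)) \<circ> cinv C" "\<lambda>x. Gm x b c"]
      rep G_diff[OF p(2)] by auto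
  have "dir_deriv A p (CF C a p) (\<lambda>q. g q (CF C b q) (CF C c q)) = fd (\<lambda>x. Gm x b c) (coord C p) a" for a b c
    using dir_deriv_chart[OF C p(1) CF_tangent[OF C p(1)] cong[THEN conjunct1]] cong C p by simp
  then show ?thesis
    unfolding christoffel_def \<Gamma>_def koszul_def Let_def by (simp add: rep_at[OF p])
qed

lemma nabla_chart:
  assumes p: "p \<in> cdom C" "coord C p \<in> W" and X: "X p \<in> tangent_space A p"
    and Y: "((\<lambda>q. Y q C) \<circ> cinv C) differentiable (at (coord C p))"
  shows "nabla A g C X Y p
    = CF C (fd ((\<lambda>q. Y q C) \<circ> cinv C) (coord C p) (X p C) + \<Gamma> (coord C p) (X p C) (Y p C)) p"
  unfolding nabla_def cov_deriv_along_def
  by (simp add: pushforward_id[OF X] dir_deriv_chart[OF C p(1) X Y] christoffel_chart[OF p])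

lemma nabla_CF:
  assumes p: "p \<in> cdom C" "coord C p \<in> W"
  shows "nabla A g C (CF C a) (CF C b) p = CF C (\<Gamma> (coord C p) a b) p"
  using nabla_chart[where X = "CF C a" and Y = "CF C b",
      OF p CF_tangent[OF C p(1)] comp_CF(1)[OF C coord_in[OF p(1)]]]
    comp_CF(2)[OF C coord_in[OF p(1)]] C p by simp

lemma curvature_chart:
  assumes p: "C = chart_at A p" "coord C p \<in> W"
  shows "curvature A g p u v w = CF C (curv (coord C p) (u C) (v C) (w C)) p"
proof -
  have pC: "p \<in> cdom C" using chart_at p by simp
  have second: "nabla A g C (CF C a) (nabla A g C (CF C b) (CF C c)) p
    = CF C (fd (\<lambda>x. \<Gamma> x b c) (coord C p) a + \<Gamma> (coord C p) a (\<Gamma> (coord C p) b c)) p" for a b c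
  proof -
    \<comment> \<open>The components of the inner derivative must be known on all of
      \<open>W\<close>, not only at \<open>p\<close>, because they are differentiated next.\<close>
    have eq: "((\<lambda>q. nabla A g C (CF C b) (CF C c) q C) \<circ> cinv C) y = \<Gamma> y b c" if "y \<in> W" for y
    proof -
      have y: "y \<in> cimg C" using that W by auto
      then have "cinv C y \<in> cdom C" "coord C (cinv C y) = y" using C cinv_in by auto
      then show ?thesis using nabla_CF[of "cinv C y" b c] that C by simp
    qed
    have d: "((\<lambda>q. nabla A g C (CF C b) (CF C c) q C) \<circ> cinv C) differentiable (at (coord C p))"
      by (subst differentiable_cong_open[OF open_U p(2) eq]) (auto intro: \<Gamma>_diff p)
    show ?thesis
      using nabla_chart[where X = "CF C a" and Y = "nabla A g C (CF C b) (CF C c)",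
          OF pC p(2) CF_tangent[OF C pC] d] fd_cong_open[OF open_U p(2) eq]
      by (simp add: nabla_CF[OF pC p(2)] C pC)
  qed
  have third: "nabla A g C (lie_bracket A C (CF C a) (CF C b)) (CF C c) p = 0" for a b c
  proof -
    have L: "lie_bracket A C (CF C a) (CF C b) p = CF C 0 p"
      using lie_bracket_CF[OF C pC] by (simp add: CF_simps C pC)
    \<comment> \<open>A covariant derivative depends on its direction field only through the value
      at \<open>p\<close>, so the bracket may be replaced by the constant field 0.\<close>
    have "nabla A g C (lie_bracket A C (CF C a) (CF C b)) (CF C c) p = nabla A g C (CF C 0) (CF C c) p"
      by (simp add: nabla_def L)
    then show ?thesis using p(2) by (simp add: nabla_CF[OF pC p(2)] \<Gamma>_simps CF_simps C pC)
  qed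
  show ?thesis
    unfolding curvature_def p(1)[symmetric] Let_def second third
    by (simp add: curv_def CF_simps C pC)
qed

end


section \<open>Coordinate expression of a Riemannian metric\<close>

context manifold begin

definition gc :: "('a, 'e) metric_field \<Rightarrow> ('a, 'e) chart \<Rightarrow> 'e \<Rightarrow> 'e \<Rightarrow> 'e \<Rightarrow> real"
  where "gc g C x a b = g (cinv C x) (CF C a (cinv C x)) (CF C b (cinv C x))"

lemma subspace_tangent: "subspace (tangent_space A p)"
  unfolding tangent_CF_image[OF chart_at]
  by (rule linear_subspace_image[OF CF_linear[OF chart_at] subspace_UNIV])

lemma metric_bilinear:
  assumes g: "riemannian_metric A g"
    and u: "u \<in> tangent_space A p" "u' \<in> tangent_space A p" and v: "v \<in> tangent_space A p"
  shows "g p v (u + u') = g p v u + g p v u'" "g p (u + u') v = g p u v + g p u' v"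
    "g p v (r *\<^sub>R u) = r * g p v u" "g p (r *\<^sub>R u) v = r * g p u v" "g p u v = g p v u"
    "g p v (u - u') = g p v u - g p v u'" "g p (u - u') v = g p u v - g p u' v"
    "g p v 0 = 0" "g p 0 v = 0"
proof -
  note T = subspace_add[OF subspace_tangent] subspace_scale[OF subspace_tangent]
    subspace_diff[OF subspace_tangent] subspace_0[OF subspace_tangent]
  have lin: "linear_map_on (tangent_space A p) (g p w)" if "w \<in> tangent_space A p" for w
    using g that by (simp add: riemannian_metric_def)
  have sym: "g p a b = g p b a" if "a \<in> tangent_space A p" "b \<in> tangent_space A p" for a b
    using g that by (simp add: riemannian_metric_def)
  have add: "g p w (a + b) = g p w a + g p w b" and scale: "g p w (r *\<^sub>R a) = r * g p w a"
    if "a \<in> tangent_space A p" "b \<in> tangent_space A p" "w \<in> tangent_space A p" for a b w r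
    using lin[OF that(3)] that by (auto simp: linear_map_on_def)
  show 1: "g p v (u + u') = g p v u + g p v u'" "g p v (r *\<^sub>R u) = r * g p v u" 
    using add scale u v by auto
  show 2: "g p u v = g p v u" by (rule sym[OF u(1) v])
  show "g p (u + u') v = g p u v + g p u' v" "g p (r *\<^sub>R u) v = r * g p u v"
    using 1 2 sym[OF u(2) v] sym[OF T(1)[OF u] v] sym[OF T(2)[OF u(1)] v] by auto
  have "- u' = (-1) *\<^sub>R u'" by simp
  then have 3: "g p v (u - u') = g p v u - g p v u'"
    using add[OF u(1) T(2)[OF u(2), of "-1"] v] scale[OF u(2,2) v, of "-1"] by simp
  then show "g p v (u - u') = g p v u - g p v u'" .
  then show "g p (u - u') v = g p u v - g p u' v"
    using 2 sym[OF u(2) v] sym[OF T(3)[OF u] v] by simp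
  show "g p v 0 = 0" using scale[OF u v, of 0] by simp
  then show "g p 0 v = 0" using sym[OF T(4) v] by simp
qed

lemma metric_rep_gc:
  assumes g: "riemannian_metric A g" and C: "C \<in> A"
  shows "metric_rep A (cimg C) (gc g C) g C"
proof
  show "open (cimg C)" by (rule open_cimg[OF C])
  show "C \<in> A" by (rule C)
  show "g (cinv C x) (CF C a (cinv C x)) (CF C b (cinv C x)) = gc g C x a b" for x a b
    by (simp add: gc_def)
  have sm: "smooth_on (cimg C) (\<lambda>x. gc g C x a b)" for a b
    using g C by (simp add: riemannian_metric_def gc_def)
  fix x a b assume x: "x \<in> cimg C"
  let ?p = "cinv C x"
  have p: "?p \<in> cdom C" by (rule cinv_in[OF C x])
  note T = CF_tangent[OF C p] and CFs = CF_simps[OF C p]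
  note b = metric_bilinear[OF g T T T]
  show "bilinear (gc g C x)"
    unfolding bilinear_def gc_def by (auto intro!: linearI simp: CFs b)
  show "gc g C x a b = gc g C x b a" unfolding gc_def by (rule b)
  show "gc g C x a a > 0" if "a \<noteq> 0"
  proof -
    have "CF C a ?p \<noteq> 0" using CF_self[OF C p, of a] that by (auto simp: zero_fun_def)
    then show ?thesis using g T by (simp add: gc_def riemannian_metric_def)
  qed
  show "(\<lambda>z. gc g C z a b) differentiable (at x)"
    using sm smooth_on_differentiable x by blast
  show "(\<lambda>z. fd (\<lambda>w. gc g C w a b) z c) differentiable (at x)" for c
    using sm smooth_on_differentiable smooth_on_fd x by blast
qed simp

end


section \<open>Contact structures and their curvature in coordinates\<close>

locale contact_manifold = manifold A
  for A :: "('a::{t2_space,second_countable_topology}, 'e::euclidean_space) chart set" +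
  fixes \<phi> \<xi> \<eta> g
  assumes contact_metric_manifold: "contact_metric_manifold A \<phi> \<xi> \<eta> g"
begin

lemma almost_contact: "almost_contact_metric_manifold A \<phi> \<xi> \<eta> g"
  using contact_metric_manifold by (simp add: contact_metric_manifold_def)

lemma structure_fields:
  shows riemannian: "riemannian_metric A g" and "smooth_endomorphism_field A \<phi>"
    and "smooth_vector_field A \<xi>" and "smooth_one_form A \<eta>"
    and \<phi>_\<xi>_eq: "\<phi> p (\<xi> p) = 0" and \<eta>_\<xi>_eq: "\<eta> p (\<xi> p) = 1"
  using almost_contact by (auto simp: almost_contact_metric_manifold_def)

lemma structure_tangent:
  assumes "u \<in> tangent_space A p"
  shows "\<phi> p (\<phi> p u) = - u + \<eta> p u *\<^sub>R \<xi> p" and "g p u (\<xi> p) = \<eta> p u"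
    and "v \<in> tangent_space A p \<Longrightarrow> g p u (\<phi> p v) = - g p (\<phi> p u) v"
  using almost_contact assms by (auto simp: almost_contact_metric_manifold_def)

lemma \<xi>_tangent: "\<xi> p \<in> tangent_space A p"
  using structure_fields by (simp add: smooth_vector_field_def)

lemma \<phi>_tangent: "u \<in> tangent_space A p \<Longrightarrow> \<phi> p u \<in> tangent_space A p"
  using structure_fields(2) unfolding smooth_endomorphism_field_def by blast

lemma \<phi>_lin: "linear_map_on (tangent_space A p) (\<phi> p)"
  using structure_fields(2) unfolding smooth_endomorphism_field_def by blast

definition xic where "xic C x = \<xi> (cinv C x) C"
definition phc where "phc C x a = \<phi> (cinv C x) (CF C a (cinv C x)) C"

lemma contact_chart:
  assumes C: "C \<in> A"
  shows "contact_chart (cimg C) (gc g C) (xic C) (phc C)"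
proof -
  interpret R: metric_rep A "cimg C" "gc g C" g C
    by (rule metric_rep_gc[OF riemannian C])
  have xi: "CF C (xic C x) (cinv C x) = \<xi> (cinv C x)" if "x \<in> cimg C" for x
    unfolding xic_def by (intro CF_eta \<xi>_tangent C cinv_in that)
  have ph: "CF C (phc C x a) (cinv C x) = \<phi> (cinv C x) (CF C a (cinv C x))" if "x \<in> cimg C" for x a
    unfolding phc_def by (intro CF_eta \<phi>_tangent CF_tangent C cinv_in that)
  have eta: "gc g C x a (xic C x) = \<eta> (cinv C x) (CF C a (cinv C x))" if "x \<in> cimg C" for x a
    using structure_tangent(2)[OF CF_tangent[OF C cinv_in[OF C that]]] by (simp add: gc_def xi that)
  have eta_smooth: "smooth_on (cimg C) (\<lambda>x. \<eta> (cinv C x) (CF C a (cinv C x)))" for a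
    using structure_fields(4) C by (simp add: smooth_one_form_def)
  show ?thesis
  proof (intro contact_chart.intro contact_chart_axioms.intro R.metric_chart_axioms)
    show "smooth_on (cimg C) (xic C)"
      using structure_fields(3) C unfolding smooth_vector_field_def xic_def by blast
    show "smooth_on (cimg C) (\<lambda>z. gc g C z a (xic C z))" for a
      by (rule smooth_on_cong[OF open_cimg[OF C] _ eta_smooth]) (simp add: eta)
    fix x a b assume x: "x \<in> cimg C"
    let ?p = "cinv C x"
    have p: "?p \<in> cdom C" by (rule cinv_in[OF C x])
    note T = CF_tangent[OF C p] and CFs = CF_simps[OF C p]
    show "linear (phc C x)"
      using \<phi>_lin[of ?p] T CFs unfolding linear_map_on_def phc_def
      by (intro linearI) (simp_all add: plus_fun_def scaleR_fun_def)
    show "(\<lambda>z. phc C z a) differentiable (at x)"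
      using structure_fields(2) C smooth_on_differentiable x
      unfolding smooth_endomorphism_field_def phc_def by blast
    show "gc g C x (xic C x) (xic C x) = 1"
      by (simp add: eta[OF x] xi[OF x] structure_fields)
    show "phc C x (xic C x) = 0"
      unfolding phc_def by (simp add: xi[OF x] structure_fields zero_fun_def)
    show "phc C x (phc C x a) = - a + gc g C x a (xic C x) *\<^sub>R xic C x"
      using structure_tangent(1)[OF T, of a] eta[OF x, of a, unfolded xic_def] C p
      by (simp add: phc_def[of C x "phc C x a"] ph[OF x] xic_def[of C x]
          plus_fun_def scaleR_fun_def fun_Compl_def)
    show "gc g C x a (phc C x b) = - gc g C x (phc C x a) b"
      by (simp add: gc_def ph[OF x] structure_tangent(3)[OF T T])
    have dd: "dir_deriv A ?p (CF C a ?p) (\<lambda>q. \<eta> q (CF C b q)) = fd (\<lambda>z. gc g C z b (xic C z)) x a" for a b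
    proof -
      have eq: "((\<lambda>q. \<eta> q (CF C b q)) \<circ> cinv C) z = gc g C z b (xic C z)" if "z \<in> cimg C" for z
        using eta[OF that] by simp
      have "((\<lambda>q. \<eta> q (CF C b q)) \<circ> cinv C) differentiable (at x)"
        using smooth_on_differentiable[OF eta_smooth x] by (simp add: o_def)
      then show ?thesis
        using dir_deriv_chart[OF C p T, of "\<lambda>q. \<eta> q (CF C b q)"] fd_cong_open[OF open_cimg[OF C] x eq] C x p
        by simp
    qed
    \<comment> \<open>Removes the bracket term of \<open>ext_deriv\<close>, since the extensions
      have constant components.\<close>
    have "\<eta> ?p 0 = 0"
      using structure_fields(4) linear_map_on_0[OF _ \<xi>_tangent] unfolding smooth_one_form_def by blast
    moreover have "ext_deriv A C \<eta> ?p (CF C a ?p) (CF C b ?p) = g ?p (CF C a ?p) (\<phi> ?p (CF C b ?p))"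
      using contact_metric_manifold C p T by (simp add: contact_metric_manifold_def charts_at_iff)
    ultimately show "(fd (\<lambda>z. gc g C z b (xic C z)) x a - fd (\<lambda>z. gc g C z a (xic C z)) x b) / 2
      = gc g C x a (phc C x b)"
      by (simp add: ext_deriv_def C p dd lie_bracket_CF gc_def[of g C x a "phc C x b"] ph[OF x])
  qed
qed

lemma h_tensor_chart:
  assumes C: "C = chart_at A p"
  shows "h_tensor A \<phi> \<xi> p v = CF C (contact_chart.h (xic C) (phc C) (coord C p) (v C)) p"
proof -
  have CA: "C \<in> A" "p \<in> cdom C" using chart_at C by auto
  interpret K: contact_chart "cimg C" "gc g C" "xic C" "phc C" by (rule contact_chart[OF CA(1)])
  let ?x = "coord C p" and ?V = "CF C (v C)"
  have x: "?x \<in> cimg C" using CA by auto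
  note T = CF_tangent[OF CA]
  have xi: "(\<lambda>q. \<xi> q C) \<circ> cinv C = xic C" by (auto simp: xic_def)
  have ph: "(\<lambda>q. \<phi> q (?V q) C) \<circ> cinv C = (\<lambda>z. phc C z (v C))" by (auto simp: phc_def)
  have xip: "\<xi> p C = xic C ?x" and php: "\<phi> p (CF C b p) C = phc C ?x b" for b
    using CA by (auto simp: xic_def phc_def)
  have 1: "lie_bracket A C \<xi> (\<lambda>q. \<phi> q (?V q)) p
    = CF C (fd (\<lambda>z. phc C z (v C)) ?x (xic C ?x) - fd (xic C) ?x (phc C ?x (v C))) p"
    using lie_bracket_chart[OF CA, of \<xi> "\<lambda>q. \<phi> q (?V q)"] K.\<xi>_diff[OF x] K.\<phi>_diff[OF x]
      \<xi>_tangent \<phi>_tangent[OF T]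
    by (simp add: xi ph xip php)
  have 2: "lie_bracket A C \<xi> ?V p = CF C (- fd (xic C) ?x (v C)) p"
    using lie_bracket_chart[OF CA, of \<xi> ?V] comp_CF[OF CA(1) x] K.\<xi>_diff[OF x] \<xi>_tangent T CA
    by (simp add: xi)
  have 3: "\<phi> p (CF C b p) = CF C (phc C ?x b) p" for b
    using CF_eta[OF \<phi>_tangent[OF T] CA, of b] by (simp add: php)
  show ?thesis
    unfolding h_tensor_def Let_def C[symmetric] 1 2 3 K.h_def
    by (simp add: CF_simps CA K.\<phi>_simps x)
qed

lemma h_tensor_\<xi>: "h_tensor A \<phi> \<xi> p (\<xi> p) = 0"
proof -
  let ?C = "chart_at A p"
  note C = chart_at[of p]
  interpret K: contact_chart "cimg ?C" "gc g ?C" "xic ?C" "phc ?C" by (rule contact_chart[OF C(1)])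
  have "\<xi> p ?C = xic ?C (coord ?C p)" using C by (simp add: xic_def)
  then show ?thesis unfolding h_tensor_chart[OF refl] using C by (simp add: K.h_\<xi> CF_simps)
qed

lemma h_tensor_eq_0:
  assumes R: "\<And>X. X \<in> tangent_space A p \<Longrightarrow> curvature A g p X (\<xi> p) (\<xi> p)
      = X - g p X (\<xi> p) *\<^sub>R \<xi> p
        + \<mu> *\<^sub>R (h_tensor A \<phi> \<xi> p X - g p (h_tensor A \<phi> \<xi> p X) (\<xi> p) *\<^sub>R \<xi> p)"
  shows "h_tensor A \<phi> \<xi> p v = 0"
proof -
  define C where C: "C = chart_at A p"
  have CA: "C \<in> A" "p \<in> cdom C" using chart_at C by auto
  interpret K: contact_chart "cimg C" "gc g C" "xic C" "phc C" by (rule contact_chart[OF CA(1)])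
  interpret R: metric_rep A "cimg C" "gc g C" g C by (rule metric_rep_gc[OF riemannian CA(1)])
  let ?x = "coord C p"
  have x: "?x \<in> cimg C" using CA by auto
  note T = CF_tangent[OF CA]
  have xip: "\<xi> p = CF C (xic C ?x) p" "\<xi> p C = xic C ?x"
    using CF_eta[OF \<xi>_tangent CA] CA by (simp_all add: xic_def)
  have h: "h_tensor A \<phi> \<xi> p (CF C a p) = CF C (K.h ?x a) p" for a
    using h_tensor_chart[OF C] CA by simp
  have gg: "g p (CF C a p) (\<xi> p) = gc g C ?x a (xic C ?x)" for a
    using R.rep_at[OF CA(2) x] xip(1) by simp
  have "K.curv ?x a (xic C ?x) (xic C ?x) = a - gc g C ?x a (xic C ?x) *\<^sub>R xic C ?x
      + \<mu> *\<^sub>R (K.h ?x a - gc g C ?x (K.h ?x a) (xic C ?x) *\<^sub>R xic C ?x)" for a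
  proof -
    have "curvature A g p (CF C a p) (\<xi> p) (\<xi> p) C = K.curv ?x a (xic C ?x) (xic C ?x)"
      using R.curvature_chart[OF C x] CA by (simp add: xip(2))
    moreover have "curvature A g p (CF C a p) (\<xi> p) (\<xi> p) C = a - gc g C ?x a (xic C ?x) *\<^sub>R xic C ?x
      + \<mu> *\<^sub>R (K.h ?x a - gc g C ?x (K.h ?x a) (xic C ?x) *\<^sub>R xic C ?x)"
      unfolding R[OF T] h gg using CA
      by (simp add: plus_fun_def fun_diff_def scaleR_fun_def xip(2))
    ultimately show ?thesis by simp
  qed
  then have "K.h ?x (v C) = 0" by (rule K.h_eq_0[OF x])
  then show ?thesis unfolding h_tensor_chart[OF C] by (simp add: CF_simps CA)
qed

text \<open>The functions \<open>f1 - f3\<close> and \<open>f4 - f6\<close> play the roles of \<open>\<kappa>\<close> and \<open>\<mu>\<close>; so \<open>\<kappa> = 1\<close>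
  forces \<open>h = 0\<close>.\<close>

lemma space_form_h_tensor_eq_0:
  assumes "generalized_kappa_mu_space_form A \<phi> \<xi> \<eta> g f1 f2 f3 f4 f5 f6" and f3: "f3 p = f1 p - 1"
  shows "h_tensor A \<phi> \<xi> p v = 0"
proof (rule h_tensor_eq_0)
  fix X assume X: "X \<in> tangent_space A p"
  let ?h = "h_tensor A \<phi> \<xi> p" and ?\<xi> = "\<xi> p"
  note zero = metric_bilinear(8,9)[OF riemannian X X X] metric_bilinear(8,9)[OF riemannian \<xi>_tangent \<xi>_tangent \<xi>_tangent]
  have \<phi>0: "\<phi> p 0 = 0" by (rule linear_map_on_0[OF \<phi>_lin X])
  have \<eta>: "\<eta> p X = g p X ?\<xi>" "g p ?\<xi> ?\<xi> = 1"
    using structure_tangent(2)[OF X] structure_tangent(2)[OF \<xi>_tangent] \<eta>_\<xi>_eq by auto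
  \<comment> \<open>At (X, \<xi>, \<xi>) the tensor R3 equals - R1 and R6 equals - R4, while R2 and
    R5 vanish because \<phi> \<xi> = 0 and h \<xi> = 0.\<close>
  have "curvature A g p X ?\<xi> ?\<xi> = f1 p *\<^sub>R (X - g p X ?\<xi> *\<^sub>R ?\<xi>) + f3 p *\<^sub>R (g p X ?\<xi> *\<^sub>R ?\<xi> - X)
     + f4 p *\<^sub>R (?h X - g p (?h X) ?\<xi> *\<^sub>R ?\<xi>) + f6 p *\<^sub>R (g p (?h X) ?\<xi> *\<^sub>R ?\<xi> - ?h X)"
    using assms(1) X \<xi>_tangent[of p]
    by (simp add: generalized_kappa_mu_space_form_def Let_def R1_def R2_def R3_def R4_def R5_def R6_def
      h_tensor_\<xi> \<phi>_\<xi>_eq \<phi>0 \<eta> \<eta>_\<xi>_eq zero)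
  then show "curvature A g p X ?\<xi> ?\<xi> = X - g p X ?\<xi> *\<^sub>R ?\<xi>
      + (f4 p - f6 p) *\<^sub>R (?h X - g p (?h X) ?\<xi> *\<^sub>R ?\<xi>)"
    by (simp add: f3 algebra_simps)
qed

text \<open>R4, R5 and R6 vanish with h; every term of R3 contains \<eta> of \<open>X\<close> or
  \<open>Y\<close>; every term of R2 contains one of the three products with \<phi>. Only R1
  survives.\<close>

lemma space_form_curvature:
  assumes gen: "generalized_kappa_mu_space_form A \<phi> \<xi> \<eta> g f1 f2 f3 f4 f5 f6" and f3: "f3 p = f1 p - 1"
    and T: "X \<in> tangent_space A p" "Y \<in> tangent_space A p" "Z \<in> tangent_space A p" "W \<in> tangent_space A p"
    and \<xi>: "g p X (\<xi> p) = 0" "g p Y (\<xi> p) = 0"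
    and \<phi>: "g p X (\<phi> p Y) = 0" "g p X (\<phi> p Z) = 0" "g p Y (\<phi> p Z) = 0"
  shows "g p (curvature A g p X Y Z) W = f1 p * (g p Y Z * g p X W - g p X Z * g p Y W)"
proof -
  have h: "h_tensor A \<phi> \<xi> p v = 0" for v
    by (rule space_form_h_tensor_eq_0[of f1 f2 f3 f4 f5 f6]) (use gen f3 in auto)
  have \<phi>0: "\<phi> p 0 = 0" by (rule linear_map_on_0[OF \<phi>_lin T(1)])
  have \<eta>: "\<eta> p X = 0" "\<eta> p Y = 0"
    using structure_tangent(2)[OF T(1)] structure_tangent(2)[OF T(2)] \<xi> by auto
  note zero = metric_bilinear(8,9)[OF riemannian T(1,1) T(3)]
  have curv: "curvature A g p X Y Z = f1 p *\<^sub>R (g p Y Z *\<^sub>R X - g p X Z *\<^sub>R Y)"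
    using gen T
    by (simp add: generalized_kappa_mu_space_form_def Let_def R1_def R2_def R3_def R4_def R5_def R6_def
      h \<phi> \<phi>0 \<eta> zero)
  note s = subspace_scale[OF subspace_tangent]
  note sub = subspace_diff[OF subspace_tangent s[OF T(1)] s[OF T(2)]]
  show ?thesis
    unfolding curv
    using metric_bilinear(4)[OF riemannian sub sub T(4)]
      metric_bilinear(7)[OF riemannian s[OF T(1)] s[OF T(2)] T(4)]
      metric_bilinear(4)[OF riemannian T(1,1) T(4)] metric_bilinear(4)[OF riemannian T(2,2) T(4)]
    by simp
qed

end


section \<open>C-totally real submanifolds\<close>

locale immersion_manifold = A: manifold A + B: manifold B
  for A :: "('a::{t2_space,second_countable_topology}, 'e::euclidean_space) chart set"
    and B :: "('b::{t2_space,second_countable_topology}, 'f::euclidean_space) chart set" +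
  fixes F :: "'b \<Rightarrow> 'a"
  assumes immersion: "immersion B A F"
begin

definition Fc :: "('b, 'f) chart \<Rightarrow> ('a, 'e) chart \<Rightarrow> 'f \<Rightarrow> 'e"
  where "Fc C D = coord D \<circ> F \<circ> cinv C"

definition Vc :: "('b, 'f) chart \<Rightarrow> ('a, 'e) chart \<Rightarrow> 'f set"
  where "Vc C D = coord C ` (cdom C \<inter> F -` cdom D)"

lemma smooth_Fc: "C \<in> B \<Longrightarrow> D \<in> A \<Longrightarrow> smooth_on (Vc C D) (Fc C D)"
  using immersion by (simp add: immersion_def smooth_map_def Fc_def Vc_def)

lemma open_Vc: "C \<in> B \<Longrightarrow> D \<in> A \<Longrightarrow> open (Vc C D)"
  unfolding Vc_def using immersion A.open_cdom
  by (intro B.open_image_coord open_vimage) (auto simp: immersion_def smooth_map_def)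

lemma Vc_subset: "Vc C D \<subseteq> cimg C"
  by (auto simp: Vc_def)

lemma Vc_cinv: 
  assumes "C \<in> B" "x \<in> Vc C D"
  shows "cinv C x \<in> cdom C" "F (cinv C x) \<in> cdom D" "coord C (cinv C x) = x"
  using assms by (auto simp: Vc_def)

lemma Vc_I: "q \<in> cdom C \<Longrightarrow> F q \<in> cdom D \<Longrightarrow> coord C q \<in> Vc C D"
  by (auto simp: Vc_def)

text \<open>A pushed-forward vector has components in every ambient chart \<open>E\<close> around
  the image point; passing through \<open>D\<close> by the chain rule reduces them all to the
  Jacobian of \<open>Fc C D\<close>.\<close>

lemma pushforward_chart:
  assumes C: "C \<in> B" "q \<in> cdom C" and D: "D \<in> A" "F q \<in> cdom D"
  shows "pushforward B A F q (B.CF C a q) = A.CF D (fd (Fc C D) (coord C q) a) (F q)"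
proof
  fix E
  let ?x = "coord C q"
  show "pushforward B A F q (B.CF C a q) E = A.CF D (fd (Fc C D) ?x a) (F q) E"
  proof (cases "E \<in> charts_at A (F q)")
    case True
    then have E: "E \<in> A" "F q \<in> cdom E" by (auto simp: A.charts_at_iff)
    have diff: "Fc C E' differentiable (at ?x)" if "E' \<in> A" "F q \<in> cdom E'" for E'
      using smooth_on_differentiable[OF smooth_Fc[OF C(1) that(1)] Vc_I[OF C(2) that(2)]] .
    have "dir_deriv B q (B.CF C a q) (coord E \<circ> F) = fd (Fc C E) ?x a"
      using B.dir_deriv_chart[OF C B.CF_tangent[OF C], of "coord E \<circ> F"] diff[OF E] C
      by (simp add: Fc_def)
    have Fcx: "Fc C D ?x = coord D (F q)" using C by (simp add: Fc_def)
    note \<open>dir_deriv B q _ _ = _\<close>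
    also have "fd (Fc C E) ?x = fd (\<lambda>x. (coord E \<circ> cinv D) (Fc C D x)) ?x"
      by (rule fd_cong_open[OF open_Vc[OF C(1) D(1)] Vc_I[OF C(2) D(2)]])
        (use C D in \<open>auto simp: Fc_def Vc_def\<close>)
    also have "\<dots> a = fd (coord E \<circ> cinv D) (Fc C D ?x) (fd (Fc C D) ?x a)"
      using A.transition_diff[OF D(1) E(1) D(2) E(2)] unfolding Fcx[symmetric]
      by (rule fd_chain[OF diff[OF D]])
    finally have "dir_deriv B q (B.CF C a q) (coord E \<circ> F)
      = fd (coord E \<circ> cinv D) (coord D (F q)) (fd (Fc C D) ?x a)" unfolding Fcx .
    moreover have "pushforward B A F q v E = dir_deriv B q v (coord E \<circ> F)" for v
      using True by (simp add: pushforward_def)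
    moreover have "A.CF D w (F q) E = fd (coord E \<circ> cinv D) (coord D (F q)) w" for w
      using D E by (simp add: coord_field_def A.charts_at_iff)
    ultimately show ?thesis by (simp only:)
  next
    case False
    then show ?thesis by (simp add: pushforward_def coord_field_def)
  qed
qed

lemma immersed_chart:
  assumes g: "riemannian_metric A g" and C: "C \<in> B" and D: "D \<in> A"
  shows "immersed_chart (cimg D) (A.gc g D) (Vc C D) (Fc C D)"
proof -
  interpret R: metric_rep A "cimg D" "A.gc g D" g D by (rule A.metric_rep_gc[OF g D])
  show ?thesis
  proof (intro immersed_chart.intro immersed_chart_axioms.intro R.metric_chart_axioms)
    show "open (Vc C D)" by (rule open_Vc[OF C D])
    show "smooth_on (Vc C D) (Fc C D)" by (rule smooth_Fc[OF C D])
    fix x assume x: "x \<in> Vc C D"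
    note q = Vc_cinv[OF C x]
    show "Fc C D x \<in> cimg D" using q by (auto simp: Fc_def)
    fix a assume "fd (Fc C D) x a = 0"
    then have "pushforward B A F (cinv C x) (B.CF C a (cinv C x)) = 0"
      using q by (simp add: pushforward_chart[OF C q(1) D q(2)] A.CF_simps D)
    then have "B.CF C a (cinv C x) = 0"
      using immersion B.CF_tangent[OF C q(1)] unfolding immersion_def by blast
    then show "a = 0"
      using B.CF_self[OF C q(1), of a] by (simp add: zero_fun_def)
  qed
qed

lemma induced_metric_rep:
  assumes g: "riemannian_metric A g" and C: "C \<in> B" and D: "D \<in> A"
  shows "metric_rep B (Vc C D) (immersed_chart.gM (A.gc g D) (Fc C D)) (induced_metric B A g F) C"
proof -
  interpret R: metric_rep A "cimg D" "A.gc g D" g D by (rule A.metric_rep_gc[OF g D])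
  interpret I: immersed_chart "cimg D" "A.gc g D" "Vc C D" "Fc C D" by (rule immersed_chart[OF g C D])
  show ?thesis
  proof (intro metric_rep.intro metric_rep_axioms.intro B.manifold_axioms I.M.metric_chart_axioms C Vc_subset)
    fix x a b assume x: "x \<in> Vc C D"
    note q = Vc_cinv[OF C x]
    have "coord D (F (cinv C x)) = Fc C D x" by (simp add: Fc_def)
    then show "induced_metric B A g F (cinv C x) (B.CF C a (cinv C x)) (B.CF C b (cinv C x)) = I.gM x a b"
      using q R.rep_at[OF q(2)] I.F_in[OF x]
      by (simp add: induced_metric_def pushforward_chart[OF C q(1) D q(2)] I.gM_def)
  qed
qed

text \<open>The ambient half of the Gauss formula becomes \<open>hess\<close> and the intrinsic half
  the image of the Christoffel symbol of the induced metric; their difference is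
  \<open>sff\<close>.\<close>

lemma second_fundamental_form_chart:
  assumes g: "riemannian_metric A g" and C: "C = chart_at B p" and D: "D = chart_at A (F p)"
    and u: "u \<in> tangent_space B p"
  shows "second_fundamental_form B A g F p u v
    = A.CF D (immersed_chart.sff (A.gc g D) (Fc C D) (coord C p) (u C) (v C)) (F p)"
proof -
  have CB: "C \<in> B" "p \<in> cdom C" and DA: "D \<in> A" "F p \<in> cdom D"
    using B.chart_at A.chart_at C D by auto
  interpret R: metric_rep A "cimg D" "A.gc g D" g D by (rule A.metric_rep_gc[OF g DA(1)])
  interpret I: immersed_chart "cimg D" "A.gc g D" "Vc C D" "Fc C D"
    by (rule immersed_chart[OF g CB(1) DA(1)])
  interpret J: metric_rep B "Vc C D" I.gM "induced_metric B A g F" C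
    by (rule induced_metric_rep[OF g CB(1) DA(1)])
  let ?x = "coord C p" and ?V = "B.CF C (v C)"
  have x: "?x \<in> Vc C D" by (rule Vc_I[OF CB(2) DA(2)])
  have Fx: "Fc C D ?x = coord D (F p)" using CB by (simp add: Fc_def)
  have eq: "((\<lambda>q. pushforward B A F q (?V q) D) \<circ> cinv C) y = fd (Fc C D) y (v C)" if "y \<in> Vc C D" for y
    using Vc_cinv[OF CB(1) that] CB DA by (simp add: pushforward_chart)
  have d: "((\<lambda>q. pushforward B A F q (?V q) D) \<circ> cinv C) differentiable (at ?x)"
    by (subst differentiable_cong_open[OF I.open_V x eq]) (auto intro: I.F_diff2[OF x])
  have dd: "dir_deriv B p u (\<lambda>q. pushforward B A F q (?V q) D) = fd (\<lambda>y. fd (Fc C D) y (v C)) ?x (u C)"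
    using B.dir_deriv_chart[OF CB u d] fd_cong_open[OF I.open_V x eq] by simp
  have pu: "pushforward B A F p u = A.CF D (fd (Fc C D) ?x (u C)) (F p)"
    using pushforward_chart[OF CB DA, of "u C"] B.CF_eta[OF u CB] by simp
  have "cov_deriv_along B A g F D p u (\<lambda>q. pushforward B A F q (?V q)) = A.CF D (I.hess ?x (u C) (v C)) (F p)"
    unfolding cov_deriv_along_def dd pu pushforward_chart[OF CB DA]
    using R.christoffel_chart[OF DA(2) A.coord_in[OF DA(2)]] DA by (simp add: I.hess_eq Fx)
  moreover have "pushforward B A F p (nabla B (induced_metric B A g F) C (B.CF C (u C)) ?V p)
     = A.CF D (fd (Fc C D) ?x (I.M.\<Gamma> ?x (u C) (v C))) (F p)"
    unfolding J.nabla_CF[OF CB(2) x] pushforward_chart[OF CB DA] ..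
  ultimately show ?thesis
    unfolding second_fundamental_form_def Let_def C[symmetric] D[symmetric] I.sff_def
    by (simp add: A.CF_simps DA)
qed

end


locale kappa_mu_submanifold = immersion_manifold A B F + contact_manifold A \<phi> \<xi> \<eta> g
  for A :: "('a::{t2_space,second_countable_topology}, 'e::euclidean_space) chart set"
    and \<phi> \<xi> \<eta> g
    and B :: "('b::{t2_space,second_countable_topology}, 'f::euclidean_space) chart set" and F +
  fixes f1 f2 f3 f4 f5 f6 :: "'a \<Rightarrow> real" and p :: 'b
  assumes space_form: "generalized_kappa_mu_space_form A \<phi> \<xi> \<eta> g f1 f2 f3 f4 f5 f6"
    and f3: "f3 (F p) = f1 (F p) - 1"
    and \<xi>_normal: "\<And>q u. u \<in> tangent_space B q \<Longrightarrow> g (F q) (\<xi> (F q)) (pushforward B A F q u) = 0"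
begin

definition C where "C = chart_at B p"
definition D where "D = chart_at A (F p)"

text \<open>The linear isomorphism from the model space onto the tangent space at \<open>p\<close>,
  along which all statements are pulled back.\<close>

abbreviation "\<iota> \<equiv> (\<lambda>a. B.CF C a p)"

lemma CB: "C \<in> B" "p \<in> cdom C" and DA: "D \<in> A" "F p \<in> cdom D"
  using B.chart_at A.chart_at by (auto simp: C_def D_def)

sublocale R: metric_rep A "cimg D" "A.gc g D" g D
  by (rule A.metric_rep_gc[OF riemannian DA(1)])

sublocale I: immersed_chart "cimg D" "A.gc g D" "Vc C D" "Fc C D"
  by (rule immersed_chart[OF riemannian CB(1) DA(1)])

sublocale J: metric_rep B "Vc C D" I.gM "induced_metric B A g F" C
  by (rule induced_metric_rep[OF riemannian CB(1) DA(1)])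

sublocale K: contact_chart "cimg D" "A.gc g D" "xic D" "phc D"
  by (rule contact_chart[OF DA(1)])

lemma C_totally_real_chart:
  "C_totally_real_chart (cimg D) (A.gc g D) (xic D) (phc D) (Vc C D) (Fc C D)"
proof (intro C_totally_real_chart.intro C_totally_real_chart_axioms.intro
    K.contact_chart_axioms I.immersed_chart_axioms)
  fix x a assume x: "x \<in> Vc C D"
  note q = Vc_cinv[OF CB(1) x]
  let ?q = "cinv C x"
  have Fx: "Fc C D x = coord D (F ?q)" by (simp add: Fc_def)
  have "\<xi> (F ?q) = A.CF D (xic D (Fc C D x)) (F ?q)"
    using A.CF_eta[OF \<xi>_tangent DA(1) q(2)] DA q by (simp add: xic_def Fx)
  moreover have "g (F ?q) (\<xi> (F ?q)) (A.CF D (fd (Fc C D) x a) (F ?q)) = 0"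
    using \<xi>_normal[OF B.CF_tangent[OF CB(1) q(1)], of a] q
    by (simp add: pushforward_chart[OF CB(1) q(1) DA(1) q(2)])
  ultimately have "A.gc g D (Fc C D x) (xic D (Fc C D x)) (fd (Fc C D) x a) = 0"
    using R.rep_at[OF q(2)] q(2) by (simp add: Fx)
  then show "A.gc g D (Fc C D x) (fd (Fc C D) x a) (xic D (Fc C D x)) = 0"
    using R.G_sym[OF I.F_in[OF x]] by simp
qed

sublocale T: C_totally_real_chart "cimg D" "A.gc g D" "xic D" "phc D" "Vc C D" "Fc C D"
  by (rule C_totally_real_chart)

abbreviation "gM \<equiv> induced_metric B A g F"
abbreviation "x0 \<equiv> coord C p"
abbreviation "y0 \<equiv> coord D (F p)"

lemma x0: "x0 \<in> Vc C D" and y0: "y0 \<in> cimg D" and Fx0: "Fc C D x0 = y0"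
  using CB DA by (auto intro: Vc_I simp: Fc_def)

lemma \<iota>_self: "\<iota> a C = a" and \<iota>_tangent: "\<iota> a \<in> tangent_space B p"
  using CB by (auto intro: B.CF_tangent)

lemma tangent_eq_\<iota>: "tangent_space B p = range \<iota>"
  by (rule B.tangent_CF_image[OF CB])

lemma gM_\<iota>: "gM p (\<iota> a) (\<iota> b) = I.gM x0 a b"
  by (rule J.rep_at[OF CB(2) x0])

lemma g_CF: "g (F p) (A.CF D a (F p)) (A.CF D b (F p)) = A.gc g D y0 a b"
  by (rule R.rep_at[OF DA(2) y0])

lemma curvature_\<iota>: "curvature B gM p (\<iota> a) (\<iota> b) (\<iota> c) = \<iota> (I.M.curv x0 a b c)"
  using J.curvature_chart[OF C_def x0] by (simp add: \<iota>_self)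

lemma sff_\<iota>: "second_fundamental_form B A g F p (\<iota> a) (\<iota> b) = A.CF D (I.sff x0 a b) (F p)"
  using second_fundamental_form_chart[OF riemannian C_def D_def \<iota>_tangent] by (simp add: \<iota>_self)

text \<open>For tangent vectors of the submanifold, \<open>T.\<xi>_normal\<close> and
  \<open>T.\<phi>_tangent_normal\<close> are exactly the orthogonality conditions that
  \<open>space_form_curvature\<close> requires.\<close>

lemma ambient_curvature:
  "A.gc g D y0 (R.curv y0 (fd (Fc C D) x0 a) (fd (Fc C D) x0 b) (fd (Fc C D) x0 c)) (fd (Fc C D) x0 d)
    = f1 (F p) * (I.gM x0 b c * I.gM x0 a d - I.gM x0 a c * I.gM x0 b d)"
proof -
  define E where "E a = A.CF D (fd (Fc C D) x0 a) (F p)" for a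
  have ET: "E a \<in> tangent_space A (F p)" for a
    unfolding E_def by (rule A.CF_tangent[OF DA])
  have gE: "g (F p) (E a) (E b) = I.gM x0 a b" for a b
    by (simp add: E_def g_CF I.gM_def Fx0)
  have "\<xi> (F p) = A.CF D (xic D y0) (F p)"
    using A.CF_eta[OF \<xi>_tangent DA] DA by (simp add: xic_def)
  then have \<xi>: "g (F p) (E a) (\<xi> (F p)) = 0" for a
    using T.\<xi>_normal[OF x0, of a] by (simp add: E_def g_CF Fx0)
  have "\<phi> (F p) (E a) = A.CF D (phc D y0 (fd (Fc C D) x0 a)) (F p)" for a
    using A.CF_eta[OF \<phi>_tangent[OF ET] DA, of a] DA by (simp add: phc_def E_def)
  then have \<phi>: "g (F p) (E a) (\<phi> (F p) (E b)) = 0" for a b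
    using T.\<phi>_tangent_normal[OF x0, of a b] by (simp add: E_def g_CF Fx0)
  have "curvature A g (F p) (E a) (E b) (E c)
      = A.CF D (R.curv y0 (fd (Fc C D) x0 a) (fd (Fc C D) x0 b) (fd (Fc C D) x0 c)) (F p)"
    using R.curvature_chart[OF D_def y0] DA by (simp add: E_def)
  then show ?thesis
    using space_form_curvature[OF space_form f3 ET ET ET ET \<xi> \<xi> \<phi> \<phi> \<phi>, of a b c d]
    by (simp add: gE) (simp add: E_def g_CF)
qed

sublocale Q: gauss_data "I.gM x0" "A.gc g D y0" "I.sff x0" "f1 (F p)"
proof
  show "bilinear (I.gM x0)" by (rule I.M.bilinear_G[OF x0])
  show "I.gM x0 a b = I.gM x0 b a" for a b by (rule I.M.G_sym[OF x0])
  show "a \<noteq> 0 \<Longrightarrow> I.gM x0 a a > 0" for a by (rule I.M.G_pos[OF x0])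
  show "bilinear (A.gc g D y0)" by (rule R.bilinear_G[OF y0])
  show "A.gc g D y0 a b = A.gc g D y0 b a" for a b by (rule R.G_sym[OF y0])
  show "a \<noteq> 0 \<Longrightarrow> A.gc g D y0 a a > 0" for a by (rule R.G_pos[OF y0])
  show "bilinear (I.sff x0)" by (rule I.bilinear_sff[OF x0])
  show "I.sff x0 a b = I.sff x0 b a" for a b by (rule I.sff_sym[OF x0])
qed

text \<open>The passage from geometry to \<open>gauss_data\<close>: the Gauss equation with its
  ambient term evaluated.\<close>

lemma Rm_\<iota>: "gM p (curvature B gM p (\<iota> a) (\<iota> b) (\<iota> c)) (\<iota> d) = Q.Rm a b c d"
  unfolding curvature_\<iota> gM_\<iota> I.gauss_equation[OF x0] Fx0 ambient_curvature Q.Rm_def by simp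

section \<open>Orthonormal bases at the point and the traces taken over them\<close>

lemma orthonormal_basis_components:
  assumes "orthonormal_basis B gM p e"
  shows frame_components: "Q.frame (\<lambda>j. e j C)"
    and \<iota>_components: "j \<in> {1..DIM('f)} \<Longrightarrow> e j = \<iota> (e j C)"
proof -
  have e: "e j = \<iota> (e j C)" if "j \<in> {1..DIM('f)}" for j
  proof -
    have "e j \<in> tangent_space B p"
      using assms that span_base[of "e j" "e ` {1..DIM('f)}"] by (auto simp: orthonormal_basis_def)
    then show ?thesis using B.CF_eta[OF _ CB] by metis
  qed
  then show "e j = \<iota> (e j C)" if "j \<in> {1..DIM('f)}" using that .
  show "Q.frame (\<lambda>j. e j C)"
    unfolding Q.orthonormal_def
  proof (intro ballI)
    fix i j assume ij: "i \<in> {1..DIM('f)}" "j \<in> {1..DIM('f)}"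
    have "I.gM x0 (e i C) (e j C) = gM p (e i) (e j)"
      using gM_\<iota> e[OF ij(1)] e[OF ij(2)] by metis
    then show "I.gM x0 (e i C) (e j C) = (if i = j then 1 else 0)"
      using assms ij by (simp add: orthonormal_basis_def)
  qed
qed

lemma frame_imp_orthonormal_basis:
  assumes "Q.frame e"
  shows "orthonormal_basis B gM p (\<lambda>j. \<iota> (e j))"
proof -
  have "span ((\<lambda>j. \<iota> (e j)) ` {1..DIM('f)}) = \<iota> ` span (e ` {1..DIM('f)})"
    unfolding linear_span_image[OF B.CF_linear[OF CB], symmetric] by (simp add: image_image)
  then show ?thesis
    using assms Q.span_frame[OF assms]
    by (simp add: orthonormal_basis_def gM_\<iota> Q.orthonormal_def tangent_eq_\<iota>)
qed

text \<open>Components of the very basis selected in \<open>ricci_tensor\<close> and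
  \<open>mean_curvature\<close>; both contain the same \<open>SOME\<close> term, so one frame serves
  for both.\<close>

definition e0 :: "nat \<Rightarrow> 'f" where
  "e0 j = (SOME e. orthonormal_basis B gM p e) j C"

lemma e0: "Q.frame e0"
  and e0_eq: "j \<in> {1..DIM('f)} \<Longrightarrow> (SOME e. orthonormal_basis B gM p e) j = \<iota> (e0 j)"
proof -
  obtain e where "Q.frame e" using Q.frame_exists .
  then have "\<exists>e. orthonormal_basis B gM p e" using frame_imp_orthonormal_basis by blast
  then have "orthonormal_basis B gM p (SOME e. orthonormal_basis B gM p e)" by (rule someI_ex)
  from orthonormal_basis_components[OF this] show "Q.frame e0"
    "j \<in> {1..DIM('f)} \<Longrightarrow> (SOME e. orthonormal_basis B gM p e) j = \<iota> (e0 j)"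
    unfolding e0_def by auto
qed

lemma ricci_tensor_\<iota>: "ricci_tensor B gM p (\<iota> a) (\<iota> b) = Q.S e0 a b"
  unfolding ricci_tensor_def Let_def Q.S_def
  by (intro sum.cong refl) (simp only: e0_eq Rm_\<iota>)

lemma mean_curvature_eq:
  "mean_curvature B A g F p = A.CF D ((1 / real DIM('f)) *\<^sub>R Q.tr e0) (F p)"
proof -
  have "(\<Sum>j=1..DIM('f). second_fundamental_form B A g F p
      ((SOME e. orthonormal_basis B gM p e) j) ((SOME e. orthonormal_basis B gM p e) j))
    = (\<Sum>j=1..DIM('f). A.CF D (I.sff x0 (e0 j) (e0 j)) (F p))"
    by (intro sum.cong refl) (simp only: e0_eq sff_\<iota>)
  then show ?thesis
    by (simp add: mean_curvature_def Let_def Q.tr_def A.CF_simps DA linear_sum[OF A.CF_linear[OF DA]])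
qed

text \<open>The factor 1/n in the mean curvature is undone by the square of n, which is why the
  bounds carry that square.\<close>

lemma mean_curvature_norm:
  "(real DIM('f))\<^sup>2 * g (F p) (mean_curvature B A g F p) (mean_curvature B A g F p)
    = A.gc g D y0 (Q.tr e0) (Q.tr e0)"
  unfolding mean_curvature_eq g_CF
  by (simp add: Q.N.g_simps power2_eq_square)

lemma CF_eq_0: "A.CF D a (F p) = 0 \<longleftrightarrow> a = 0"
  using A.CF_self[OF DA] A.CF_simps(4)[OF DA] by (metis zero_fun_apply)

lemma mean_curvature_eq_0: "mean_curvature B A g F p = 0 \<longleftrightarrow> Q.tr e0 = 0"
  unfolding mean_curvature_eq CF_eq_0 by simp

text \<open>The basis selected in \<open>ricci_curvature\<close> depends on the vector and need not
  be \<open>e0\<close>; it is handed over with its properties, to be compared with \<open>e0\<close>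
  through \<open>Q.tr_independent\<close>.\<close>

lemma ricci_curvature_\<iota>:
  assumes U: "I.gM x0 u u = 1"
  obtains e where "Q.frame e" "e 1 = u" "ricci_curvature B gM p (\<iota> u) = Q.ric e"
proof -
  let ?P = "\<lambda>e. orthonormal_basis B gM p e \<and> e 1 = \<iota> u"
  obtain e where "Q.frame e" "e 1 = u" using Q.extend_to_frame[OF U] .
  then have "\<exists>e. ?P e" using frame_imp_orthonormal_basis by blast
  then have P: "?P (SOME e. ?P e)" by (rule someI_ex)
  define e' where "e' j = (SOME e. ?P e) j C" for j
  have e': "Q.frame e'" "\<And>j. j \<in> {1..DIM('f)} \<Longrightarrow> (SOME e. ?P e) j = \<iota> (e' j)"
    using orthonormal_basis_components[OF conjunct1[OF P]] unfolding e'_def by auto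
  have e1: "e' 1 = u" using P by (simp add: e'_def \<iota>_self)
  have "ricci_curvature B gM p (\<iota> u) = Q.ric e'"
    unfolding ricci_curvature_def Let_def Q.ric_def sectional_curvature_def
  proof (intro sum.cong refl)
    fix j assume "j \<in> {2..DIM('f)}"
    then have "j \<in> {1..DIM('f)}" "1 \<in> {1..DIM('f)}" by auto
    then show "gM p (curvature B gM p ((SOME e. ?P e) 1) ((SOME e. ?P e) j) ((SOME e. ?P e) j))
        ((SOME e. ?P e) 1) = Q.Rm (e' 1) (e' j) (e' j) (e' 1)"
      by (simp only: e'(2) Rm_\<iota>)
  qed
  with that e'(1) e1 show ?thesis by blast
qed

lemma relative_null_space_\<iota>:
  "\<iota> u \<in> relative_null_space B A g F p \<longleftrightarrow> (\<forall>v. I.sff x0 u v = 0)"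
  unfolding relative_null_space_def tangent_eq_\<iota> by (auto simp: sff_\<iota> CF_eq_0)

lemma totally_geodesic_\<iota>:
  "totally_geodesic_point B A g F p \<longleftrightarrow> (\<forall>u v. I.sff x0 u v = 0)"
  unfolding totally_geodesic_point_def tangent_eq_\<iota> by (auto simp: sff_\<iota> CF_eq_0)

end

theorem theorem6p2:
  fixes A :: "('a::{t2_space,second_countable_topology}, 'e::euclidean_space) chart set"
    and \<phi> :: "'a \<Rightarrow> ('a, 'e) tangent \<Rightarrow> ('a, 'e) tangent"
    and \<xi> :: "('a, 'e) vfield"
    and \<eta> :: "'a \<Rightarrow> ('a, 'e) tangent \<Rightarrow> real"
    and g :: "('a, 'e) metric_field"
    and f1 f2 f3 f4 f5 f6 :: "'a \<Rightarrow> real"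
    and B :: "('b::{t2_space,second_countable_topology}, 'f::euclidean_space) chart set"
    and F :: "'b \<Rightarrow> 'a"
    and n m :: nat
    and p :: 'b
  assumes "n \<ge> 3"
    and "DIM('f) = n"
    and "DIM('e) = 2 * m + 1"
    and "generalized_kappa_mu_contact_space_form A \<phi> \<xi> \<eta> g f1 f2 f3 f4 f5 f6"
    and "\<forall>x. f3 x = f1 x - 1"
    and "C_totally_real_submanifold B A \<xi> g F"
  shows
    "let gM = induced_metric B A g F;
         TM = tangent_space B p;
         Ric = ricci_curvature B gM p;
         S = ricci_tensor B gM p;
         H = mean_curvature B A g F p;
         H2 = g (F p) H H;
         c = f1 (F p)
     in
      (\<forall>U\<in>TM. gM p U U = 1 \<longrightarrow> Ric U \<le> 1/4 * (real n)\<^sup>2 * H2 + (real n - 1) * c) \<and>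
      (H = 0 \<longrightarrow>
        (\<forall>U\<in>TM. gM p U U = 1 \<longrightarrow>
          (Ric U = (real n - 1) * c \<longleftrightarrow> U \<in> relative_null_space B A g F p))) \<and>
      (\<forall>X\<in>TM. 4 * S X X \<le> ((real n)\<^sup>2 * H2 + 4 * (real n - 1) * c) * gM p X X) \<and>
      ((\<forall>X\<in>TM. \<forall>Y\<in>TM.
          4 * S X Y = ((real n)\<^sup>2 * H2 + 4 * (real n - 1) * c) * gM p X Y) \<longleftrightarrow>
        totally_geodesic_point B A g F p \<or> (n = 2 \<and> totally_umbilical_point B A g F p))"
proof -
  interpret kappa_mu_submanifold A \<phi> \<xi> \<eta> g B F f1 f2 f3 f4 f5 f6 p
  proof
    show contact: "contact_metric_manifold A \<phi> \<xi> \<eta> g"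
      and form: "generalized_kappa_mu_space_form A \<phi> \<xi> \<eta> g f1 f2 f3 f4 f5 f6"
      using assms(4) by (auto simp: generalized_kappa_mu_contact_space_form_def)
    show "smooth_manifold A"
      using contact by (simp add: contact_metric_manifold_def almost_contact_metric_manifold_def)
    show "smooth_manifold B" "immersion B A F"
      "u \<in> tangent_space B q \<Longrightarrow> g (F q) (\<xi> (F q)) (pushforward B A F q u) = 0" for q u
      using assms(6) by (auto simp: C_totally_real_submanifold_def)
    show "f3 (F p) = f1 (F p) - 1" using assms(5) by simp
  qed
  let ?H = "mean_curvature B A g F p" and ?c = "f1 (F p)" and ?t = "Q.tr e0"
  let ?tt = "A.gc g D y0 ?t ?t"
  have n: "real n = real DIM('f)" using assms(2) by simp
  have H2: "(real n)\<^sup>2 * g (F p) ?H ?H = ?tt"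
    using mean_curvature_norm by (simp add: n)
  have 1: "ricci_curvature B gM p (\<iota> u) \<le> 1/4 * (real n)\<^sup>2 * g (F p) ?H ?H + (real n - 1) * ?c"
    if u: "I.gM x0 u u = 1" for u
  proof -
    obtain e where e: "Q.frame e" "e 1 = u" "ricci_curvature B gM p (\<iota> u) = Q.ric e"
      using ricci_curvature_\<iota>[OF u] .
    show ?thesis
      using Q.ric_le[OF e(1)] Q.tr_independent[OF e(1) e0] H2 by (simp add: e(3) n)
  qed
  have 2: "ricci_curvature B gM p (\<iota> u) = (real n - 1) * ?c \<longleftrightarrow> \<iota> u \<in> relative_null_space B A g F p"
    if H: "?H = 0" and u: "I.gM x0 u u = 1" for u
  proof -
    obtain e where e: "Q.frame e" "e 1 = u" "ricci_curvature B gM p (\<iota> u) = Q.ric e"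
      using ricci_curvature_\<iota>[OF u] .
    show ?thesis
      using Q.ric_eq_iff_relative_null[OF e(1)] Q.tr_independent[OF e(1) e0] H e(2)
      by (simp add: e(3) n mean_curvature_eq_0 relative_null_space_\<iota>)
  qed
  have 3: "4 * Q.S e0 u u \<le> (?tt + 4 * (real n - 1) * ?c) * I.gM x0 u u" for u
    using Q.S_le[OF e0] by (simp add: n)
  have 4: "(\<forall>u v. 4 * Q.S e0 u v = (?tt + 4 * (real n - 1) * ?c) * I.gM x0 u v) \<longleftrightarrow>
      totally_geodesic_point B A g F p \<or> (n = 2 \<and> totally_umbilical_point B A g F p)"
    using Q.S_equality_imp_geodesic[OF e0] Q.S_geodesic[OF e0] assms(1,2)
    unfolding totally_geodesic_\<iota> n by auto
  show ?thesis
    unfolding Let_def H2 tangent_eq_\<iota>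
    using 1 2 3 4 by (simp add: gM_\<iota> ricci_tensor_\<iota>)
qed

end
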